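(* Let $\gamma=q-q^{-1}$. On $\mathcal A_q^+\otimes V'_\Lambda$ the operator $\mathcal O^J_{\Lambda'}(E_\beta)$ is $$\mathcal O^J_{\Lambda'}(E_\beta)={}_{Z_{11}}M\otimes1-M_{Z_{11}}\mathrm{Ad}(K_\beta)\otimes K_\beta^2+\sum_{i=1}^{n-1}\gamma q^{-1}M_{Z_{i+1,1}}\mathrm{Ad}(K_\beta)\otimes X_i^TK_\beta^2+\sum_{j=1}^{n-1}\gamma q^{-1}M_{Z_{1,j+1}}\mathrm{Ad}(K_\beta)\otimes Y_j^TK_\beta^2-\sum_{i,j=1}^{n-1}\gamma^2q^{-2}M_{Z_{i+1,j+1}}\mathrm{Ad}(K_\beta)\otimes X_i^TY_j^TK_\beta^2,$$ where ${}_aM(\psi)=a\psi$, $M_a(\psi)=\psi a$ and $\mathrm{Ad}(K_\beta)(\psi)=K_\beta\psi K_\beta^{-1}$ for $\psi\in\mathcal A_q^+$; $K_\beta$ acts on $V'_\Lambda$ by the dual module action; and $X_i^T,Y_j^T$ are the dual operators on $V'_\Lambda$ to $X_i,Y_j$ as acting in $V_\Lambda$, i.e. $(X_i^Tv',v)_\Lambda=(v',X_iv)_\Lambda$ and $(Y_j^Tv',v)_\Lambda=(v',Y_jv)_\Lambda$.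
   Context: Let $n\ge1$ and let $q\in\mathbb C\setminus\{0\}$ not be a root of unity. $\mathcal U_q=\mathcal U_q(su(n,n)^{\mathbb C})$ is the quantized enveloping algebra of type $A_{2n-1}$ over $\mathbb C$ with generators $E_\alpha,F_\alpha,K_\alpha^{\pm1}$, $\alpha\in\Pi=\{\mu_1,\dots,\mu_{n-1},\beta,\nu_1,\dots,\nu_{n-1}\}$; the Dynkin diagram is the chain $\mu_{n-1}-\cdots-\mu_1-\beta-\nu_1-\cdots-\nu_{n-1}$, with $(\alpha,\alpha)=2$, $(\alpha,\alpha')=-1$ for neighbours and $0$ otherwise. Relations: $K_\alpha E_{\alpha'}K_\alpha^{-1}=q^{(\alpha,\alpha')}E_{\alpha'}$, $K_\alpha F_{\alpha'}K_\alpha^{-1}=q^{-(\alpha,\alpha')}F_{\alpha'}$, $[E_\alpha,F_{\alpha'}]=\delta_{\alpha\alpha'}(K_\alpha-K_\alpha^{-1})/(q-q^{-1})$, and the quantum Serre relations. Coproduct: $\Delta(E_\alpha)=E_\alpha\otimes1+K_\alpha\otimes E_\alpha$, $\Delta(F_\alpha)=F_\alpha\otimes K_\alpha^{-1}+1\otimes F_\alpha$, $\Delta(K_\alpha)=K_\alpha\otimes K_\alpha$. Antipode: $S(E_\alpha)=-K_\alpha^{-1}E_\alpha$, $S(F_\alpha)=-F_\alpha K_\alpha$, $S(K_\alpha)=K_\alpha^{-1}$. Lusztig automorphisms: $T_\alpha(E_\alpha)=-F_\alpha K_\alpha$, $T_\alpha(F_\alpha)=-K_\alpha^{-1}E_\alpha$,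 $T_\alpha(K_\gamma)=K_\gamma K_\alpha^{-(\alpha,\gamma)}$ (here and in the next formulas $\gamma$ denotes a simple root); for neighbours $T_\alpha(E_\gamma)=E_\alpha E_\gamma-q^{-1}E_\gamma E_\alpha$, $T_\alpha(F_\gamma)=F_\gamma F_\alpha-qF_\alpha F_\gamma$; for $\gamma\ne\alpha$ not a neighbour $T_\alpha$ fixes $E_\gamma,F_\gamma$. For $1\le i,j\le n$: $Z_{ij}=T_{\nu_{j-1}}\cdots T_{\nu_1}T_{\mu_{i-1}}\cdots T_{\mu_1}(E_\beta)$, $W_{ij}=T_{\nu_{j-1}}\cdots T_{\nu_1}T_{\mu_{i-1}}\cdots T_{\mu_1}(F_\beta)$ (empty products are the identity). $\mathcal A_q^\pm$ are the subalgebras generated by the $Z_{ij}$ ($+$) and the $W_{ij}$ ($-$); they have bases $Z^{\mathbf a}=Z_{11}^{a_{11}}Z_{21}^{a_{21}}\cdots Z_{n1}^{a_{n1}}Z_{12}^{a_{12}}\cdots Z_{nn}^{a_{nn}}$ and $W^{\mathbf a}$ (same ordering), $\mathbf a\in\mathbb N_0^{n^2}$. For $1\le i,j\le n-1$: $X_i=T_{\mu_i}T_{\mu_{i-1}}\cdots T_{\mu_2}(F_{\mu_1})$ and $Y_j=T_{\nu_j}T_{\nu_{j-1}}\cdots T_{\nu_2}(F_{\nu_1})$. The pairing $(\cdot,\cdot)_J$ between $\mathcal A_q^-$ and $\mathcal A_q^+$ is the restriction of the $q$-Killing form (the unique bilinear pairing of $\mathcal U_q^{\le0}$ with $\mathcal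 U_q^{\ge0}$ with $(y,xx')_J=(\Delta(y),x'\otimes x)_J$, $(yy',x)_J=(y\otimes y',\Delta(x))_J$, $(K_\mu,K_\nu)_J=q^{-(\mu,\nu)}$, $(F_\alpha,E_{\alpha'})_J=-\delta_{\alpha\alpha'}(q-q^{-1})^{-1}$, $(K_\mu,E_\alpha)_J=0=(F_\alpha,K_\mu)_J$); explicitly $(W^{\mathbf b},Z^{\mathbf a})_J=\delta_{\mathbf a,\mathbf b}\left(\frac{-1}{q-q^{-1}}\right)^{|\mathbf a|}\prod_{i,j}[[a_{ij}]]!$, where $[[a]]=1+q^2+\cdots+q^{2a-2}$ and $|\mathbf a|=\sum a_{ij}$. Let $\mathcal U_q(\mathfrak k^{\mathbb C})$ be the subalgebra generated by all $K_\alpha^{\pm1}$ ($\alpha\in\Pi$) and $E_\alpha,F_\alpha$ for $\alpha\ne\beta$. Let $V_\Lambda$ be the finite-dimensional irreducible $\mathcal U_q(\mathfrak k^{\mathbb C})$-module with highest weight vector $v_\Lambda$ satisfying $K_{\mu_i}v_\Lambda=q^{\lambda_i^\mu}v_\Lambda$, $K_{\nu_i}v_\Lambda=q^{\lambda_i^\nu}v_\Lambda$, $K_\beta v_\Lambda=q^\lambda v_\Lambda$, with $\lambda_i^\mu,\lambda_i^\nu\in\mathbb N_0$ and $\lambda\in\mathbb R$ (a value of $q^\lambda$ being fixed). $V'_\Lambda$ is its dual space with canonical pairing $(v',v)_\Lambda$ and dual module action $(uv',v)_\Lambda=(v',S(u)v)_\Lambda$; its lowest weight is $\Lambda'=-\Lambda$.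 Extend $V_\Lambda$ to $\mathcal U_q(\mathfrak k^{\mathbb C})\mathcal A_q^+$ by letting all $Z_{ij}$ act by $0$; the quantized generalized Verma module is $\mathcal M(V_\Lambda)=\mathcal U_q\otimes_{\mathcal U_q(\mathfrak k^{\mathbb C})\mathcal A_q^+}V_\Lambda=\mathcal A_q^-\otimes V_\Lambda$, with left action denoted $L_\Lambda$. Pair $\mathcal M(V_\Lambda)$ with $\mathcal A_q^+\otimes V'_\Lambda$ by $(w\otimes v,z\otimes v')_J=(w,z)_J(v',v)_\Lambda$, for $w\in\mathcal A_q^-$, $z\in\mathcal A_q^+$. For $u\in\mathcal U_q$, $\mathcal O^J_{\Lambda'}(u)$ is the operator on $\mathcal A_q^+\otimes V'_\Lambda$ determined by $(\eta,\mathcal O^J_{\Lambda'}(u)\xi)_J=(L_\Lambda(S(u))\eta,\xi)_J$ for all $\eta\in\mathcal M(V_\Lambda)$, $\xi\in\mathcal A_q^+\otimes V'_\Lambda$.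
   Formalization: The products X_i^T K_β^2, Y_j^T K_β^2 and X_i^T Y_j^T K_β^2 on V'_Λ are taken with the left factor applied first (K_β^2 applied last); with ordinary composition the formula fails for n≥2, the X and Y terms being off by a factor q^{-2}. *)

theory Defs
  imports Complex_Main "HOL-Library.Poly_Mapping"
begin

section \<open>Complex vector spaces and algebras\<close>

class cvec = ab_group_add +
  fixes cscale :: "complex \<Rightarrow> 'a \<Rightarrow> 'a" (infixr \<open>*\<^sub>C\<close> 75)
  assumes cscale_add_right: "c *\<^sub>C (x + y) = c *\<^sub>C x + c *\<^sub>C y"
    and cscale_add_left: "(c + d) *\<^sub>C x = c *\<^sub>C x + d *\<^sub>C x"
    and cscale_cscale: "c *\<^sub>C d *\<^sub>C x = (c * d) *\<^sub>C x"
    and cscale_one: "1 *\<^sub>C x = x"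

class calg = cvec + ring_1 +
  assumes mult_cscale_left: "(c *\<^sub>C x) * y = c *\<^sub>C (x * y)"
    and mult_cscale_right: "x * (c *\<^sub>C y) = c *\<^sub>C (x * y)"

global_interpretation cvec: vector_space "cscale :: complex \<Rightarrow> 'a \<Rightarrow> 'a :: cvec"
  by unfold_locales (simp_all add: cscale_add_right cscale_add_left cscale_cscale cscale_one)

global_interpretation cvec: vector_space_pair
  "cscale :: complex \<Rightarrow> 'a \<Rightarrow> 'a :: cvec" "cscale :: complex \<Rightarrow> 'b \<Rightarrow> 'b :: cvec"
  by unfold_locales

abbreviation clinear :: "('a::cvec \<Rightarrow> 'b::cvec) \<Rightarrow> bool"
  where "clinear \<equiv> Vector_Spaces.linear (*\<^sub>C) (*\<^sub>C)"

lemma clinearI: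
  assumes "\<And>x y. f (x + y) = f x + f y" "\<And>c x. f (c *\<^sub>C x) = c *\<^sub>C f x"
  shows "clinear f"
  by (unfold_locales) (simp_all add: assms)

lemma clinear_add: "clinear f \<Longrightarrow> f (x + y) = f x + f y"
  and clinear_scale: "clinear f \<Longrightarrow> f (c *\<^sub>C x) = c *\<^sub>C f x"
  and clinear_zero: "clinear f \<Longrightarrow> f 0 = 0"
  by (simp_all add: cvec.linear_add cvec.linear_scale cvec.linear_0)

instantiation complex :: calg
begin
definition cscale_complex :: "complex \<Rightarrow> complex \<Rightarrow> complex" where "cscale_complex c x = c * x"
instance by standard (simp_all add: cscale_complex_def algebra_simps)
end

definition bilinear_on :: "'a::cvec set \<Rightarrow> 'b::cvec set \<Rightarrow> ('a \<Rightarrow> 'b \<Rightarrow> complex) \<Rightarrow> bool" where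
  "bilinear_on A B J \<longleftrightarrow>
     (\<forall>y\<in>A. \<forall>y'\<in>A. \<forall>x\<in>B. J (y + y') x = J y x + J y' x) \<and>
     (\<forall>y\<in>A. \<forall>x\<in>B. \<forall>c. J (c *\<^sub>C y) x = c * J y x) \<and>
     (\<forall>y\<in>A. \<forall>x\<in>B. \<forall>x'\<in>B. J y (x + x') = J y x + J y x') \<and>
     (\<forall>y\<in>A. \<forall>x\<in>B. \<forall>c. J y (c *\<^sub>C x) = c * J y x)"

definition calg_hom :: "('a::calg \<Rightarrow> 'b::calg) \<Rightarrow> bool" where
  "calg_hom f \<longleftrightarrow> clinear f \<and> f 1 = 1 \<and> (\<forall>x y. f (x * y) = f x * f y)"

definition calg_antihom :: "('a::calg \<Rightarrow> 'b::calg) \<Rightarrow> bool" where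
  "calg_antihom f \<longleftrightarrow> clinear f \<and> f 1 = 1 \<and> (\<forall>x y. f (x * y) = f y * f x)"

definition subalg :: "'a::calg set \<Rightarrow> bool" where
  "subalg B \<longleftrightarrow> cvec.subspace B \<and> 1 \<in> B \<and> (\<forall>x\<in>B. \<forall>y\<in>B. x * y \<in> B)"


section \<open>Dual spaces\<close>

typedef (overloaded) 'v dual = "{f :: 'v::cvec \<Rightarrow> complex. clinear f}"
  morphisms dual_app Abs_dual
  by (rule exI[of _ "\<lambda>_. 0"]) (simp add: clinearI)

setup_lifting type_definition_dual

instantiation dual :: (cvec) cvec
begin
lift_definition zero_dual :: "'a dual" is "\<lambda>_. 0" by (simp add: clinearI)
lift_definition plus_dual :: "'a dual \<Rightarrow> 'a dual \<Rightarrow> 'a dual" is "\<lambda>f g v. f v + g v"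
  by (rule clinearI) (simp_all add: clinear_add clinear_scale cscale_complex_def algebra_simps)
lift_definition uminus_dual :: "'a dual \<Rightarrow> 'a dual" is "\<lambda>f v. - f v"
  by (rule clinearI) (simp_all add: clinear_add clinear_scale cscale_complex_def algebra_simps)
lift_definition minus_dual :: "'a dual \<Rightarrow> 'a dual \<Rightarrow> 'a dual" is "\<lambda>f g v. f v - g v"
  by (rule clinearI) (simp_all add: clinear_add clinear_scale cscale_complex_def algebra_simps)
lift_definition cscale_dual :: "complex \<Rightarrow> 'a dual \<Rightarrow> 'a dual" is "\<lambda>c f v. c * f v"
  by (rule clinearI) (simp_all add: clinear_add clinear_scale cscale_complex_def algebra_simps)
instance by standard (transfer; simp add: fun_eq_iff algebra_simps)+
end

lift_definition transpose_op :: "('v::cvec \<Rightarrow> 'v) \<Rightarrow> 'v dual \<Rightarrow> 'v dual"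
  is "\<lambda>A f. if clinear A then (\<lambda>v. f (A v)) else (\<lambda>_. 0)"
  by (auto intro!: clinearI simp: clinear_add clinear_scale)

lemma dual_app_transpose_op: "clinear A \<Longrightarrow> dual_app (transpose_op A f) v = dual_app f (A v)"
  by transfer simp

lemma clinear_dual_app: "clinear (dual_app f)"
  using dual_app by blast


section \<open>Finitely supported functions and linear extension\<close>

instantiation poly_mapping :: (type, cvec) cvec
begin
lift_definition cscale_poly_mapping :: "complex \<Rightarrow> ('a \<Rightarrow>\<^sub>0 'b) \<Rightarrow> 'a \<Rightarrow>\<^sub>0 'b"
  is "\<lambda>c f k. c *\<^sub>C f k"
  by (rule finite_subset[rotated]) auto
instance
  by standard (transfer; simp add: fun_eq_iff cscale_add_right cscale_add_left cscale_cscale cscale_one)+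
end

lemma lookup_cscale: "Poly_Mapping.lookup (c *\<^sub>C p) k = c *\<^sub>C Poly_Mapping.lookup p k"
  by transfer simp

definition lin_ext :: "('k \<Rightarrow> 'c::cvec) \<Rightarrow> ('k \<Rightarrow>\<^sub>0 complex) \<Rightarrow> 'c" where
  "lin_ext h p = (\<Sum>k\<in>Poly_Mapping.keys p. Poly_Mapping.lookup p k *\<^sub>C h k)"

lemma lin_ext_superset:
  assumes "finite A" "Poly_Mapping.keys p \<subseteq> A"
  shows "lin_ext h p = (\<Sum>k\<in>A. Poly_Mapping.lookup p k *\<^sub>C h k)"
  unfolding lin_ext_def by (rule sum.mono_neutral_left) (use assms in \<open>auto simp: in_keys_iff\<close>)

lemma clinear_lin_ext: "clinear (lin_ext h)"
proof (rule clinearI)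
  fix p r :: "'a \<Rightarrow>\<^sub>0 complex"
  let ?A = "Poly_Mapping.keys p \<union> Poly_Mapping.keys r"
  have "lin_ext h (p + r) = (\<Sum>k\<in>?A. Poly_Mapping.lookup (p + r) k *\<^sub>C h k)"
    by (rule lin_ext_superset) (use Poly_Mapping.keys_add[of p r] in auto)
  also have "\<dots> = lin_ext h p + lin_ext h r"
    by (simp add: lin_ext_superset[of ?A] lookup_add cscale_add_left sum.distrib)
  finally show "lin_ext h (p + r) = lin_ext h p + lin_ext h r" .
next
  fix c and p :: "'a \<Rightarrow>\<^sub>0 complex"
  have "Poly_Mapping.keys (c *\<^sub>C p) \<subseteq> Poly_Mapping.keys p"
    by (auto simp: in_keys_iff lookup_cscale cscale_complex_def)
  then have "lin_ext h (c *\<^sub>C p) = (\<Sum>k\<in>Poly_Mapping.keys p. Poly_Mapping.lookup (c *\<^sub>C p) k *\<^sub>C h k)"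
    by (intro lin_ext_superset) auto
  then show "lin_ext h (c *\<^sub>C p) = c *\<^sub>C lin_ext h p"
    by (simp add: lin_ext_def lookup_cscale cscale_complex_def cvec.scale_sum_right cscale_cscale)
qed

lemma lin_ext_single: "lin_ext h (Poly_Mapping.single k c) = c *\<^sub>C h k"
  by (cases "c = 0") (simp_all add: lin_ext_def)


section \<open>Tensor products\<close>

abbreviation pure_pair :: "'a \<Rightarrow> 'b \<Rightarrow> ('a \<times> 'b) \<Rightarrow>\<^sub>0 complex"
  where "pure_pair a b \<equiv> Poly_Mapping.single (a, b) 1"

definition tensor_null :: "(('a::cvec \<times> 'b::cvec) \<Rightarrow>\<^sub>0 complex) set" where
  "tensor_null = cvec.span (
     {pure_pair (a + a') b - pure_pair a b - pure_pair a' b | a a' b. True} \<union>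
     {pure_pair a (b + b') - pure_pair a b - pure_pair a b' | a b b'. True} \<union>
     {pure_pair (c *\<^sub>C a) b - c *\<^sub>C pure_pair a b | a b c. True} \<union>
     {pure_pair a (c *\<^sub>C b) - c *\<^sub>C pure_pair a b | a b c. True})"

definition tensor_eq :: "(('a::cvec \<times> 'b::cvec) \<Rightarrow>\<^sub>0 complex) \<Rightarrow> (('a \<times> 'b) \<Rightarrow>\<^sub>0 complex) \<Rightarrow> bool" where
  "tensor_eq x y \<longleftrightarrow> x - y \<in> tensor_null"

lemma subspace_tensor_null: "cvec.subspace tensor_null"
  unfolding tensor_null_def by (rule cvec.subspace_span)

quotient_type (overloaded) ('a, 'b) tensor = "('a::cvec \<times> 'b::cvec) \<Rightarrow>\<^sub>0 complex" / tensor_eq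
proof (rule equivpI)
  note s = subspace_tensor_null
  show "reflp (tensor_eq :: (('a \<times> 'b) \<Rightarrow>\<^sub>0 complex) \<Rightarrow> _)"
    by (rule reflpI) (simp add: tensor_eq_def cvec.subspace_0[OF s])
  show "symp (tensor_eq :: (('a \<times> 'b) \<Rightarrow>\<^sub>0 complex) \<Rightarrow> _)"
    by (rule sympI) (use cvec.subspace_neg[OF s] in \<open>force simp: tensor_eq_def\<close>)
  show "transp (tensor_eq :: (('a \<times> 'b) \<Rightarrow>\<^sub>0 complex) \<Rightarrow> _)"
    by (rule transpI) (use cvec.subspace_add[OF s] in \<open>force simp: tensor_eq_def\<close>)
qed

instantiation tensor :: (cvec, cvec) cvec
begin
lift_definition zero_tensor :: "('a, 'b) tensor" is 0 .
lift_definition plus_tensor :: "('a, 'b) tensor \<Rightarrow> ('a, 'b) tensor \<Rightarrow> ('a, 'b) tensor" is "(+)"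
  unfolding tensor_eq_def using cvec.subspace_add[OF subspace_tensor_null] by (force simp: algebra_simps)
lift_definition uminus_tensor :: "('a, 'b) tensor \<Rightarrow> ('a, 'b) tensor" is "uminus"
  unfolding tensor_eq_def using cvec.subspace_neg[OF subspace_tensor_null] by (force simp: algebra_simps)
lift_definition minus_tensor :: "('a, 'b) tensor \<Rightarrow> ('a, 'b) tensor \<Rightarrow> ('a, 'b) tensor" is "(-)"
  unfolding tensor_eq_def using cvec.subspace_diff[OF subspace_tensor_null] by (force simp: algebra_simps)
lift_definition cscale_tensor :: "complex \<Rightarrow> ('a, 'b) tensor \<Rightarrow> ('a, 'b) tensor" is "(*\<^sub>C)"
  unfolding tensor_eq_def using cvec.subspace_scale[OF subspace_tensor_null]
  by (simp flip: cvec.scale_right_diff_distrib)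
instance
  by standard
    (transfer; simp add: tensor_eq_def cvec.subspace_0[OF subspace_tensor_null]
      cscale_add_right cscale_add_left cscale_cscale cscale_one algebra_simps)+
end

lift_definition tens :: "'a::cvec \<Rightarrow> 'b::cvec \<Rightarrow> ('a, 'b) tensor" (infixr \<open>\<otimes>\<^sub>t\<close> 72) is pure_pair .

lemma tens_add_left: "(a + a') \<otimes>\<^sub>t b = a \<otimes>\<^sub>t b + a' \<otimes>\<^sub>t b"
  apply transfer
  unfolding tensor_eq_def tensor_null_def
  by (rule cvec.span_base) (simp only: diff_diff_eq[symmetric], blast)

lemma tens_add_right: "a \<otimes>\<^sub>t (b + b') = a \<otimes>\<^sub>t b + a \<otimes>\<^sub>t b'"
  apply transfer
  unfolding tensor_eq_def tensor_null_def
  by (rule cvec.span_base) (simp only: diff_diff_eq[symmetric], blast)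

lemma tens_scale_left: "(c *\<^sub>C a) \<otimes>\<^sub>t b = c *\<^sub>C (a \<otimes>\<^sub>t b)"
  apply transfer
  unfolding tensor_eq_def tensor_null_def
  by (rule cvec.span_base) blast

lemma tens_scale_right: "a \<otimes>\<^sub>t (c *\<^sub>C b) = c *\<^sub>C (a \<otimes>\<^sub>t b)"
  apply transfer
  unfolding tensor_eq_def tensor_null_def
  by (rule cvec.span_base) blast

lemma tensor_induct:
  assumes tens: "\<And>a b. P (a \<otimes>\<^sub>t b)" and add: "\<And>x y. P x \<Longrightarrow> P y \<Longrightarrow> P (x + y)"
  shows "P (t :: ('a::cvec, 'b::cvec) tensor)"
proof -
  have z: "P 0"
    using tens[of "0 *\<^sub>C 0" 0] by (simp only: tens_scale_left) simp
  have sg: "P (abs_tensor (Poly_Mapping.single k v))" for k and v :: complex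
  proof -
    obtain a b where k: "k = (a, b)" by force
    have "Poly_Mapping.single k v = v *\<^sub>C pure_pair a b"
      by (rule poly_mapping_eqI)
        (simp add: k lookup_cscale cscale_complex_def lookup_single when_def)
    then have "abs_tensor (Poly_Mapping.single k v) = (v *\<^sub>C a) \<otimes>\<^sub>t b"
      by (simp only: tens_scale_left) (simp add: tens.abs_eq cscale_tensor.abs_eq)
    then show ?thesis using tens by simp
  qed
  have "P (abs_tensor p)" for p :: "('a \<times> 'b) \<Rightarrow>\<^sub>0 complex"
  proof (induction p rule: Poly_Mapping.update_induct)
    case const
    show ?case using z by (simp add: zero_tensor.abs_eq)
  next
    case (update f a b)
    have "Poly_Mapping.update a b f = f + Poly_Mapping.single a b"
      using update(1)
      by (intro poly_mapping_eqI) (auto simp: lookup_add lookup_single lookup_update when_def in_keys_iff)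
    then show ?case using update(3) sg by (simp add: plus_tensor.abs_eq[symmetric] add)
  qed
  then show ?thesis by (induction t) simp
qed

definition cbilinear :: "('a::cvec \<Rightarrow> 'b::cvec \<Rightarrow> 'c::cvec) \<Rightarrow> bool" where
  "cbilinear h \<longleftrightarrow> (\<forall>a. clinear (h a)) \<and> (\<forall>b. clinear (\<lambda>a. h a b))"

lemma cbilinearD:
  assumes "cbilinear h"
  shows "h (a + a') b = h a b + h a' b" "h a (b + b') = h a b + h a b'"
    "h (c *\<^sub>C a) b = c *\<^sub>C h a b" "h a (c *\<^sub>C b) = c *\<^sub>C h a b"
  using assms clinear_add[of "\<lambda>a. h a b"] clinear_scale[of "\<lambda>a. h a b"]
    clinear_add[of "h a"] clinear_scale[of "h a"]
  by (auto simp: cbilinear_def)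

lift_definition tensor_lift :: "('a::cvec \<Rightarrow> 'b::cvec \<Rightarrow> 'c::cvec) \<Rightarrow> ('a, 'b) tensor \<Rightarrow> 'c"
  is "\<lambda>h. if cbilinear h then lin_ext (\<lambda>(a, b). h a b) else (\<lambda>_. 0)"
proof -
  fix h :: "'a \<Rightarrow> 'b \<Rightarrow> 'c" and p r :: "('a \<times> 'b) \<Rightarrow>\<^sub>0 complex"
  assume eq: "tensor_eq p r"
  let ?L = "lin_ext (\<lambda>(a, b). h a b)"
  have "?L x = 0" if h: "cbilinear h" and x: "x \<in> tensor_null" for x
    using x unfolding tensor_null_def
  proof (rule cvec.linear_eq_0_on_span[OF clinear_lin_ext, rotated])
    fix y :: "('a \<times> 'b) \<Rightarrow>\<^sub>0 complex"
    assume "y \<in> {pure_pair (a + a') b - pure_pair a b - pure_pair a' b | a a' b. True} \<union>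
     {pure_pair a (b + b') - pure_pair a b - pure_pair a b' | a b b'. True} \<union>
     {pure_pair (c *\<^sub>C a) b - c *\<^sub>C pure_pair a b | a b c. True} \<union>
     {pure_pair a (c *\<^sub>C b) - c *\<^sub>C pure_pair a b | a b c. True}"
    then show "?L y = 0"
      by (auto simp: cvec.linear_diff[OF clinear_lin_ext] clinear_scale[OF clinear_lin_ext]
          lin_ext_single cscale_one cbilinearD[OF h])
  qed
  from this[of "p - r"] eq have "cbilinear h \<Longrightarrow> ?L p = ?L r"
    by (simp add: tensor_eq_def cvec.linear_diff[OF clinear_lin_ext])
  then show "(if cbilinear h then ?L else (\<lambda>_. 0)) p = (if cbilinear h then ?L else (\<lambda>_. 0)) r"
    by simp
qed

lemma tensor_lift_tens: "cbilinear h \<Longrightarrow> tensor_lift h (a \<otimes>\<^sub>t b) = h a b"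
  by transfer (simp add: lin_ext_single cscale_one)

lemma clinear_tensor_lift: "clinear (tensor_lift h)"
proof (rule clinearI)
  show "tensor_lift h (x + y) = tensor_lift h x + tensor_lift h y" for x y
    by transfer (simp add: clinear_add[OF clinear_lin_ext])
  show "tensor_lift h (c *\<^sub>C x) = c *\<^sub>C tensor_lift h x" for c x
    by transfer (simp add: clinear_scale[OF clinear_lin_ext])
qed

lemmas tensor_lift_add = clinear_add[OF clinear_tensor_lift]
  and tensor_lift_scale = clinear_scale[OF clinear_tensor_lift]

definition tensor_map :: "('a::cvec \<Rightarrow> 'c::cvec) \<Rightarrow> ('b::cvec \<Rightarrow> 'd::cvec) \<Rightarrow> ('a, 'b) tensor \<Rightarrow> ('c, 'd) tensor" where
  "tensor_map f g = tensor_lift (\<lambda>a b. f a \<otimes>\<^sub>t g b)"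

lemma tensor_map_tens:
  assumes "clinear f" "clinear g"
  shows "tensor_map f g (a \<otimes>\<^sub>t b) = f a \<otimes>\<^sub>t g b"
  unfolding tensor_map_def
  by (rule tensor_lift_tens)
    (auto simp: cbilinear_def clinear_add[OF assms(1)] clinear_add[OF assms(2)]
      clinear_scale[OF assms(1)] clinear_scale[OF assms(2)]
      tens_add_left tens_add_right tens_scale_left tens_scale_right intro!: clinearI)

text \<open>The tensor product algebra.\<close>

lemma cbilinear_mult_aux:
  "cbilinear (\<lambda>c d. (a * c) \<otimes>\<^sub>t (b * d :: 'b::calg))" for a :: "'a::calg"
  by (auto simp: cbilinear_def distrib_left mult_cscale_right
      tens_add_left tens_add_right tens_scale_left tens_scale_right intro!: clinearI)

definition tensor_mult_pure :: "'a::calg \<Rightarrow> 'b::calg \<Rightarrow> ('a, 'b) tensor \<Rightarrow> ('a, 'b) tensor" where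
  "tensor_mult_pure a b = tensor_lift (\<lambda>c d. (a * c) \<otimes>\<^sub>t (b * d))"

lemma tensor_mult_pure_tens: "tensor_mult_pure a b (c \<otimes>\<^sub>t d) = (a * c) \<otimes>\<^sub>t (b * d)"
  unfolding tensor_mult_pure_def by (rule tensor_lift_tens[OF cbilinear_mult_aux])

lemma tensor_mult_pure_add: "tensor_mult_pure a b (x + y) = tensor_mult_pure a b x + tensor_mult_pure a b y"
  unfolding tensor_mult_pure_def by (rule tensor_lift_add)

lemma tensor_mult_pure_scale: "tensor_mult_pure a b (k *\<^sub>C x) = k *\<^sub>C tensor_mult_pure a b x"
  unfolding tensor_mult_pure_def by (rule tensor_lift_scale)

lemma cbilinear_tensor_mult_pure: "cbilinear (\<lambda>a b. tensor_mult_pure a b s)"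
  unfolding cbilinear_def
proof (intro conjI allI clinearI)
  fix a a' :: 'a and b b' :: 'b and k
  note simps = tensor_mult_pure_tens tensor_mult_pure_add distrib_right tens_add_left tens_add_right
    tens_scale_left tens_scale_right mult_cscale_left cscale_add_right
  show "tensor_mult_pure a (b + b') s = tensor_mult_pure a b s + tensor_mult_pure a b' s"
    by (induction s rule: tensor_induct) (simp_all add: simps)
  show "tensor_mult_pure a (k *\<^sub>C b) s = k *\<^sub>C tensor_mult_pure a b s"
    by (induction s rule: tensor_induct) (simp_all add: simps)
  show "tensor_mult_pure (a + a') b s = tensor_mult_pure a b s + tensor_mult_pure a' b s"
    by (induction s rule: tensor_induct) (simp_all add: simps)
  show "tensor_mult_pure (k *\<^sub>C a) b s = k *\<^sub>C tensor_mult_pure a b s"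
    by (induction s rule: tensor_induct) (simp_all add: simps)
qed

lemma exists_functional:
  assumes "(x :: 'a::cvec) \<noteq> 0"
  obtains f :: "'a::cvec \<Rightarrow> complex" where "clinear f" "f x = 1"
proof -
  have "cvec.independent {x}" using assms by simp
  from cvec.linear_independent_extend[OF this, of "\<lambda>_. 1 :: complex"] that show ?thesis by auto
qed

instantiation tensor :: (calg, calg) calg
begin
definition one_tensor :: "('a, 'b) tensor" where "one_tensor = 1 \<otimes>\<^sub>t 1"
definition times_tensor :: "('a, 'b) tensor \<Rightarrow> ('a, 'b) tensor \<Rightarrow> ('a, 'b) tensor" where
  "times_tensor t s = tensor_lift (\<lambda>a b. tensor_mult_pure a b s) t"

lemma tens_times: "(a \<otimes>\<^sub>t b) * z = tensor_mult_pure a b z" for a :: "'a::calg" and b :: "'b::calg"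
  unfolding times_tensor_def by (rule tensor_lift_tens[OF cbilinear_tensor_mult_pure])

lemma tensor_mult_tens: "(a \<otimes>\<^sub>t b) * (c \<otimes>\<^sub>t d) = (a * c) \<otimes>\<^sub>t (b * d)"
  for a c :: "'a::calg" and b d :: "'b::calg"
  by (simp only: tens_times tensor_mult_pure_tens)

lemma tensor_distrib_right: "(x + y) * z = x * z + y * (z :: ('a::calg, 'b::calg) tensor)"
  by (simp add: times_tensor_def tensor_lift_add)

lemma tensor_scale_left: "(k *\<^sub>C x) * z = k *\<^sub>C (x * (z :: ('a::calg, 'b::calg) tensor))"
  by (simp add: times_tensor_def tensor_lift_scale)

lemma tensor_distrib_left: "x * (y + z) = x * y + x * (z :: ('a::calg, 'b::calg) tensor)"
proof (induction x rule: tensor_induct)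
  case (1 a b)
  then show ?case by (simp only: tens_times tensor_mult_pure_add)
next
  case (2 u v)
  then show ?case by (simp add: tensor_distrib_right)
qed

lemma tensor_scale_right: "x * (k *\<^sub>C z) = k *\<^sub>C (x * (z :: ('a::calg, 'b::calg) tensor))"
proof (induction x rule: tensor_induct)
  case (1 a b)
  then show ?case by (simp only: tens_times tensor_mult_pure_scale)
next
  case (2 u v)
  then show ?case by (simp add: tensor_distrib_right cscale_add_right)
qed

instance
proof
  fix x y z :: "('a, 'b) tensor" and k
  show "x * y * z = x * (y * z)"
  proof (induction x rule: tensor_induct)
    case (1 a b)
    show ?case
    proof (induction y rule: tensor_induct)
      case (1 c d)
      show ?case
        by (induction z rule: tensor_induct) (simp_all add: tensor_mult_tens tensor_distrib_left mult.assoc)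
    qed (simp add: tensor_distrib_left tensor_distrib_right)
  qed (simp add: tensor_distrib_right)
  show "(x + y) * z = x * z + y * z" by (rule tensor_distrib_right)
  show "x * (y + z) = x * y + x * z" by (rule tensor_distrib_left)
  show "(k *\<^sub>C x) * y = k *\<^sub>C (x * y)" by (rule tensor_scale_left)
  show "x * (k *\<^sub>C y) = k *\<^sub>C (x * y)" by (rule tensor_scale_right)
  show "1 * x = x"
    by (induction x rule: tensor_induct) (simp_all add: one_tensor_def tensor_mult_tens tensor_distrib_left)
  show "x * 1 = x"
    by (induction x rule: tensor_induct) (simp_all add: one_tensor_def tensor_mult_tens tensor_distrib_right)
  obtain f :: "'a \<Rightarrow> complex" where f: "clinear f" "f 1 = 1" by (rule exists_functional[of 1]) auto
  obtain g :: "'b \<Rightarrow> complex" where g: "clinear g" "g 1 = 1" by (rule exists_functional[of 1]) auto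
  have "cbilinear (\<lambda>a b. f a * g b)"
    by (auto simp: cbilinear_def clinear_add[OF f(1)] clinear_add[OF g(1)]
      clinear_scale[OF f(1)] clinear_scale[OF g(1)] cscale_complex_def algebra_simps intro!: clinearI)
  from tensor_lift_tens[OF this, of 1 1] f g
  have "tensor_lift (\<lambda>a b. f a * g b) (1 :: ('a, 'b) tensor) = 1" by (simp add: one_tensor_def)
  moreover have "tensor_lift (\<lambda>a b. f a * g b) (0 :: ('a, 'b) tensor) = 0"
    by (rule clinear_zero[OF clinear_tensor_lift])
  ultimately show "(0 :: ('a, 'b) tensor) \<noteq> 1" by force
qed
end


section \<open>Free algebras\<close>

datatype 'g word = Word (letters: "'g list")

instantiation word :: (type) monoid_add
begin
definition zero_word :: "'a word" where "zero_word = Word []"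
definition plus_word :: "'a word \<Rightarrow> 'a word \<Rightarrow> 'a word" where
  "plus_word u v = Word (letters u @ letters v)"
instance by standard (simp_all add: zero_word_def plus_word_def)
end

text \<open>Multiplication of finitely supported functions on words is convolution along
  concatenation, so this is the free unital algebra on \<open>'g\<close>.\<close>

type_synonym 'g free_alg = "'g word \<Rightarrow>\<^sub>0 complex"

definition free_gen :: "'g \<Rightarrow> 'g free_alg" where
  "free_gen x = Poly_Mapping.single (Word [x]) 1"

definition free_eval :: "('g \<Rightarrow> 'u::calg) \<Rightarrow> 'g free_alg \<Rightarrow> 'u" where
  "free_eval g = lin_ext (\<lambda>w. prod_list (map g (letters w)))"

definition two_sided_ideal :: "'g free_alg set \<Rightarrow> 'g free_alg set" where
  "two_sided_ideal R = cvec.span {a * r * b | a r b. r \<in> R}"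


section \<open>The quantized enveloping algebra\<close>

text \<open>The simple roots are encoded as the integers from \<open>-(n-1)\<close> to \<open>n-1\<close>, in the
  order in which they occur in the Dynkin diagram.\<close>

abbreviation beta :: int where "beta \<equiv> 0"
abbreviation mu :: "nat \<Rightarrow> int" where "mu i \<equiv> - int i"
abbreviation nu :: "nat \<Rightarrow> int" where "nu j \<equiv> int j"

definition simple_roots :: "nat \<Rightarrow> int set" where
  "simple_roots n = {- (int n - 1) .. int n - 1}"

definition cartan :: "int \<Rightarrow> int \<Rightarrow> int" where
  "cartan \<alpha> \<alpha>' = (if \<alpha> = \<alpha>' then 2 else if \<bar>\<alpha> - \<alpha>'\<bar> = 1 then -1 else 0)"

datatype qgen = GE int | GF int | GK int | GKi int

text \<open>Generators whose index is not a simple root are set to zero, so that only those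
  indexed by simple roots remain in the quotient.\<close>

definition Uq_relators :: "nat \<Rightarrow> complex \<Rightarrow> qgen free_alg set" where
  "Uq_relators n q =
    (let E = \<lambda>\<alpha>. free_gen (GE \<alpha>); F = \<lambda>\<alpha>. free_gen (GF \<alpha>);
         K = \<lambda>\<alpha>. free_gen (GK \<alpha>); Ki = \<lambda>\<alpha>. free_gen (GKi \<alpha>);
         R = simple_roots n in
     (\<Union>\<alpha>\<in>-R. {E \<alpha>, F \<alpha>, K \<alpha>, Ki \<alpha>}) \<union>
     (\<Union>\<alpha>\<in>R. {K \<alpha> * Ki \<alpha> - 1, Ki \<alpha> * K \<alpha> - 1}) \<union>
     (\<Union>\<alpha>\<in>R. \<Union>\<alpha>'\<in>R.
        {K \<alpha> * K \<alpha>' - K \<alpha>' * K \<alpha>,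
         K \<alpha> * E \<alpha>' * Ki \<alpha> - (q powi cartan \<alpha> \<alpha>') *\<^sub>C E \<alpha>',
         K \<alpha> * F \<alpha>' * Ki \<alpha> - (q powi (- cartan \<alpha> \<alpha>')) *\<^sub>C F \<alpha>',
         E \<alpha> * F \<alpha>' - F \<alpha>' * E \<alpha>
           - (if \<alpha> = \<alpha>' then (1 / (q - inverse q)) *\<^sub>C (K \<alpha> - Ki \<alpha>) else 0)}) \<union>
     (\<Union>\<alpha>\<in>R. \<Union>\<alpha>'\<in>{\<alpha>'\<in>R. cartan \<alpha> \<alpha>' = 0}.
        {E \<alpha> * E \<alpha>' - E \<alpha>' * E \<alpha>, F \<alpha> * F \<alpha>' - F \<alpha>' * F \<alpha>}) \<union>
     (\<Union>\<alpha>\<in>R. \<Union>\<alpha>'\<in>{\<alpha>'\<in>R. cartan \<alpha> \<alpha>' = -1}.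
        {E \<alpha> * E \<alpha> * E \<alpha>' - (q + inverse q) *\<^sub>C (E \<alpha> * E \<alpha>' * E \<alpha>) + E \<alpha>' * E \<alpha> * E \<alpha>,
         F \<alpha> * F \<alpha> * F \<alpha>' - (q + inverse q) *\<^sub>C (F \<alpha> * F \<alpha>' * F \<alpha>) + F \<alpha>' * F \<alpha> * F \<alpha>}))"

text \<open>\<open>'u\<close>, with the images \<open>g\<close> of the generators, is the algebra with these generators and
  relations.\<close>

definition Uq_presented :: "nat \<Rightarrow> complex \<Rightarrow> (qgen \<Rightarrow> 'u::calg) \<Rightarrow> bool" where
  "Uq_presented n q g \<longleftrightarrow>
     surj (free_eval g) \<and> {p. free_eval g p = 0} = two_sided_ideal (Uq_relators n q)"

definition K_pow :: "(qgen \<Rightarrow> 'u::calg) \<Rightarrow> int \<Rightarrow> int \<Rightarrow> 'u" where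
  "K_pow g \<alpha> m = (if m \<ge> 0 then g (GK \<alpha>) ^ nat m else g (GKi \<alpha>) ^ nat (- m))"

text \<open>\<open>K\<close> and the bilinear form on the root lattice, whose elements are given by their
  coefficients with respect to the simple roots.\<close>

definition K_lattice :: "nat \<Rightarrow> (qgen \<Rightarrow> 'u::calg) \<Rightarrow> (int \<Rightarrow> int) \<Rightarrow> 'u" where
  "K_lattice n g m = prod_list (map (\<lambda>\<alpha>. K_pow g \<alpha> (m \<alpha>)) [- (int n - 1) .. int n - 1])"

definition lattice_form :: "nat \<Rightarrow> (int \<Rightarrow> int) \<Rightarrow> (int \<Rightarrow> int) \<Rightarrow> int" where
  "lattice_form n m m' =
     (\<Sum>\<alpha>\<in>simple_roots n. \<Sum>\<alpha>'\<in>simple_roots n. m \<alpha> * m' \<alpha>' * cartan \<alpha> \<alpha>')"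

definition coproduct :: "nat \<Rightarrow> (qgen \<Rightarrow> 'u::calg) \<Rightarrow> ('u \<Rightarrow> ('u, 'u) tensor) \<Rightarrow> bool" where
  "coproduct n g \<Delta> \<longleftrightarrow> calg_hom \<Delta> \<and>
     (\<forall>\<alpha>\<in>simple_roots n.
        \<Delta> (g (GE \<alpha>)) = g (GE \<alpha>) \<otimes>\<^sub>t 1 + g (GK \<alpha>) \<otimes>\<^sub>t g (GE \<alpha>) \<and>
        \<Delta> (g (GF \<alpha>)) = g (GF \<alpha>) \<otimes>\<^sub>t g (GKi \<alpha>) + 1 \<otimes>\<^sub>t g (GF \<alpha>) \<and>
        \<Delta> (g (GK \<alpha>)) = g (GK \<alpha>) \<otimes>\<^sub>t g (GK \<alpha>))"

definition antipode :: "nat \<Rightarrow> (qgen \<Rightarrow> 'u::calg) \<Rightarrow> ('u \<Rightarrow> 'u) \<Rightarrow> bool" where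
  "antipode n g S \<longleftrightarrow> calg_antihom S \<and>
     (\<forall>\<alpha>\<in>simple_roots n.
        S (g (GE \<alpha>)) = - (g (GKi \<alpha>) * g (GE \<alpha>)) \<and>
        S (g (GF \<alpha>)) = - (g (GF \<alpha>) * g (GK \<alpha>)) \<and>
        S (g (GK \<alpha>)) = g (GKi \<alpha>))"

definition lusztig_automorphisms :: "nat \<Rightarrow> complex \<Rightarrow> (qgen \<Rightarrow> 'u::calg) \<Rightarrow> (int \<Rightarrow> 'u \<Rightarrow> 'u) \<Rightarrow> bool" where
  "lusztig_automorphisms n q g T \<longleftrightarrow>
     (\<forall>\<alpha>\<in>simple_roots n. calg_hom (T \<alpha>) \<and> bij (T \<alpha>) \<and>
        T \<alpha> (g (GE \<alpha>)) = - (g (GF \<alpha>) * g (GK \<alpha>)) \<and>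
        T \<alpha> (g (GF \<alpha>)) = - (g (GKi \<alpha>) * g (GE \<alpha>)) \<and>
        (\<forall>\<gamma>\<in>simple_roots n.
           T \<alpha> (g (GK \<gamma>)) = g (GK \<gamma>) * K_pow g \<alpha> (- cartan \<alpha> \<gamma>) \<and>
           (cartan \<alpha> \<gamma> = -1 \<longrightarrow>
              T \<alpha> (g (GE \<gamma>)) = g (GE \<alpha>) * g (GE \<gamma>) - inverse q *\<^sub>C (g (GE \<gamma>) * g (GE \<alpha>)) \<and>
              T \<alpha> (g (GF \<gamma>)) = g (GF \<gamma>) * g (GF \<alpha>) - q *\<^sub>C (g (GF \<alpha>) * g (GF \<gamma>))) \<and>
           (cartan \<alpha> \<gamma> = 0 \<longrightarrow>
              T \<alpha> (g (GE \<gamma>)) = g (GE \<gamma>) \<and> T \<alpha> (g (GF \<gamma>)) = g (GF \<gamma>))))"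

text \<open>\<open>fold\<close> applies the function for the first list element first.\<close>

definition Z_el :: "(qgen \<Rightarrow> 'u::calg) \<Rightarrow> (int \<Rightarrow> 'u \<Rightarrow> 'u) \<Rightarrow> nat \<Rightarrow> nat \<Rightarrow> 'u" where
  "Z_el g T i j = fold (\<lambda>k. T (nu k)) [1..<j] (fold (\<lambda>k. T (mu k)) [1..<i] (g (GE beta)))"

definition W_el :: "(qgen \<Rightarrow> 'u::calg) \<Rightarrow> (int \<Rightarrow> 'u \<Rightarrow> 'u) \<Rightarrow> nat \<Rightarrow> nat \<Rightarrow> 'u" where
  "W_el g T i j = fold (\<lambda>k. T (nu k)) [1..<j] (fold (\<lambda>k. T (mu k)) [1..<i] (g (GF beta)))"

definition X_el :: "(qgen \<Rightarrow> 'u::calg) \<Rightarrow> (int \<Rightarrow> 'u \<Rightarrow> 'u) \<Rightarrow> nat \<Rightarrow> 'u" where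
  "X_el g T i = fold (\<lambda>k. T (mu k)) [2..<Suc i] (g (GF (mu 1)))"

definition Y_el :: "(qgen \<Rightarrow> 'u::calg) \<Rightarrow> (int \<Rightarrow> 'u \<Rightarrow> 'u) \<Rightarrow> nat \<Rightarrow> 'u" where
  "Y_el g T j = fold (\<lambda>k. T (nu k)) [2..<Suc j] (g (GF (nu 1)))"

definition A_plus :: "nat \<Rightarrow> (qgen \<Rightarrow> 'u::calg) \<Rightarrow> (int \<Rightarrow> 'u \<Rightarrow> 'u) \<Rightarrow> 'u set" where
  "A_plus n g T = subalg hull {Z_el g T i j | i j. i \<in> {1..n} \<and> j \<in> {1..n}}"

definition A_minus :: "nat \<Rightarrow> (qgen \<Rightarrow> 'u::calg) \<Rightarrow> (int \<Rightarrow> 'u \<Rightarrow> 'u) \<Rightarrow> 'u set" where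
  "A_minus n g T = subalg hull {W_el g T i j | i j. i \<in> {1..n} \<and> j \<in> {1..n}}"

definition U_ge :: "nat \<Rightarrow> (qgen \<Rightarrow> 'u::calg) \<Rightarrow> 'u set" where
  "U_ge n g = subalg hull (\<Union>\<alpha>\<in>simple_roots n. {g (GE \<alpha>), g (GK \<alpha>), g (GKi \<alpha>)})"

definition U_le :: "nat \<Rightarrow> (qgen \<Rightarrow> 'u::calg) \<Rightarrow> 'u set" where
  "U_le n g = subalg hull (\<Union>\<alpha>\<in>simple_roots n. {g (GF \<alpha>), g (GK \<alpha>), g (GKi \<alpha>)})"

definition U_k :: "nat \<Rightarrow> (qgen \<Rightarrow> 'u::calg) \<Rightarrow> 'u set" where
  "U_k n g = subalg hull ((\<Union>\<alpha>\<in>simple_roots n. {g (GK \<alpha>), g (GKi \<alpha>)}) \<union>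
                           (\<Union>\<alpha>\<in>simple_roots n - {beta}. {g (GE \<alpha>), g (GF \<alpha>)}))"

definition U_kA :: "nat \<Rightarrow> (qgen \<Rightarrow> 'u::calg) \<Rightarrow> (int \<Rightarrow> 'u \<Rightarrow> 'u) \<Rightarrow> 'u set" where
  "U_kA n g T = cvec.span {k * a | k a. k \<in> U_k n g \<and> a \<in> A_plus n g T}"


section \<open>The \<open>q\<close>-Killing form\<close>

text \<open>The pairing of \<open>\<Delta> y\<close> with \<open>x' \<otimes> x\<close> is evaluated on an arbitrary representation of
  \<open>\<Delta> y\<close> as a sum of pure tensors of elements of \<open>U_le\<close>, and likewise for \<open>\<Delta> x\<close>.\<close>

definition q_Killing_form ::
    "nat \<Rightarrow> complex \<Rightarrow> (qgen \<Rightarrow> 'u::calg) \<Rightarrow> ('u \<Rightarrow> ('u, 'u) tensor) \<Rightarrow> ('u \<Rightarrow> 'u \<Rightarrow> complex) \<Rightarrow> bool" where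
  "q_Killing_form n q g \<Delta> J \<longleftrightarrow>
     bilinear_on (U_le n g) (U_ge n g) J \<and>
     (\<forall>y\<in>U_le n g. \<forall>x\<in>U_ge n g. \<forall>x'\<in>U_ge n g. \<forall>(N::nat) a b.
        (\<forall>k<N. a k \<in> U_le n g \<and> b k \<in> U_le n g) \<and> \<Delta> y = (\<Sum>k<N. a k \<otimes>\<^sub>t b k) \<longrightarrow>
        J y (x * x') = (\<Sum>k<N. J (a k) x' * J (b k) x)) \<and>
     (\<forall>y\<in>U_le n g. \<forall>y'\<in>U_le n g. \<forall>x\<in>U_ge n g. \<forall>(N::nat) a b.
        (\<forall>k<N. a k \<in> U_ge n g \<and> b k \<in> U_ge n g) \<and> \<Delta> x = (\<Sum>k<N. a k \<otimes>\<^sub>t b k) \<longrightarrow>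
        J (y * y') x = (\<Sum>k<N. J y (a k) * J y' (b k))) \<and>
     (\<forall>m m'. J (K_lattice n g m) (K_lattice n g m') = q powi (- lattice_form n m m')) \<and>
     (\<forall>\<alpha>\<in>simple_roots n. \<forall>\<alpha>'\<in>simple_roots n.
        J (g (GF \<alpha>)) (g (GE \<alpha>')) = (if \<alpha> = \<alpha>' then - inverse (q - inverse q) else 0)) \<and>
     (\<forall>\<alpha>\<in>simple_roots n. \<forall>m.
        J (K_lattice n g m) (g (GE \<alpha>)) = 0 \<and> J (g (GF \<alpha>)) (K_lattice n g m) = 0)"


section \<open>The module \<open>V_\<Lambda>\<close> and the generalized Verma module\<close>

definition acts_on :: "'u::calg set \<Rightarrow> ('u \<Rightarrow> 'v::cvec \<Rightarrow> 'v) \<Rightarrow> bool" where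
  "acts_on B \<rho> \<longleftrightarrow>
     (\<forall>x\<in>B. clinear (\<rho> x)) \<and> (\<forall>v. \<rho> 1 v = v) \<and>
     (\<forall>x\<in>B. \<forall>y\<in>B. \<forall>v. \<rho> (x * y) v = \<rho> x (\<rho> y v)) \<and>
     (\<forall>x\<in>B. \<forall>y\<in>B. \<forall>v. \<rho> (x + y) v = \<rho> x v + \<rho> y v) \<and>
     (\<forall>x\<in>B. \<forall>c v. \<rho> (c *\<^sub>C x) v = c *\<^sub>C \<rho> x v)"

definition irreducible_on :: "'u::calg set \<Rightarrow> ('u \<Rightarrow> 'v::cvec \<Rightarrow> 'v) \<Rightarrow> bool" where
  "irreducible_on B \<rho> \<longleftrightarrow> (\<exists>v::'v. v \<noteq> 0) \<and>
     (\<forall>V. cvec.subspace V \<and> (\<forall>x\<in>B. \<forall>v\<in>V. \<rho> x v \<in> V) \<longrightarrow> V = {0} \<or> V = UNIV)"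

text \<open>\<open>qlam\<close> is a value of \<open>q^lam\<close>, i.e. taken with respect to some logarithm of \<open>q\<close>.\<close>

definition real_power_value :: "complex \<Rightarrow> real \<Rightarrow> complex \<Rightarrow> bool" where
  "real_power_value q lam qlam \<longleftrightarrow> (\<exists>h. exp h = q \<and> qlam = exp (of_real lam * h))"

text \<open>\<open>\<rho>\<close> is the action of \<open>U_k\<close> on \<open>V_\<Lambda> = 'v\<close>, extended to \<open>U_kA\<close>.\<close>

definition V_Lambda :: "nat \<Rightarrow> complex \<Rightarrow> (qgen \<Rightarrow> 'u::calg) \<Rightarrow> (int \<Rightarrow> 'u \<Rightarrow> 'u) \<Rightarrow>
    (nat \<Rightarrow> nat) \<Rightarrow> (nat \<Rightarrow> nat) \<Rightarrow> complex \<Rightarrow> ('u \<Rightarrow> 'v::cvec \<Rightarrow> 'v) \<Rightarrow> 'v \<Rightarrow> bool" where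
  "V_Lambda n q g T lmu lnu qlam \<rho> v\<^sub>0 \<longleftrightarrow>
     (\<exists>B::'v set. finite B \<and> cvec.span B = UNIV) \<and>
     acts_on (U_kA n g T) \<rho> \<and>
     irreducible_on (U_k n g) \<rho> \<and>
     v\<^sub>0 \<noteq> 0 \<and>
     (\<forall>\<alpha>\<in>simple_roots n - {beta}. \<rho> (g (GE \<alpha>)) v\<^sub>0 = 0) \<and>
     (\<forall>i\<in>{1..n-1}. \<rho> (g (GK (mu i))) v\<^sub>0 = (q ^ lmu i) *\<^sub>C v\<^sub>0 \<and>
                    \<rho> (g (GK (nu i))) v\<^sub>0 = (q ^ lnu i) *\<^sub>C v\<^sub>0) \<and>
     \<rho> (g (GK beta)) v\<^sub>0 = qlam *\<^sub>C v\<^sub>0 \<and>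
     (\<forall>i\<in>{1..n}. \<forall>j\<in>{1..n}. \<forall>v. \<rho> (Z_el g T i j) v = 0)"

definition dual_action :: "('u \<Rightarrow> 'u) \<Rightarrow> ('u \<Rightarrow> 'v::cvec \<Rightarrow> 'v) \<Rightarrow> 'u \<Rightarrow> 'v dual \<Rightarrow> 'v dual" where
  "dual_action S \<rho> u = transpose_op (\<rho> (S u))"

text \<open>\<open>'m\<close> with the canonical map \<open>\<kappa>\<close> from \<open>'u \<otimes> 'v\<close> is the module induced from the action \<open>\<rho>\<close>
  of \<open>P\<close>, i.e. the tensor product of \<open>'u\<close> and \<open>'v\<close> over \<open>P\<close>, with left action \<open>L\<close>.\<close>

definition induced_module :: "'u::calg set \<Rightarrow> ('u \<Rightarrow> 'v::cvec \<Rightarrow> 'v) \<Rightarrow>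
    (('u, 'v) tensor \<Rightarrow> 'm::cvec) \<Rightarrow> ('u \<Rightarrow> 'm \<Rightarrow> 'm) \<Rightarrow> bool" where
  "induced_module P \<rho> \<kappa> L \<longleftrightarrow>
     clinear \<kappa> \<and> surj \<kappa> \<and>
     {t. \<kappa> t = 0} = cvec.span {(u * p) \<otimes>\<^sub>t v - u \<otimes>\<^sub>t \<rho> p v | u p v. p \<in> P} \<and>
     (\<forall>u. clinear (L u) \<and> (\<forall>a v. L u (\<kappa> (a \<otimes>\<^sub>t v)) = \<kappa> ((u * a) \<otimes>\<^sub>t v)))"

text \<open>\<open>A \<otimes> V'\<close>, as a subspace of \<open>'u \<otimes> V'\<close>.\<close>

definition tensor_dual :: "'u::calg set \<Rightarrow> ('u, 'v::cvec dual) tensor set" where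
  "tensor_dual A = cvec.span {z \<otimes>\<^sub>t v' | z v'. z \<in> A}"

text \<open>The elements \<open>w \<otimes> v\<close> of the induced module are \<open>\<kappa> (w \<otimes>\<^sub>t v)\<close> with \<open>w\<close> in \<open>A_minus\<close>.\<close>

definition Verma_pairing :: "'u::calg set \<Rightarrow> 'u set \<Rightarrow> ('u \<Rightarrow> 'u \<Rightarrow> complex) \<Rightarrow>
    (('u, 'v::cvec) tensor \<Rightarrow> 'm::cvec) \<Rightarrow> ('m \<Rightarrow> ('u, 'v dual) tensor \<Rightarrow> complex) \<Rightarrow> bool" where
  "Verma_pairing Am Ap J \<kappa> B \<longleftrightarrow>
     bilinear_on UNIV (tensor_dual Ap) B \<and>
     (\<forall>w\<in>Am. \<forall>z\<in>Ap. \<forall>v v'. B (\<kappa> (w \<otimes>\<^sub>t v)) (z \<otimes>\<^sub>t v') = J w z * dual_app v' v)"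

definition dual_operator :: "'u::calg set \<Rightarrow> ('u \<Rightarrow> 'u) \<Rightarrow> ('u \<Rightarrow> 'm::cvec \<Rightarrow> 'm) \<Rightarrow>
    ('m \<Rightarrow> ('u, 'v::cvec dual) tensor \<Rightarrow> complex) \<Rightarrow> 'u \<Rightarrow> ('u, 'v dual) tensor \<Rightarrow> ('u, 'v dual) tensor" where
  "dual_operator Ap S L B u \<xi> =
     (THE \<zeta>. \<zeta> \<in> tensor_dual Ap \<and> (\<forall>\<eta>. B \<eta> \<zeta> = B (L (S u) \<eta>) \<xi>))"

definition lmult :: "'u::calg \<Rightarrow> 'u \<Rightarrow> 'u" where "lmult a \<psi> = a * \<psi>"
definition rmult :: "'u::calg \<Rightarrow> 'u \<Rightarrow> 'u" where "rmult a \<psi> = \<psi> * a"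

definition Ad_K :: "(qgen \<Rightarrow> 'u::calg) \<Rightarrow> int \<Rightarrow> 'u \<Rightarrow> 'u" where
  "Ad_K g \<alpha> \<psi> = g (GK \<alpha>) * \<psi> * g (GKi \<alpha>)"

text \<open>Convention for products of operators on \<open>V'\<close>: transposition reverses composition, and a
  product is written in the order of the operators on \<open>V\<close> to which its factors are dual, so the
  left factor is applied first. The product of \<open>X\<^sup>T\<close> and \<open>K\<^sup>2\<close> thus sends \<open>v'\<close> to the functional
  \<open>v \<mapsto> (v', X K\<^sup>-\<^sup>2 v)\<close>. The order matters: for \<open>X = X_i\<close> (or \<open>Y_j\<close>) and \<open>K = K_\<beta>\<close> the other one,
  \<open>v \<mapsto> (v', K\<^sup>-\<^sup>2 X v)\<close>, is \<open>q\<^sup>-\<^sup>2\<close> times this functional, and with it the adjointness relation that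
  determines the operator of \<open>E_\<beta>\<close> fails for \<open>n \<ge> 2\<close>.\<close>

definition dual_times :: "('v::cvec dual \<Rightarrow> 'v dual) \<Rightarrow> ('v dual \<Rightarrow> 'v dual) \<Rightarrow> 'v dual \<Rightarrow> 'v dual"
    (infixl \<open>\<odot>\<close> 70) where
  "A \<odot> B = B \<circ> A"

end

theory Submission
  imports Defs
begin

text \<open>Pairing with \<open>E_\<beta>\<close> in one tensor factor of the coproduct defines skew derivations \<open>\<Phi>\<close> and \<open>\<Psi>\<close> of
  \<open>U^-\<close>, adjoint to right and left multiplication by \<open>E_\<beta>\<close>, with \<open>[E_\<beta>, w] = \<Phi> w - K_\<beta> \<Psi> w\<close>. Set
  \<open>x_0 = y_0 = 1\<close>, \<open>x_k = X_k\<close>, \<open>y_l = Y_l\<close>. For \<open>w\<close> in \<open>A^-\<close>, the element \<open>\<Psi> w\<close> lies in \<open>A^-\<close>, while \<open>\<Phi> w\<close> is a sum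
  of terms \<open>D_kl(w) x_k y_l K_\<beta>^-1\<close> with \<open>D_kl(w)\<close> in \<open>A^-\<close>. Modulo the left ideal generated by the other
  \<open>E_\<alpha>\<close>, whose skew derivations kill \<open>A^-\<close>, the element \<open>Z_(k+1,l+1)\<close> is a product of such \<open>E_\<alpha>\<close> with \<open>E_\<beta>\<close>
  on the right; hence \<open>D_kl\<close> is, up to an explicit scalar, adjoint to right multiplication by it. This
  gives the adjointness relation. It determines the operator because the pairing is nondegenerate on
  \<open>A^+\<close>: the quantum matrix relations show that ordered monomials span \<open>A^+\<close>, and on ordered monomials
  the pairing is triangular with nonzero diagonal, \<open>q\<close> not being a root of unity.\<close>

section \<open>Linear algebra\<close>

text \<open>No basis theorem for the algebra is invoked: spanning by ordered monomials together with
  triangularity already gives nondegeneracy. The root vectors built from E and those built from F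
  are treated once, through a skew commutator \<open>bracket s q\<close>, and all their relations
  are derived from the quantum Serre relations. The constants of the formula arise as follows. Let
  c0 = -1/(q - q^-1) be the pairing of F_\<alpha> with E_\<alpha>. Pairing a nonempty chain x_k with
  the matching product of simple E's gives c0 whatever k is: removing a letter costs c0 (q^-1 - q) =
  1 as long as letters remain, and c0 for the last one. Moving K_\<beta>^-1 past x_k gives q^-1,
  since only the first letter is adjacent to \<beta>. The quotient q^-1 / c0 = -(q - q^-1) q^-1 is
  what each nonzero index contributes; with the overall minus sign this explains the alternating
  signs. Ad(K_\<beta>) appears because S(E_\<beta>) = -K_\<beta>^-1 E_\<beta>: the coefficient D_kl
  has to be conjugated by K_\<beta> to be separated from the part acting on V, and the two factors
  K_\<beta>^-1 around the word in x_k and y_l make up the dual action of K_\<beta>^2.\<close>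

lemma functional_eqI:
  assumes "\<And>f :: 'a::cvec \<Rightarrow> complex. clinear f \<Longrightarrow> f x = f y"
  shows "x = y"
proof (rule ccontr)
  assume "x \<noteq> y"
  then have "x - y \<noteq> 0" by simp
  then obtain f :: "'a \<Rightarrow> complex" where f: "clinear f" "f (x - y) = 1" by (rule exists_functional)
  with assms[OF f(1)] show False by (simp add: cvec.linear_diff[OF f(1)])
qed

lemma clinear_compose: "clinear f \<Longrightarrow> clinear g \<Longrightarrow> clinear (\<lambda>x. f (g x))"
  by (auto intro!: clinearI simp: clinear_add clinear_scale)

lemma cscale_complex [simp]: "(c :: complex) *\<^sub>C d = c * d"
  by (simp add: cscale_complex_def)

lemmas functional_simps = clinear_add clinear_scale clinear_zero cvec.linear_diff cvec.linear_neg

lemmas calg_simps = mult_cscale_left mult_cscale_right cscale_cscale cscale_add_right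
  cvec.scale_right_diff_distrib distrib_left distrib_right left_diff_distrib right_diff_distrib mult.assoc

lemma clinear_mult_left: "clinear (\<lambda>x. a * x :: 'a::calg)"
  by (auto intro!: clinearI simp: calg_simps)

lemma clinear_mult_right: "clinear (\<lambda>x. x * a :: 'a::calg)"
  by (auto intro!: clinearI simp: calg_simps)

lemma calg_homD:
  assumes "calg_hom f"
  shows "clinear f" "f 1 = 1" "f (x * y) = f x * f y" "f (x + y) = f x + f y" "f (x - y) = f x - f y"
    "f (c *\<^sub>C x) = c *\<^sub>C f x" "f 0 = 0" "f (- x) = - f x"
  using assms by (auto simp: calg_hom_def functional_simps)

lemma calg_hom_id: "calg_hom (\<lambda>x. x)"
  by (auto simp: calg_hom_def intro: clinearI)

lemma calg_hom_comp: "calg_hom f \<Longrightarrow> calg_hom h \<Longrightarrow> calg_hom (\<lambda>x. f (h x))"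
  by (auto simp: calg_hom_def intro: clinear_compose)

lemma subspaceD:
  assumes "cvec.subspace A"
  shows "0 \<in> A" "x \<in> A \<Longrightarrow> y \<in> A \<Longrightarrow> x + y \<in> A" "x \<in> A \<Longrightarrow> y \<in> A \<Longrightarrow> x - y \<in> A"
    "x \<in> A \<Longrightarrow> c *\<^sub>C x \<in> A" "x \<in> A \<Longrightarrow> - x \<in> A"
  using assms by (auto simp: cvec.subspace_0 cvec.subspace_add cvec.subspace_diff cvec.subspace_scale cvec.subspace_neg)

lemma subspaceI:
  assumes "0 \<in> A" "\<And>x y. x \<in> A \<Longrightarrow> y \<in> A \<Longrightarrow> x + y \<in> A" "\<And>c x. x \<in> A \<Longrightarrow> c *\<^sub>C x \<in> A"
  shows "cvec.subspace A"
  using assms by (auto simp: cvec.subspace_def)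

lemma span_subsetI: "cvec.subspace A \<Longrightarrow> S \<subseteq> A \<Longrightarrow> cvec.span S \<subseteq> A"
  by (rule cvec.span_minimal)

lemma subalg_hull: "subalg (subalg hull A)"
proof (rule hull_in)
  fix T :: "'a set set"
  assume "Ball T subalg"
  then have T: "\<And>A. A \<in> T \<Longrightarrow> cvec.subspace A \<and> 1 \<in> A \<and> (\<forall>x\<in>A. \<forall>y\<in>A. x * y \<in> A)"
    by (simp add: subalg_def)
  then show "subalg (\<Inter> T)"
    unfolding subalg_def by (auto intro!: subspaceI) (blast dest: subspaceD)+
qed

lemma subalgD:
  assumes "subalg A"
  shows "cvec.subspace A" "0 \<in> A" "1 \<in> A" "x \<in> A \<Longrightarrow> y \<in> A \<Longrightarrow> x * y \<in> A" "x \<in> A \<Longrightarrow> y \<in> A \<Longrightarrow> x + y \<in> A"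
    "x \<in> A \<Longrightarrow> y \<in> A \<Longrightarrow> x - y \<in> A" "x \<in> A \<Longrightarrow> c *\<^sub>C x \<in> A" "x \<in> A \<Longrightarrow> - x \<in> A"
  using assms subspaceD[of A] by (auto simp: subalg_def)

lemma subalg_power: "subalg A \<Longrightarrow> x \<in> A \<Longrightarrow> x ^ k \<in> A"
  by (induction k) (auto intro: subalgD)

lemma subalgI:
  assumes "1 \<in> A" "\<And>x y. x \<in> A \<Longrightarrow> y \<in> A \<Longrightarrow> x + y \<in> A" "\<And>c x. x \<in> A \<Longrightarrow> c *\<^sub>C x \<in> A"
    "\<And>x y. x \<in> A \<Longrightarrow> y \<in> A \<Longrightarrow> x * y \<in> A"
  shows "subalg A"
  using assms assms(3)[of 1 0] by (auto simp: subalg_def intro!: subspaceI)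

lemma subalg_hull_least: "subalg A \<Longrightarrow> S \<subseteq> A \<Longrightarrow> subalg hull S \<subseteq> A"
  by (rule hull_minimal)

lemma subalg_hull_induct [consumes 1, case_names gen one add scale mult]:
  assumes "x \<in> subalg hull S"
    and "\<And>x. x \<in> S \<Longrightarrow> P x" "P 1"
    and "\<And>x y. x \<in> subalg hull S \<Longrightarrow> y \<in> subalg hull S \<Longrightarrow> P x \<Longrightarrow> P y \<Longrightarrow> P (x + y)"
    and "\<And>c x. x \<in> subalg hull S \<Longrightarrow> P x \<Longrightarrow> P (c *\<^sub>C x)"
    and "\<And>x y. x \<in> subalg hull S \<Longrightarrow> y \<in> subalg hull S \<Longrightarrow> P x \<Longrightarrow> P y \<Longrightarrow> P (x * y)"
  shows "P x"
proof -
  note h = subalgD[OF subalg_hull[of S]]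
  have "subalg hull S \<subseteq> {x \<in> subalg hull S. P x}"
    by (rule subalg_hull_least) (use assms h in \<open>auto intro!: subalgI intro: hull_inc\<close>)
  then show ?thesis using assms(1) by auto
qed

lemma span_induct_lin [consumes 1, case_names base zero add scale]:
  assumes "x \<in> cvec.span S" "\<And>x. x \<in> S \<Longrightarrow> P x" "P 0" "\<And>x y. P x \<Longrightarrow> P y \<Longrightarrow> P (x + y)"
    "\<And>c x. P x \<Longrightarrow> P (c *\<^sub>C x)"
  shows "P x"
  by (rule cvec.span_induct[OF assms(1), of P]) (use assms in \<open>auto intro!: subspaceI\<close>)


section \<open>Chains of root vectors\<close>

definition serre :: "complex \<Rightarrow> 'u::calg \<Rightarrow> 'u \<Rightarrow> bool" where
  "serre q a b \<longleftrightarrow> a * a * b - (q + inverse q) *\<^sub>C (a * b * a) + b * a * a = 0"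

text \<open>Algebra identities are checked after applying an arbitrary linear functional, which
  reduces them to arithmetic of complex numbers. The rules rewrite \<open>a a b\<close> in
  right-associated products; the four versions cover the presence or absence of factors around
  it.\<close>

lemma serre_functional:
  assumes "serre q a b" "clinear f"
  shows "f (x * (a * (a * (b * y)))) = (q + inverse q) * f (x * (a * (b * (a * y)))) - f (x * (b * (a * (a * y))))"
    "f (a * (a * (b * y))) = (q + inverse q) * f (a * (b * (a * y))) - f (b * (a * (a * y)))"
    "f (x * (a * (a * b))) = (q + inverse q) * f (x * (a * (b * a))) - f (x * (b * (a * a)))"
    "f (a * (a * b)) = (q + inverse q) * f (a * (b * a)) - f (b * (a * a))"
proof -
  have eq: "f (x * (a * a * b - (q + inverse q) *\<^sub>C (a * b * a) + b * a * a) * y) = 0" for x y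
    using assms by (simp add: serre_def clinear_zero)
  show "f (x * (a * (a * (b * y)))) = (q + inverse q) * f (x * (a * (b * (a * y)))) - f (x * (b * (a * (a * y))))"
    using eq[of x y] by (simp add: calg_simps functional_simps[OF assms(2)] algebra_simps)
  show "f (a * (a * (b * y))) = (q + inverse q) * f (a * (b * (a * y))) - f (b * (a * (a * y)))"
    using eq[of 1 y] by (simp add: calg_simps functional_simps[OF assms(2)] algebra_simps)
  show "f (x * (a * (a * b))) = (q + inverse q) * f (x * (a * (b * a))) - f (x * (b * (a * a)))"
    using eq[of x 1] by (simp add: calg_simps functional_simps[OF assms(2)] algebra_simps)
  show "f (a * (a * b)) = (q + inverse q) * f (a * (b * a)) - f (b * (a * a))"
    using eq[of 1 1] by (simp add: calg_simps functional_simps[OF assms(2)] algebra_simps)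
qed

lemma serre_hom: "calg_hom h \<Longrightarrow> serre q a b \<Longrightarrow> serre q (h a) (h b)"
  unfolding serre_def by (drule arg_cong[of _ _ h]) (simp add: calg_homD)

lemma commute_left: "(a::'u::calg) * c = c * a \<Longrightarrow> a * (c * y) = c * (a * y)"
  by (metis mult.assoc)

text \<open>The Serre expression is linear in \<open>b\<close>, and \<open>c\<close> can be pulled
  out of it on either side because it commutes with \<open>a\<close>.\<close>

lemma serre_bracket:
  assumes "a * c = c * a" "serre q a b"
  shows "serre q a (s *\<^sub>C (c * b - t *\<^sub>C (b * c)))"
proof -
  let ?S = "\<lambda>b. a * a * b - (q + inverse q) *\<^sub>C (a * b * a) + b * a * a"
  note c = assms(1) commute_left[OF assms(1)]
  have "?S (s *\<^sub>C (c * b - t *\<^sub>C (b * c))) = s *\<^sub>C (c * ?S b - t *\<^sub>C (?S b * c))"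
    by (simp add: calg_simps c algebra_simps)
  then show ?thesis using assms(2) by (simp add: serre_def)
qed

text \<open>Common form of the action of \<open>T\<close> on a neighbouring generator:
  \<open>s = 1\<close> gives the rule for F, and \<open>s = - inverse q\<close> the rule for E,
  since \<open>E_\<alpha> E_\<gamma> - q^-1 E_\<gamma> E_\<alpha> = - q^-1 (E_\<gamma> E_\<alpha> -
  q E_\<alpha> E_\<gamma>)\<close>.\<close>

definition bracket :: "complex \<Rightarrow> complex \<Rightarrow> 'u::calg \<Rightarrow> 'u \<Rightarrow> 'u" where
  "bracket s q a x = s *\<^sub>C (x * a - q *\<^sub>C (a * x))"

primrec brackets :: "complex \<Rightarrow> complex \<Rightarrow> (nat \<Rightarrow> 'u::calg) \<Rightarrow> 'u \<Rightarrow> nat \<Rightarrow> 'u" where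
  "brackets s q f x 0 = x"
| "brackets s q f x (Suc k) = bracket s q (f k) (brackets s q f x k)"

lemma bracket_hom: "calg_hom h \<Longrightarrow> h (bracket s q a x) = bracket s q (h a) (h x)"
  by (simp add: bracket_def calg_homD)

lemma brackets_hom:
  assumes "calg_hom h" "\<And>i. i < k \<Longrightarrow> h (f i) = f' i"
  shows "h (brackets s q f x k) = brackets s q f' (h x) k"
  using assms(2) by (induction k) (simp_all add: bracket_hom[OF assms(1)])

lemma bracket_bracket:
  assumes "a * b = b * a"
  shows "bracket s q a (bracket s q b x) = bracket s q b (bracket s q a x)"
proof -
  note c = assms commute_left[OF assms]
  show ?thesis
    by (simp add: bracket_def calg_simps c mult_ac)
qed

lemma brackets_bracket:
  assumes "\<And>i. i < k \<Longrightarrow> a * f i = f i * a"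
  shows "brackets s q f (bracket s q a x) k = bracket s q a (brackets s q f x k)"
  using assms by (induction k) (simp_all add: bracket_bracket)

lemma commute_bracket:
  assumes "c * a = a * c" "c * x = x * (c :: 'u::calg)"
  shows "c * bracket s q a x = bracket s q a x * c"
  using assms commute_left[OF assms(1)] commute_left[OF assms(2)] by (simp add: bracket_def calg_simps)

lemma commute_brackets:
  assumes "\<And>i. i < k \<Longrightarrow> c * f i = f i * c" "c * x = x * (c :: 'u::calg)"
  shows "c * brackets s q f x k = brackets s q f x k * c"
  using assms(1) by (induction k) (simp_all add: commute_bracket assms(2))

text \<open>Abstraction of one row or column of root vectors: \<open>w 0, f 0, f 1, ...\<close>
  satisfy the relations of a type A diagram in this order, and \<open>w i\<close> is the root vector
  of its first \<open>i + 1\<close> nodes.\<close>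

locale qchain =
  fixes q s :: complex and N :: nat and f w :: "nat \<Rightarrow> 'u::calg"
  assumes q0: "q \<noteq> 0" and q2: "q + inverse q \<noteq> 0"
    and w_Suc_bracket: "i < N \<Longrightarrow> w (Suc i) = bracket s q (f i) (w i)"
    and f_comm: "i < N \<Longrightarrow> j < N \<Longrightarrow> Suc i < j \<Longrightarrow> f j * f i = f i * f j"
    and f_serre: "Suc i < N \<Longrightarrow> serre q (f i) (f (Suc i))" "Suc i < N \<Longrightarrow> serre q (f (Suc i)) (f i)"
    and f_w0: "0 < i \<Longrightarrow> i < N \<Longrightarrow> f i * w 0 = w 0 * f i"
    and w0_serre: "0 < N \<Longrightarrow> serre q (f 0) (w 0)" "0 < N \<Longrightarrow> serre q (w 0) (f 0)"
begin

lemmas w_Suc = w_Suc_bracket[unfolded bracket_def]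

lemma commute_step:
  assumes "a * b = b * a" "a * c = c * (a :: 'u)"
  shows "a * (s *\<^sub>C (b * c - q *\<^sub>C (c * b))) = (s *\<^sub>C (b * c - q *\<^sub>C (c * b))) * a"
  using assms commute_left[OF assms(1)] commute_left[OF assms(2)] by (simp add: calg_simps)

lemma f_w_greater: "i < m \<Longrightarrow> m < N \<Longrightarrow> f m * w i = w i * f m"
proof (induction i)
  case 0 then show ?case using f_w0 by simp
next
  case (Suc i)
  have "f m * w i = w i * f m" "f m * f i = f i * f m" using Suc f_comm by auto
  with Suc.prems show ?case by (simp add: w_Suc commute_step)
qed

text \<open>\<open>w m\<close> is a bracket of \<open>w (m - 1)\<close>, which commutes with
  \<open>f m\<close>, and \<open>f (m - 1)\<close>, which satisfies the Serre relation with
  \<open>f m\<close>; so \<open>serre_bracket\<close> applies.\<close>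

lemma f_w_serre: "m < N \<Longrightarrow> serre q (f m) (w m)"
proof (cases m)
  case 0 then show "m < N \<Longrightarrow> ?thesis" using w0_serre by simp
next
  case (Suc k)
  assume "m < N"
  with Suc show ?thesis
    using w_Suc[of k] f_w_greater[of k m] f_serre[of k] by (simp add: serre_bracket)
qed

text \<open>After expansion of \<open>w (Suc m)\<close> this is a multiple of the Serre relation
  between \<open>f m\<close> and \<open>w m\<close>.\<close>

lemma f_w_Suc:
  assumes "m < N" shows "f m * w (Suc m) = q *\<^sub>C (w (Suc m) * f m)"
proof (rule functional_eqI)
  fix h :: "'u \<Rightarrow> complex" assume h: "clinear h"
  show "h (f m * w (Suc m)) = h (q *\<^sub>C (w (Suc m) * f m))"
    using assms q0
    by (simp add: w_Suc calg_simps functional_simps[OF h] serre_functional[OF f_w_serre[OF assms] h] field_simps)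
qed

text \<open>In a chain \<open>a - b - c\<close> the middle generator commutes with the root vector
  of the whole chain, as a consequence of the two Serre relations at \<open>b\<close>.\<close>

lemma middle_commute:
  assumes ac: "a * c = c * a" and ba: "serre q b a" and bc: "serre q b (c::'u)"
  shows "b * (r *\<^sub>C ((s *\<^sub>C (a * b - q *\<^sub>C (b * a))) * c - q *\<^sub>C (c * (s *\<^sub>C (a * b - q *\<^sub>C (b * a)))))) =
    (r *\<^sub>C ((s *\<^sub>C (a * b - q *\<^sub>C (b * a))) * c - q *\<^sub>C (c * (s *\<^sub>C (a * b - q *\<^sub>C (b * a)))))) * b"
proof -
  let ?q = "q + inverse q"
  note c = ac commute_left[OF ac]
  have S: "?q *\<^sub>C (b * a * b) = b * b * a + a * b * b" "?q *\<^sub>C (b * c * b) = b * b * c + c * b * b"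
    using ba bc by (simp_all add: serre_def algebra_simps)
  have 1: "?q *\<^sub>C (b * (a * (b * c))) = b * (b * (a * c)) + a * (b * (b * c))"
    using arg_cong[OF S(1), of "\<lambda>x. x * c"] by (simp add: calg_simps)
  have 2: "?q *\<^sub>C (a * (b * (c * b))) = a * (b * (b * c)) + a * (c * (b * b))"
    using arg_cong[OF S(2), of "\<lambda>x. a * x"] by (simp add: calg_simps)
  have 3: "?q *\<^sub>C (b * (c * (b * a))) = b * (b * (c * a)) + c * (b * (b * a))"
    using arg_cong[OF S(2), of "\<lambda>x. x * a"] by (simp add: calg_simps)
  have 4: "?q *\<^sub>C (c * (b * (a * b))) = c * (b * (b * a)) + c * (a * (b * b))"
    using arg_cong[OF S(1), of "\<lambda>x. c * x"] by (simp add: calg_simps)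
  show ?thesis
  proof (rule functional_eqI)
    fix h :: "'u \<Rightarrow> complex" assume h: "clinear h"
    note H = functional_simps[OF h]
    have eqs: "?q * h (b * (a * (b * c))) = h (b * (b * (c * a))) + h (a * (b * (b * c)))"
      "?q * h (a * (b * (c * b))) = h (a * (b * (b * c))) + h (c * (a * (b * b)))"
      "?q * h (b * (c * (b * a))) = h (b * (b * (c * a))) + h (c * (b * (b * a)))"
      "?q * h (c * (b * (a * b))) = h (c * (b * (b * a))) + h (c * (a * (b * b)))"
      using arg_cong[OF 1, of h] arg_cong[OF 2, of h] arg_cong[OF 3, of h] arg_cong[OF 4, of h]
      by (simp_all add: H c)
    \<comment> \<open>The Serre relations give the four mixed words only after multiplication by
      \<open>q + inverse q\<close>; so that multiple of \<open>?D\<close> is shown to vanish and the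
      nonzero scalar is cancelled.\<close>
    have "h (b * (a * (b * c))) - q * h (b * (b * (c * a))) + q * (q * h (b * (c * (b * a))))
        - h (a * (b * (c * b))) + q * h (c * (a * (b * b))) - q * (q * h (c * (b * (a * b)))) = 0"
      (is "?D = 0")
    proof -
      have "p * (x1 - q * b1 + q * (q * x3) - x2 + q * b2 - q * (q * x4)) = 0"
        if "p * x1 = b1 + x" "p * x2 = x + b2" "p * x3 = b1 + y" "p * x4 = y + b2" "q * p = q * q + 1"
        for p x1 x2 x3 x4 b1 b2 x y :: complex
        using that by algebra
      from this[OF eqs] have "?q * ?D = 0" using q0 by (simp add: field_simps)
      then show ?thesis using q2 by simp
    qed
    moreover have "h (b * (r *\<^sub>C ((s *\<^sub>C (a * b - q *\<^sub>C (b * a))) * c - q *\<^sub>C (c * (s *\<^sub>C (a * b - q *\<^sub>C (b * a))))))) -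
      h ((r *\<^sub>C ((s *\<^sub>C (a * b - q *\<^sub>C (b * a))) * c - q *\<^sub>C (c * (s *\<^sub>C (a * b - q *\<^sub>C (b * a)))))) * b) = r * s * ?D"
      by (simp only: calg_simps H c cscale_complex) (simp add: algebra_simps)
    ultimately show "h (b * (r *\<^sub>C ((s *\<^sub>C (a * b - q *\<^sub>C (b * a))) * c - q *\<^sub>C (c * (s *\<^sub>C (a * b - q *\<^sub>C (b * a))))))) =
      h ((r *\<^sub>C ((s *\<^sub>C (a * b - q *\<^sub>C (b * a))) * c - q *\<^sub>C (c * (s *\<^sub>C (a * b - q *\<^sub>C (b * a)))))) * b)"
      by simp
  qed
qed

text \<open>The case \<open>i = m + 2\<close> is \<open>middle_commute\<close> for
  \<open>w m\<close>, \<open>f m\<close>, \<open>f (m + 1)\<close>; all later \<open>w i\<close>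
  arise from it by brackets with generators commuting with \<open>f m\<close>.\<close>

lemma f_w_less: "Suc m < i \<Longrightarrow> i \<le> N \<Longrightarrow> f m * w i = w i * f m"
proof (induction i)
  case (Suc i)
  show ?case
  proof (cases "i = Suc m")
    case True
    with Suc.prems have m: "m < N" "Suc m < N" by auto
    have "w m * f (Suc m) = f (Suc m) * w m" using f_w_greater[of m "Suc m"] m by simp
    from middle_commute[OF this f_w_serre[OF m(1)] f_serre(1)[OF m(2)]]
    show ?thesis using m by (simp add: True w_Suc)
  next
    case False
    with Suc have "f m * w i = w i * f m" "f m * f i = f i * f m" using f_comm[of m i] by auto
    with Suc.prems show ?thesis by (simp add: w_Suc commute_step)
  qed
qed simp

text \<open>For \<open>i = 0\<close> the induction on \<open>k\<close> starts from the Serre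
  relation between \<open>w 0\<close> and \<open>f 0\<close>; afterwards \<open>i\<close> is raised
  by the bracket with \<open>f i\<close>, which commutes with \<open>w k\<close>.\<close>

lemma w_w:
  assumes "i < k" "k \<le> N"
  shows "w i * w k = inverse q *\<^sub>C (w k * w i)"
  using assms
proof (induction i arbitrary: k)
  case 0
  then show ?case
  proof (induction k)
    case (Suc k)
    show ?case
    proof (cases "k = 0")
      case True
      show ?thesis
      proof (rule functional_eqI)
        fix h :: "'u \<Rightarrow> complex" assume h: "clinear h"
        show "h (w 0 * w (Suc k)) = h (inverse q *\<^sub>C (w (Suc k) * w 0))"
          using True Suc.prems q0
          by (simp add: w_Suc calg_simps functional_simps[OF h] serre_functional[OF w0_serre(2) h] field_simps)
      qed
    next
      case False
      with Suc have IH: "w 0 * w k = inverse q *\<^sub>C (w k * w 0)" and f: "f k * w 0 = w 0 * f k"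
        using f_w_greater[of 0 k] by auto
      from IH have IH': "w 0 * (w k * y) = inverse q *\<^sub>C (w k * (w 0 * y))" for y
        by (metis mult.assoc mult_cscale_left)
      show ?thesis using Suc.prems
        by (simp add: w_Suc calg_simps f IH IH' commute_left[OF f[symmetric]] mult_ac)
    qed
  qed simp
next
  case (Suc i)
  have f: "f i * w k = w k * f i" using f_w_less[of i k] Suc.prems by simp
  have IH: "w i * w k = inverse q *\<^sub>C (w k * w i)" using Suc by simp
  from IH have IH': "w i * (w k * y) = inverse q *\<^sub>C (w k * (w i * y))" for y
    by (metis mult.assoc mult_cscale_left)
  show ?case using Suc.prems
    by (simp add: w_Suc calg_simps f IH IH' commute_left[OF f] mult_ac)
qed

end

text \<open>Straightening rules that move the root vector \<open>x k\<close> of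
  \<open>f 0, ..., f k\<close> to the right of the \<open>w i\<close>. By weight, a correction by a
  single root vector is possible only for \<open>i = 0\<close>; for \<open>0 < i \<le> k\<close> the
  product \<open>w (k + 1) * x (i - 1)\<close> has the same weight as
  \<open>x k * w i\<close>.\<close>

lemma (in qchain) chain_w:
  fixes k i :: nat
  defines "x \<equiv> brackets 1 q (\<lambda>k. f (Suc k)) (f 0)"
  assumes s: "s = 1" and k: "k < N"
  shows "x k * w 0 = inverse q *\<^sub>C (w 0 * x k) - inverse q *\<^sub>C w (Suc k)"
    and "0 < i \<Longrightarrow> i \<le> k \<Longrightarrow> x k * w i = w i * x k + (q - inverse q) *\<^sub>C (w (Suc k) * x (i - 1))"
    and "x k * w (Suc k) = q *\<^sub>C (w (Suc k) * x k)"
    and "Suc k < i \<Longrightarrow> i \<le> N \<Longrightarrow> x k * w i = w i * x k"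
proof -
  have x0: "x 0 = f 0" and xS: "x (Suc m) = x m * f (Suc m) - q *\<^sub>C (f (Suc m) * x m)" for m
    by (simp_all add: x_def bracket_def cscale_one)
  have wS: "w (Suc m) = w m * f m - q *\<^sub>C (f m * w m)" if "m < N" for m
    using w_Suc[OF that] s by (simp add: cscale_one)
  \<comment> \<open>The recursion for \<open>w (Suc m)\<close>, solved for the product in the wrong
    order.\<close>
  have down: "f m * w m = inverse q *\<^sub>C (w m * f m) - inverse q *\<^sub>C w (Suc m)" if "m < N" for m
    using wS[OF that] q0 by (simp add: calg_simps cscale_one)
  have up: "f m * (w m * y) = inverse q *\<^sub>C (w m * (f m * y)) - inverse q *\<^sub>C (w (Suc m) * y)" if "m < N" for m y
    using arg_cong[OF down[OF that], of "\<lambda>a. a * y"] by (simp add: calg_simps)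
  have fx: "f m * x j = x j * f m" if "m < N" "Suc j < m" for m j
    using that
  proof (induction j)
    case 0 then show ?case by (simp add: x0 f_comm)
  next
    case (Suc j)
    then have a: "f m * x j = x j * f m" "f m * f (Suc j) = f (Suc j) * f m" using f_comm by auto
    show ?case using commute_left[OF a(1)] commute_left[OF a(2)] a by (simp add: xS calg_simps)
  qed
  have gt: "x k * w i = w i * x k" if "Suc k < i" "i \<le> N" for i k
    using that
  proof (induction k)
    case 0 then show ?case using f_w_less by (simp add: x0)
  next
    case (Suc k)
    then have a: "x k * w i = w i * x k" "f (Suc k) * w i = w i * f (Suc k)" using f_w_less by auto
    show ?case using commute_left[OF a(1)] commute_left[OF a(2)] a by (simp add: xS calg_simps)
  qed
  then show "Suc k < i \<Longrightarrow> i \<le> N \<Longrightarrow> x k * w i = w i * x k" .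
  have eq: "x k * w (Suc k) = q *\<^sub>C (w (Suc k) * x k)" if "k < N" for k
  proof (cases k)
    case 0 with that show ?thesis using f_w_Suc[of 0] by (simp add: x0)
  next
    case (Suc j)
    have a: "x j * w (Suc k) = w (Suc k) * x j" using gt that Suc by simp
    have b: "f k * w (Suc k) = q *\<^sub>C (w (Suc k) * f k)" using f_w_Suc that by simp
    then have b': "f k * (w (Suc k) * y) = q *\<^sub>C (w (Suc k) * (f k * y))" for y
      by (metis mult.assoc mult_cscale_left)
    show ?thesis using commute_left[OF a] a b b' unfolding Suc by (simp add: xS calg_simps)
  qed
  then show "x k * w (Suc k) = q *\<^sub>C (w (Suc k) * x k)" using k .
  show "x k * w 0 = inverse q *\<^sub>C (w 0 * x k) - inverse q *\<^sub>C w (Suc k)"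
    using k
  proof (induction k)
    case 0 then show ?case by (simp add: x0 down)
  next
    case (Suc k)
    then have a: "x k * w 0 = inverse q *\<^sub>C (w 0 * x k) - inverse q *\<^sub>C w (Suc k)" by simp
    have a': "x k * (w 0 * y) = inverse q *\<^sub>C (w 0 * (x k * y)) - inverse q *\<^sub>C (w (Suc k) * y)" for y
      using arg_cong[OF a, of "\<lambda>a. a * y"] by (simp add: calg_simps)
    have b: "f (Suc k) * w 0 = w 0 * f (Suc k)" using f_w0 Suc.prems by simp
    show ?case using Suc.prems commute_left[OF b]
      by (simp add: xS calg_simps a a' b wS[of "Suc k"] mult_ac)
  qed
  show "x k * w i = w i * x k + (q - inverse q) *\<^sub>C (w (Suc k) * x (i - 1))" if "0 < i" "i \<le> k"
    using that(2) k
  proof (induction k)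
    case 0 with that show ?case by simp
  next
    case (Suc k)
    have P: "x (i - 1) * w i = q *\<^sub>C (w i * x (i - 1))" using eq[of "i - 1"] that Suc.prems by simp
    then have P': "x (i - 1) * (w i * y) = q *\<^sub>C (w i * (x (i - 1) * y))" for y
      by (metis mult.assoc mult_cscale_left)
    \<comment> \<open>The correction first appears when the chain reaches \<open>f i\<close>; for
      longer chains it is only bracketed with the next generator.\<close>
    show ?case
    proof (cases "i = Suc k")
      case True
      have c: "x k * w (Suc (Suc k)) = w (Suc (Suc k)) * x k" using gt Suc.prems by simp
      show ?thesis
        using P P' Suc.prems q0 down[of "Suc k"] up[of "Suc k"] unfolding True
        by (simp add: xS calg_simps c cscale_one cscale_add_left cvec.scale_left_diff_distrib)
    next
      case False
      with Suc have a: "x k * w i = w i * x k + (q - inverse q) *\<^sub>C (w (Suc k) * x (i - 1))" by simp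
      have a': "x k * (w i * y) = w i * (x k * y) + (q - inverse q) *\<^sub>C (w (Suc k) * (x (i - 1) * y))" for y
        using arg_cong[OF a, of "\<lambda>a. a * y"] by (simp add: calg_simps)
      have b: "f (Suc k) * w i = w i * f (Suc k)" using f_w_greater[of i "Suc k"] False Suc.prems by simp
      have c: "x (i - 1) * f (Suc k) = f (Suc k) * x (i - 1)" using fx[of "Suc k" "i - 1"] False that Suc.prems by simp
      show ?thesis using Suc.prems commute_left[OF b] c
        by (simp add: xS calg_simps a a' b wS[of "Suc k"] mult.left_commute[of q])
    qed
  qed
qed

text \<open>The hypotheses are symmetric in the two directions, so every relation has a transposed
  version, available through \<open>mirror\<close>.\<close>

locale qgrid =
  fixes q s :: complex and N :: nat and a b :: "nat \<Rightarrow> 'u::calg" and z :: "nat \<Rightarrow> nat \<Rightarrow> 'u"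
  assumes rows: "j \<le> N \<Longrightarrow> qchain q s N a (\<lambda>i. z i j)"
    and columns: "i \<le> N \<Longrightarrow> qchain q s N b (z i)"
begin

lemma mirror: "qgrid q s N b a (\<lambda>i j. z j i)"
  by (rule qgrid.intro) (simp_all add: rows columns)

lemma z_column: "i < k \<Longrightarrow> k \<le> N \<Longrightarrow> j \<le> N \<Longrightarrow> z i j * z k j = inverse q *\<^sub>C (z k j * z i j)"
  using qchain.w_w[OF rows] .

lemma z_row: "j < l \<Longrightarrow> l \<le> N \<Longrightarrow> i \<le> N \<Longrightarrow> z i j * z i l = inverse q *\<^sub>C (z i l * z i j)"
  using qchain.w_w[OF columns] .

lemma q_nonzero: "q \<noteq> 0" "q + inverse q \<noteq> 0"
  using rows[of 0] by (simp_all add: qchain_def)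

text \<open>Bracketing the q-commutation of \<open>z i j\<close> and \<open>z i l\<close> with
  \<open>a i\<close> gives the case \<open>k = i + 1\<close>; further brackets preserve it, because
  later \<open>a k\<close> commute with \<open>z i j\<close> and \<open>z i l\<close>. The result
  mixes the two relations of a 2 by 2 block, and its transpose allows them to be separated.\<close>

lemma minor_relation:
  assumes "i < k" "k \<le> N" "j < l" "l \<le> N"
  shows "z k j * z i l + inverse q *\<^sub>C (z i j * z k l)
    = inverse q *\<^sub>C (z k l * z i j) + inverse (q * q) *\<^sub>C (z i l * z k j)"
  using assms(1,2)
proof (induction k)
  case (Suc k)
  define f where "f = a k"
  interpret J: qchain q s N a "\<lambda>i. z i j" using rows assms by simp
  interpret L: qchain q s N a "\<lambda>i. z i l" using rows assms by simp
  have J: "z (Suc k) j = s *\<^sub>C (z k j * f - q *\<^sub>C (f * z k j))"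
    and L: "z (Suc k) l = s *\<^sub>C (z k l * f - q *\<^sub>C (f * z k l))"
    using J.w_Suc[of k] L.w_Suc[of k] Suc.prems by (simp_all add: f_def)
  show ?case
  proof (cases "k = i")
    case True
    have r: "z i j * z i l = inverse q *\<^sub>C (z i l * z i j)" using z_row assms by simp
    have "z i j * (z i l * y) = inverse q *\<^sub>C (z i l * (z i j * y))" for y
      using arg_cong[OF r, of "\<lambda>a. a * y"] by (simp add: calg_simps)
    moreover have qi: "q * (s * inverse q) = s" "q * (s * (inverse q * inverse q)) = s * inverse q"
      using q_nonzero by (simp_all add: field_simps)
    ultimately show ?thesis unfolding J L using True r
      by (simp add: calg_simps mult_ac qi)
  next
    case False
    with Suc have c: "f * z i j = z i j * f" "f * z i l = z i l * f"
      and IH: "z k j * z i l + inverse q *\<^sub>C (z i j * z k l)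
        = inverse q *\<^sub>C (z k l * z i j) + inverse (q * q) *\<^sub>C (z i l * z k j)"
      using J.f_w_greater[of i k] L.f_w_greater[of i k] by (auto simp: f_def)
    define x where "x = z k j * z i l + inverse q *\<^sub>C (z i j * z k l)"
    have "z (Suc k) j * z i l + inverse q *\<^sub>C (z i j * z (Suc k) l) = s *\<^sub>C (x * f - q *\<^sub>C (f * x))"
      unfolding J L x_def using c commute_left[OF c(1)] commute_left[OF c(2)]
      by (simp add: calg_simps mult_ac)
    also have "\<dots> = inverse q *\<^sub>C (z (Suc k) l * z i j) + inverse (q * q) *\<^sub>C (z i l * z (Suc k) j)"
      unfolding J L x_def IH using c commute_left[OF c(1)] commute_left[OF c(2)]
      by (simp add: calg_simps mult_ac)
    finally show ?thesis .
  qed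
qed simp

text \<open>Subtracting the transpose of \<open>minor_relation\<close> from it leaves
  \<open>1 + q^-2\<close>, a nonzero scalar, times the commutator.\<close>

lemma z_antidiagonal:
  assumes "i < k" "k \<le> N" "j < l" "l \<le> N"
  shows "z k j * z i l = z i l * z k j"
proof -
  interpret m: qgrid q s N b a "\<lambda>i j. z j i" by (rule mirror)
  let ?d = "z k j * z i l - z i l * z k j"
  have "(z k j * z i l + inverse q *\<^sub>C (z i j * z k l)) - (z i l * z k j + inverse q *\<^sub>C (z i j * z k l))
    = (inverse q *\<^sub>C (z k l * z i j) + inverse (q * q) *\<^sub>C (z i l * z k j))
      - (inverse q *\<^sub>C (z k l * z i j) + inverse (q * q) *\<^sub>C (z k j * z i l))"
    by (simp only: minor_relation[OF assms] m.minor_relation[OF assms(3,4,1,2)])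
  then have "?d = inverse (q * q) *\<^sub>C (z i l * z k j) - inverse (q * q) *\<^sub>C (z k j * z i l)" by simp
  also have "\<dots> = - (inverse (q * q) *\<^sub>C ?d)" by (simp only: cvec.scale_right_diff_distrib minus_diff_eq)
  finally have "?d + inverse (q * q) *\<^sub>C ?d = 0" by (simp only: eq_neg_iff_add_eq_0)
  then have "(1 + inverse (q * q)) *\<^sub>C ?d = 0" by (simp add: cscale_add_left cscale_one)
  moreover have "1 + inverse (q * q) = inverse q * (q + inverse q)"
    using q_nonzero by (simp add: field_simps)
  ultimately show ?thesis using q_nonzero by auto
qed

lemma z_diagonal:
  assumes "i < k" "k \<le> N" "j < l" "l \<le> N"
  shows "z k l * z i j = z i j * z k l + (q - inverse q) *\<^sub>C (z i l * z k j)"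
proof -
  have "q *\<^sub>C (z i l * z k j + inverse q *\<^sub>C (z i j * z k l))
    = q *\<^sub>C (inverse q *\<^sub>C (z k l * z i j) + inverse (q * q) *\<^sub>C (z i l * z k j))"
    using minor_relation[OF assms] z_antidiagonal[OF assms] by simp
  then show ?thesis using q_nonzero
    by (simp add: calg_simps cscale_one cvec.scale_left_diff_distrib algebra_simps)
qed

end


section \<open>Ordered monomials\<close>

primrec ordered_span :: "('p \<Rightarrow> 'u::calg) \<Rightarrow> 'p list \<Rightarrow> 'u set" where
  "ordered_span f [] = cvec.span {1}"
| "ordered_span f (p # ps) = cvec.span {f p ^ k * y | k y. y \<in> ordered_span f ps}"

lemma subspace_ordered_span: "cvec.subspace (ordered_span f ps)"
  by (cases ps) simp_all

lemma one_in_ordered_span: "1 \<in> ordered_span f ps"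
proof (induction ps)
  case (Cons p ps)
  have "f p ^ 0 * 1 \<in> ordered_span f (p # ps)" unfolding ordered_span.simps
    by (rule cvec.span_base) (use Cons in blast)
  then show ?case by simp
qed (simp add: cvec.span_base)

text \<open>Straightening terminates because the correction \<open>f s * f t\<close> involves only
  generators after \<open>p\<close>: each use of the relation lowers the exponent of the first
  generator.\<close>

lemma ordered_span_mult_closed:
  assumes rel: "\<And>us p vs r. ps = us @ p # vs \<Longrightarrow> r \<in> set vs \<Longrightarrow>
      \<exists>c d s t. s \<in> set vs \<and> t \<in> set vs \<and> f r * f p = c *\<^sub>C (f p * f r) + d *\<^sub>C (f s * f t)"
    and r: "r \<in> set ps" and y: "y \<in> ordered_span f ps"
  shows "f r * y \<in> ordered_span f ps"
  using assms
proof (induction ps arbitrary: r y)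
  case (Cons p ps)
  \<comment> \<open>Filtration by the exponent of the first generator; \<open>main\<close> shows
    that multiplication by later generators respects it.\<close>
  let ?O = "\<lambda>k. cvec.span {f p ^ k' * y | k' y. k' \<le> k \<and> y \<in> ordered_span f ps}"
  have O_mono: "?O k \<subseteq> ?O k'" if "k \<le> k'" for k k'
    by (rule cvec.span_mono) (use that le_trans in blast)
  have O: "?O k \<subseteq> ordered_span f (p # ps)" for k
    unfolding ordered_span.simps by (rule cvec.span_mono) auto
  have rel': "\<exists>c d s t. s \<in> set vs \<and> t \<in> set vs \<and> f r * f p' = c *\<^sub>C (f p' * f r) + d *\<^sub>C (f s * f t)"
    if "ps = us @ p' # vs" "r \<in> set vs" for us p' vs r
    using Cons.prems(1)[of "p # us" p' vs r] that by simp
  have left: "f p * x \<in> ?O (Suc k)" if "x \<in> ?O k" for x k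
    using that
  proof (induction rule: span_induct_lin)
    case (base x)
    then obtain k' y where x: "x = f p ^ k' * y" "k' \<le> k" "y \<in> ordered_span f ps" by auto
    have "f p * x = f p ^ Suc k' * y" by (simp add: x mult.assoc)
    moreover have "Suc k' \<le> Suc k" using x by simp
    ultimately show ?case using x(3) by (intro cvec.span_base) blast
  qed (auto simp: calg_simps cvec.span_zero intro: cvec.span_add cvec.span_scale)
  have main: "f r * (f p ^ k * y) \<in> ?O k" if "r \<in> set ps" "y \<in> ordered_span f ps" for r k y
    using that
  proof (induction k arbitrary: r y rule: less_induct)
    case (less k)
    show ?case
    proof (cases k)
      case 0
      have "f r * y \<in> ordered_span f ps"
        by (rule Cons.IH) (use rel' less.prems in auto)
      then have "f p ^ 0 * (f r * y) \<in> ?O 0" by (intro cvec.span_base) blast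
      then show ?thesis using 0 by simp
    next
      case (Suc m)
      obtain c d s t where st: "s \<in> set ps" "t \<in> set ps"
        and eq: "f r * f p = c *\<^sub>C (f p * f r) + d *\<^sub>C (f s * f t)"
        using Cons.prems(1)[of "[]" p ps r] less.prems by auto
      have "f r * (f p ^ k * y) = (f r * f p) * (f p ^ m * y)" by (simp add: Suc mult.assoc)
      also have "\<dots> = c *\<^sub>C (f p * (f r * (f p ^ m * y))) + d *\<^sub>C (f s * (f t * (f p ^ m * y)))"
        by (simp add: eq calg_simps)
      also have "\<dots> \<in> ?O k"
      proof (intro cvec.span_add cvec.span_scale)
        show "f p * (f r * (f p ^ m * y)) \<in> ?O k"
          unfolding Suc by (intro left less.IH) (use less.prems Suc in auto)
        have "f s * x \<in> ?O k" if "x \<in> ?O m" for x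
          using that
        proof (induction rule: span_induct_lin)
          case (base x)
          then obtain k' y' where x: "x = f p ^ k' * y'" "k' \<le> m" "y' \<in> ordered_span f ps" by auto
          show ?case using less.IH[of k' s y'] x st(1) Suc O_mono[of k' k] by auto
        qed (auto simp: calg_simps cvec.span_zero intro: cvec.span_add cvec.span_scale)
        then show "f s * (f t * (f p ^ m * y)) \<in> ?O k"
          using less.IH[of m t y] less.prems st Suc by simp
      qed
      finally show ?thesis .
    qed
  qed
  have "f r * x \<in> ordered_span f (p # ps)" if "x \<in> ordered_span f (p # ps)"for x
    using that unfolding ordered_span.simps
  proof (induction rule: span_induct_lin)
    case (base x)
    then obtain k y where x: "x = f p ^ k * y" "y \<in> ordered_span f ps" by auto
    have xk: "x \<in> ?O k" unfolding x(1) using x(2) by (intro cvec.span_base) blast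
    show ?case
    proof (cases "r = p")
      case True
      then show ?thesis using left[OF xk] O[of "Suc k"] by auto
    next
      case False
      then show ?thesis using main[of r y k] x Cons.prems(2) O[of k] by auto
    qed
  qed (auto simp: calg_simps cvec.span_zero intro: cvec.span_add cvec.span_scale)
  then show ?case using Cons.prems(3) .
qed simp

lemma subalg_hull_subset_ordered_span:
  assumes rel: "\<And>us p vs r. ps = us @ p # vs \<Longrightarrow> r \<in> set vs \<Longrightarrow>
      \<exists>c d s t. s \<in> set vs \<and> t \<in> set vs \<and> f r * f p = c *\<^sub>C (f p * f r) + d *\<^sub>C (f s * f t)"
  shows "subalg hull (f ` set ps) \<subseteq> ordered_span f ps"
proof
  note sub = subspaceD[OF subspace_ordered_span[of f ps]]
  fix x assume x: "x \<in> subalg hull (f ` set ps)"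
  have "\<forall>y\<in>ordered_span f ps. x * y \<in> ordered_span f ps"
    using x
  proof (induction rule: subalg_hull_induct)
    case (gen x)
    then show ?case using ordered_span_mult_closed[of ps f] rel by blast
  qed (auto simp: calg_simps intro: sub)
  then have "x * 1 \<in> ordered_span f ps" using one_in_ordered_span by blast
  then show "x \<in> ordered_span f ps" by simp
qed

text \<open>Column-major numbering of the positions, as in the monomials \<open>Z\<^sup>a\<close>.\<close>

definition position :: "nat \<Rightarrow> (nat \<Rightarrow> nat \<Rightarrow> 'u) \<Rightarrow> nat \<Rightarrow> 'u" where
  "position n z m = z (m mod n) (m div n)"

lemma upt_split: "[0..<M] = us @ p # vs \<Longrightarrow> p < M \<and> vs = [Suc p..<M]"
proof -
  assume eq: "[0..<M] = us @ p # vs"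
  then have len: "length us < M" by (metis add_Suc_right length_append length_upt less_add_Suc1 list.size(4) diff_zero add.right_neutral One_nat_def)
  have "[0..<M] ! length us = p" unfolding eq by simp
  then have p: "p = length us" using len by simp
  have "drop (Suc (length us)) [0..<M] = vs" unfolding eq by simp
  then show ?thesis using p len by (simp add: drop_upt)
qed

text \<open>The possible mutual positions of two entries correspond to the quantum matrix relations;
  only the diagonal one has a correction whose position must be checked.\<close>

lemma (in qgrid) subalg_hull_subset_ordered_monomials:
  fixes n assumes n: "n = Suc N"
  shows "subalg hull (position n z ` {0..<n * n}) \<subseteq> ordered_span (position n z) [0..<n * n]"
proof -
  have bound: "r mod n \<le> N" "r div n \<le> N" if "r < n * n" for r
    using that n by (auto simp: less_Suc_eq_le[symmetric] less_mult_imp_div_less)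
  have "\<exists>c d s t. s \<in> set vs \<and> t \<in> set vs \<and>
      position n z r * position n z p = c *\<^sub>C (position n z p * position n z r) + d *\<^sub>C (position n z s * position n z t)"
    if eq: "[0..<n * n] = us @ p # vs" and r: "r \<in> set vs" for us p vs r
  proof -
    have p: "p < n * n" and vs: "vs = [Suc p..<n * n]" using upt_split[OF eq] by auto
    have pr: "p < r" "r < n * n" using r vs by auto
    define i j k l where ij: "i = p mod n" "j = p div n" "k = r mod n" "l = r div n"
    have p': "p = j * n + i" and r': "r = l * n + k" by (simp_all add: ij)
    have b: "i \<le> N" "j \<le> N" "k \<le> N" "l \<le> N" using bound p pr by (auto simp: ij)
    have jl: "j \<le> l" using pr(1) by (simp add: ij div_le_mono)
    have zp: "position n z p = z i j" "position n z r = z k l" by (simp_all add: position_def ij)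
    have triv: ?thesis if "z k l * z i j = c *\<^sub>C (z i j * z k l)" for c
      using that r zp by (intro exI[of _ c] exI[of _ 0] exI[of _ r]) auto
    consider "j = l" "i < k" | "j < l" "k = i" | "j < l" "k < i" | "j < l" "i < k"
      using jl pr p' r' by (cases "j = l"; cases i k rule: linorder_cases) auto
    then show ?thesis
    proof cases
      case 1
      show ?thesis by (rule triv[of q]) (use 1 b z_column[of i k j] q_nonzero in \<open>simp add: cscale_cscale cscale_one\<close>)
    next
      case 2
      show ?thesis by (rule triv[of q]) (use 2 b z_row[of j l i] q_nonzero in \<open>simp add: cscale_cscale cscale_one\<close>)
    next
      case 3
      show ?thesis by (rule triv[of 1]) (use 3 b z_antidiagonal[of k i j l] in \<open>simp add: cscale_one\<close>)
    next
      case 4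
      \<comment> \<open>Both entries of the correction \<open>z i l * z k j\<close> come after
        \<open>z i j\<close> in column-major order: the first lies in a later column, the second
        lower in the same column.\<close>
      have "j * n + k < j * n + n" "l * n + i < n * n" "j * n + n \<le> l * n"
        using 4 b n mult_le_mono1[of "Suc j" l n] mult_le_mono1[of "Suc l" n n] by auto
      then have "l * n + i \<in> set vs" "j * n + k \<in> set vs"
        using 4 b by (auto simp: vs p')
      moreover have "position n z (l * n + i) = z i l" "position n z (j * n + k) = z k j"
      proof -
        have "i < n" "k < n" using b n by auto
        then show "position n z (l * n + i) = z i l" "position n z (j * n + k) = z k j"
          by (simp_all add: position_def)
      qed
      ultimately show ?thesis using z_diagonal[of i k j l] 4 b zp
        by (intro exI[of _ 1] exI[of _ "q - inverse q"] exI[of _ "l * n + i"] exI[of _ "j * n + k"])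
          (simp add: cscale_one)
    qed
  qed
  from subalg_hull_subset_ordered_span[of "[0..<n * n]" "position n z", OF this]
  show ?thesis by simp
qed

section \<open>Root vectors\<close>

lemma fold_hom: "(\<And>k. k \<in> set xs \<Longrightarrow> calg_hom (H k)) \<Longrightarrow> calg_hom (fold H xs)"
proof (induction xs)
  case Nil then show ?case using calg_hom_id by (simp add: id_def)
next
  case (Cons x xs)
  then show ?case using calg_hom_comp[of "fold H xs" "H x"] by (simp add: comp_def)
qed

lemma fold_fixed: "(\<And>k. k \<in> set xs \<Longrightarrow> H k y = y) \<Longrightarrow> fold H xs y = y"
  by (induction xs) simp_all

text \<open>The families E and F are handled together: they satisfy the same Serre relations and
  differ only in the scalar \<open>s\<close>.\<close>

locale root_vectors =
  fixes n :: nat and q s :: complex and e :: "int \<Rightarrow> 'u::calg" and T :: "int \<Rightarrow> 'u \<Rightarrow> 'u"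
  assumes n_pos: "n \<ge> 1" and q0: "q \<noteq> 0" and q2: "q + inverse q \<noteq> 0"
    and T_hom: "\<alpha> \<in> simple_roots n \<Longrightarrow> calg_hom (T \<alpha>)"
    and T_adjacent: "\<alpha> \<in> simple_roots n \<Longrightarrow> \<alpha>' \<in> simple_roots n \<Longrightarrow> cartan \<alpha> \<alpha>' = -1 \<Longrightarrow>
      T \<alpha> (e \<alpha>') = bracket s q (e \<alpha>) (e \<alpha>')"
    and T_distant: "\<alpha> \<in> simple_roots n \<Longrightarrow> \<alpha>' \<in> simple_roots n \<Longrightarrow> cartan \<alpha> \<alpha>' = 0 \<Longrightarrow> T \<alpha> (e \<alpha>') = e \<alpha>'"
    and e_comm: "\<alpha> \<in> simple_roots n \<Longrightarrow> \<alpha>' \<in> simple_roots n \<Longrightarrow> cartan \<alpha> \<alpha>' = 0 \<Longrightarrow> e \<alpha> * e \<alpha>' = e \<alpha>' * e \<alpha>"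
    and e_serre: "\<alpha> \<in> simple_roots n \<Longrightarrow> \<alpha>' \<in> simple_roots n \<Longrightarrow> cartan \<alpha> \<alpha>' = -1 \<Longrightarrow> serre q (e \<alpha>) (e \<alpha>')"
begin

lemma fold_T:
  assumes R: "\<And>k. k \<le> i \<Longrightarrow> \<rho> k \<in> simple_roots n"
    and adj: "\<And>k. k < i \<Longrightarrow> cartan (\<rho> (Suc k)) (\<rho> k) = -1"
    and dist: "\<And>k m. m \<le> i \<Longrightarrow> Suc k < m \<Longrightarrow> cartan (\<rho> m) (\<rho> k) = 0"
  shows "fold (\<lambda>k. T (\<rho> k)) [1..<Suc i] (e (\<rho> 0)) = brackets s q (\<lambda>k. e (\<rho> (Suc k))) (e (\<rho> 0)) i"
  using assms
proof (induction i)
  case (Suc i)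
  let ?b = "brackets s q (\<lambda>k. e (\<rho> (Suc k))) (e (\<rho> 0))"
  have IH: "fold (\<lambda>k. T (\<rho> k)) [1..<Suc i] (e (\<rho> 0)) = ?b i"
    using Suc.prems by (intro Suc.IH) auto
  have "fold (\<lambda>k. T (\<rho> k)) [1..<Suc (Suc i)] (e (\<rho> 0)) = T (\<rho> (Suc i)) (?b i)"
    using IH by simp
  also have "\<dots> = ?b (Suc i)"
  proof (cases i)
    case 0
    then show ?thesis using T_adjacent[of "\<rho> 1" "\<rho> 0"] Suc.prems(1,2)[of 0] Suc.prems(1)[of 1] by simp
  next
    case (Suc m)
    have hom: "calg_hom (T (\<rho> (Suc i)))" using T_hom Suc.prems(1) by simp
    have fix_: "T (\<rho> (Suc i)) (?b m) = ?b m"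
      using Suc.prems(1,3) Suc T_distant by (subst brackets_hom[OF hom]) simp_all
    have comm: "e (\<rho> (Suc i)) * ?b m = ?b m * e (\<rho> (Suc i))"
      using Suc.prems(1,3) Suc e_comm by (intro commute_brackets) simp_all
    have "T (\<rho> (Suc i)) (?b i) = bracket s q (bracket s q (e (\<rho> (Suc i))) (e (\<rho> (Suc m)))) (?b m)"
      using T_adjacent[of "\<rho> (Suc i)" "\<rho> i"] Suc.prems(1,2)[of i] Suc.prems(1)[of "Suc i"]
      by (simp add: Suc bracket_hom[OF hom, unfolded Suc] fix_[unfolded Suc])
    \<comment> \<open>The last automorphism has changed only the last letter of the chain, into a
      bracket. Since the new generator commutes with \<open>?b m\<close>, the nested bracket can be
      reassociated.\<close>
    also have "\<dots> = bracket s q (e (\<rho> (Suc i))) (bracket s q (e (\<rho> (Suc m))) (?b m))"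
      using comm commute_left[OF comm] by (simp add: bracket_def calg_simps mult_ac)
    finally show ?thesis by (simp add: Suc)
  qed
  finally show ?case .
qed simp

text \<open>Indices are counted from 0: \<open>z i j\<close> is the root vector with indices \<open>(i + 1, j + 1)\<close> in the
  informal statement, and \<open>fmu k\<close>, \<open>fnu k\<close> belong to the simple roots with index \<open>k + 1\<close>.\<close>

definition z :: "nat \<Rightarrow> nat \<Rightarrow> 'u" where
  "z i j = fold (\<lambda>k. T (nu k)) [1..<Suc j] (fold (\<lambda>k. T (mu k)) [1..<Suc i] (e beta))"

abbreviation fmu :: "nat \<Rightarrow> 'u" where "fmu k \<equiv> e (- int (Suc k))"
abbreviation fnu :: "nat \<Rightarrow> 'u" where "fnu k \<equiv> e (int (Suc k))"

lemma z_brackets: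
  assumes "i < n" "j < n"
  shows "z i j = brackets s q fmu (brackets s q fnu (e beta) j) i"
proof -
  have m: "fold (\<lambda>k. T (mu k)) [1..<Suc i] (e beta) = brackets s q fmu (e beta) i"
    using fold_T[of i "\<lambda>k. mu k"] assms by (simp add: simple_roots_def cartan_def)
  have v: "fold (\<lambda>k. T (nu k)) [1..<Suc j] (e beta) = brackets s q fnu (e beta) j"
    using fold_T[of j "\<lambda>k. nu k"] assms by (simp add: simple_roots_def cartan_def)
  have hom: "calg_hom (fold (\<lambda>k. T (nu k)) [1..<Suc j])"
    using assms by (intro fold_hom T_hom) (auto simp: simple_roots_def)
  show ?thesis unfolding z_def m v[symmetric]
  proof (rule brackets_hom[OF hom])
    fix k assume "k < i"
    then show "fold (\<lambda>k. T (nu k)) [1..<Suc j] (fmu k) = fmu k"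
      using assms by (intro fold_fixed T_distant) (auto simp: simple_roots_def cartan_def)
  qed
qed

lemma z_Suc_left: "Suc i < n \<Longrightarrow> j < n \<Longrightarrow> z (Suc i) j = bracket s q (fmu i) (z i j)"
  by (simp add: z_brackets)

text \<open>Generators on different arms commute, so the bracket with \<open>fnu j\<close> can be
  pulled out of those with the \<open>fmu\<close>.\<close>

lemma z_Suc_right:
  assumes "i < n" "Suc j < n" shows "z i (Suc j) = bracket s q (fnu j) (z i j)"
  using assms by (auto simp: z_brackets simple_roots_def cartan_def intro!: brackets_bracket e_comm)

lemma z_0_0: "z 0 0 = e beta"
  by (simp add: z_def)

text \<open>A row or column starts at the image of \<open>e beta\<close> under automorphisms
  belonging to the other arm. These fix all \<open>f i\<close>, so the relations of
  \<open>w 0\<close> with the \<open>f i\<close> are images of those of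
  \<open>e beta\<close>.\<close>

lemma qchain_hom:
  assumes h: "calg_hom h"
    and f: "\<And>i. i < n - 1 \<Longrightarrow> h (f i) = f i"
    and w: "\<And>i. i < n - 1 \<Longrightarrow> w (Suc i) = bracket s q (f i) (w i)" and w0: "w 0 = h (e beta)"
    and comm: "\<And>i j. i < n - 1 \<Longrightarrow> j < n - 1 \<Longrightarrow> Suc i < j \<Longrightarrow> f j * f i = f i * f j"
    and fserre: "\<And>i. Suc i < n - 1 \<Longrightarrow> serre q (f i) (f (Suc i)) \<and> serre q (f (Suc i)) (f i)"
    and commw: "\<And>i. 0 < i \<Longrightarrow> i < n - 1 \<Longrightarrow> f i * e beta = e beta * f i"
    and wserre: "0 < n - 1 \<Longrightarrow> serre q (f 0) (e beta) \<and> serre q (e beta) (f 0)"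
  shows "qchain q s (n - 1) f w"
proof
  show "f i * w 0 = w 0 * f i" if "0 < i" "i < n - 1" for i
    using arg_cong[OF commw[OF that], of h] f[OF that(2)] by (simp add: w0 calg_homD[OF h])
  show "serre q (f 0) (w 0)" "serre q (w 0) (f 0)" if "0 < n - 1"
    using serre_hom[OF h] wserre[OF that] f[OF that] unfolding w0 by metis+
qed (use q0 q2 w comm fserre in auto)

sublocale grid: qgrid q s "n - 1" fmu fnu z
proof (rule qgrid.intro)
  fix j assume j: "j \<le> n - 1"
  let ?h = "fold (\<lambda>k. T (nu k)) [1..<Suc j]"
  have h: "calg_hom ?h" using j n_pos by (intro fold_hom T_hom) (auto simp: simple_roots_def)
  show "qchain q s (n - 1) fmu (\<lambda>i. z i j)"
  proof (rule qchain_hom[OF h])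
    show "?h (fmu i) = fmu i" if "i < n - 1" for i
      using that j n_pos by (intro fold_fixed T_distant) (auto simp: simple_roots_def cartan_def)
    show "z (Suc i) j = bracket s q (fmu i) (z i j)" if "i < n - 1" for i
      using that j n_pos by (intro z_Suc_left) auto
  qed (use n_pos in \<open>auto simp: z_def cartan_def simple_roots_def intro!: e_comm e_serre\<close>)
next
  fix i assume i: "i \<le> n - 1"
  let ?h = "fold (\<lambda>k. T (mu k)) [1..<Suc i]"
  have h: "calg_hom ?h" using i n_pos by (intro fold_hom T_hom) (auto simp: simple_roots_def)
  show "qchain q s (n - 1) fnu (z i)"
  proof (rule qchain_hom[OF h])
    show "?h (fnu j) = fnu j" if "j < n - 1" for j
      using that i n_pos by (intro fold_fixed T_distant) (auto simp: simple_roots_def cartan_def)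
    show "z i (Suc j) = bracket s q (fnu j) (z i j)" if "j < n - 1" for j
      using that i n_pos by (intro z_Suc_right) auto
  qed (use n_pos in \<open>auto simp: z_def cartan_def simple_roots_def intro!: e_comm e_serre\<close>)
qed

end


section \<open>Consequences of the presentation\<close>

lemma free_eval_simps:
  fixes g :: "'g \<Rightarrow> 'u::calg"
  shows
  "free_eval g 1 = 1"
  "free_eval g (free_gen x) = g x"
  "free_eval g (free_gen x * free_gen y) = g x * g y"
  "free_eval g (free_gen x * free_gen y * free_gen t) = g x * g y * g t"
  "free_eval g (a + b) = free_eval g a + free_eval g b"
  "free_eval g (a - b) = free_eval g a - free_eval g b"
  "free_eval g (c *\<^sub>C a) = c *\<^sub>C free_eval g a"
proof -
  note lin = clinear_lin_ext[of "\<lambda>w. prod_list (map g (letters w))"]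
  have one: "(1 :: 'g free_alg) = Poly_Mapping.single (Word []) 1"
    by (simp flip: single_one add: zero_word_def)
  show "free_eval g 1 = 1" by (simp add: one free_eval_def lin_ext_single cscale_one)
  show "free_eval g (free_gen x) = g x"
    "free_eval g (free_gen x * free_gen y) = g x * g y"
    "free_eval g (free_gen x * free_gen y * free_gen t) = g x * g y * g t"
    by (simp_all add: free_eval_def free_gen_def mult_single plus_word_def lin_ext_single cscale_one mult.assoc)
  show "free_eval g (a + b) = free_eval g a + free_eval g b"
    "free_eval g (a - b) = free_eval g a - free_eval g b"
    "free_eval g (c *\<^sub>C a) = c *\<^sub>C free_eval g a"
    unfolding free_eval_def by (rule functional_simps[OF lin])+
qed

locale quantum_group =
  fixes n :: nat and q :: complex and g :: "qgen \<Rightarrow> 'u::calg" and T :: "int \<Rightarrow> 'u \<Rightarrow> 'u"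
  assumes n_pos: "n \<ge> 1" and q0: "q \<noteq> 0" and not_root: "\<And>k. k > 0 \<Longrightarrow> q ^ k \<noteq> 1"
    and presented: "Uq_presented n q g" and lusztig: "lusztig_automorphisms n q g T"
begin

abbreviation "R \<equiv> simple_roots n"
abbreviation "E \<alpha> \<equiv> g (GE \<alpha>)"
abbreviation "F \<alpha> \<equiv> g (GF \<alpha>)"
abbreviation "K \<alpha> \<equiv> g (GK \<alpha>)"
abbreviation "Ki \<alpha> \<equiv> g (GKi \<alpha>)"
abbreviation "c0 \<equiv> - inverse (q - inverse q)"

text \<open>\<open>q + inverse q = 0\<close> would force \<open>q^2 = -1\<close>, hence
  \<open>q^4 = 1\<close>.\<close>

lemma q_facts: "q * q \<noteq> 1" "q - inverse q \<noteq> 0" "q + inverse q \<noteq> 0"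
proof -
  show "q * q \<noteq> 1" using not_root[of 2] by (simp add: power2_eq_square)
  then show "q - inverse q \<noteq> 0" using q0 by (simp add: field_simps)
  have "q ^ 4 \<noteq> 1" using not_root[of 4] by simp
  then show "q + inverse q \<noteq> 0" using q0
    by (auto simp: field_simps power4_eq_xxxx add_eq_0_iff)
qed

lemma relator: "r \<in> Uq_relators n q \<Longrightarrow> free_eval g r = 0"
proof -
  assume "r \<in> Uq_relators n q"
  then have "1 * r * 1 \<in> two_sided_ideal (Uq_relators n q)"
    unfolding two_sided_ideal_def by (intro cvec.span_base) blast
  then show ?thesis using presented by (auto simp: Uq_presented_def)
qed

lemma K_Ki: assumes R: "\<alpha> \<in> R" shows "K \<alpha> * Ki \<alpha> = 1"
proof -
  have "free_gen (GK \<alpha>) * free_gen (GKi \<alpha>) - 1 \<in> Uq_relators n q"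
    using R unfolding Uq_relators_def Let_def by blast
  from relator[OF this] show ?thesis by (simp add: free_eval_simps)
qed

lemma Ki_K: assumes R: "\<alpha> \<in> R" shows "Ki \<alpha> * K \<alpha> = 1"
proof -
  have "free_gen (GKi \<alpha>) * free_gen (GK \<alpha>) - 1 \<in> Uq_relators n q"
    using R unfolding Uq_relators_def Let_def by blast
  from relator[OF this] show ?thesis by (simp add: free_eval_simps)
qed

context
  fixes \<alpha> \<alpha>' assumes R: "\<alpha> \<in> R" "\<alpha>' \<in> R"
begin

lemma K_E: "K \<alpha> * E \<alpha>' = (q powi cartan \<alpha> \<alpha>') *\<^sub>C (E \<alpha>' * K \<alpha>)"
proof -
  have "K \<alpha> * E \<alpha>' * Ki \<alpha> = (q powi cartan \<alpha> \<alpha>') *\<^sub>C E \<alpha>'"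
  proof -
    have "free_gen (GK \<alpha>) * free_gen (GE \<alpha>') * free_gen (GKi \<alpha>) - (q powi cartan \<alpha> \<alpha>') *\<^sub>C free_gen (GE \<alpha>') \<in> Uq_relators n q"
      using R unfolding Uq_relators_def Let_def by blast
    from relator[OF this] show ?thesis by (simp add: free_eval_simps)
  qed
  from arg_cong[OF this, of "\<lambda>x. x * K \<alpha>"] show ?thesis
    by (simp add: calg_simps Ki_K R)
qed

lemma K_F: "K \<alpha> * F \<alpha>' = (q powi (- cartan \<alpha> \<alpha>')) *\<^sub>C (F \<alpha>' * K \<alpha>)"
proof -
  have "K \<alpha> * F \<alpha>' * Ki \<alpha> = (q powi (- cartan \<alpha> \<alpha>')) *\<^sub>C F \<alpha>'"
  proof -
    have "free_gen (GK \<alpha>) * free_gen (GF \<alpha>') * free_gen (GKi \<alpha>) - (q powi (- cartan \<alpha> \<alpha>')) *\<^sub>C free_gen (GF \<alpha>') \<in> Uq_relators n q"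
      using R unfolding Uq_relators_def Let_def by blast
    from relator[OF this] show ?thesis by (simp add: free_eval_simps)
  qed
  from arg_cong[OF this, of "\<lambda>x. x * K \<alpha>"] show ?thesis
    by (simp add: calg_simps Ki_K R)
qed

lemma E_F: "E \<alpha> * F \<alpha>' = F \<alpha>' * E \<alpha> + (if \<alpha> = \<alpha>' then (1 / (q - inverse q)) *\<^sub>C (K \<alpha> - Ki \<alpha>) else 0)"
proof -
  let ?d = "if \<alpha> = \<alpha>' then (1 / (q - inverse q)) *\<^sub>C (free_gen (GK \<alpha>) - free_gen (GKi \<alpha>)) else 0"
  have "free_gen (GE \<alpha>) * free_gen (GF \<alpha>') - free_gen (GF \<alpha>') * free_gen (GE \<alpha>) - ?d \<in> Uq_relators n q"
    using R unfolding Uq_relators_def Let_def by blast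
  from relator[OF this] show ?thesis
    by (auto simp: free_eval_simps free_eval_simps(6)[of g 0 0, simplified] algebra_simps split: if_splits)
qed

lemma EE_comm: assumes "cartan \<alpha> \<alpha>' = 0" shows "E \<alpha> * E \<alpha>' = E \<alpha>' * E \<alpha>"
proof -
  have "free_gen (GE \<alpha>) * free_gen (GE \<alpha>') - free_gen (GE \<alpha>') * free_gen (GE \<alpha>) \<in> Uq_relators n q"
    unfolding Uq_relators_def Let_def
    by (rule UnI1, rule UnI2, rule UN_I[OF R(1)], rule UN_I[of \<alpha>']) (use R assms in simp_all)
  from relator[OF this] show ?thesis by (simp add: free_eval_simps)
qed

lemma FF_comm: assumes "cartan \<alpha> \<alpha>' = 0" shows "F \<alpha> * F \<alpha>' = F \<alpha>' * F \<alpha>"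
proof -
  have "free_gen (GF \<alpha>) * free_gen (GF \<alpha>') - free_gen (GF \<alpha>') * free_gen (GF \<alpha>) \<in> Uq_relators n q"
    unfolding Uq_relators_def Let_def
    by (rule UnI1, rule UnI2, rule UN_I[OF R(1)], rule UN_I[of \<alpha>']) (use R assms in simp_all)
  from relator[OF this] show ?thesis by (simp add: free_eval_simps)
qed

lemma E_serre: assumes "cartan \<alpha> \<alpha>' = -1" shows "serre q (E \<alpha>) (E \<alpha>')"
proof -
  let ?E = "\<lambda>\<alpha>. free_gen (GE \<alpha>)"
  have "?E \<alpha> * ?E \<alpha> * ?E \<alpha>' - (q + inverse q) *\<^sub>C (?E \<alpha> * ?E \<alpha>' * ?E \<alpha>) + ?E \<alpha>' * ?E \<alpha> * ?E \<alpha> \<in> Uq_relators n q"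
    unfolding Uq_relators_def Let_def
    by (rule UnI2, rule UN_I[OF R(1)], rule UN_I[of \<alpha>']) (use R assms in simp_all)
  from relator[OF this] show ?thesis by (simp add: serre_def free_eval_simps)
qed

lemma F_serre: assumes "cartan \<alpha> \<alpha>' = -1" shows "serre q (F \<alpha>) (F \<alpha>')"
proof -
  let ?E = "\<lambda>\<alpha>. free_gen (GF \<alpha>)"
  have "?E \<alpha> * ?E \<alpha> * ?E \<alpha>' - (q + inverse q) *\<^sub>C (?E \<alpha> * ?E \<alpha>' * ?E \<alpha>) + ?E \<alpha>' * ?E \<alpha> * ?E \<alpha> \<in> Uq_relators n q"
    unfolding Uq_relators_def Let_def
    by (rule UnI2, rule UN_I[OF R(1)], rule UN_I[of \<alpha>']) (use R assms in simp_all)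
  from relator[OF this] show ?thesis by (simp add: serre_def free_eval_simps)
qed

lemma Ki_F: "Ki \<alpha> * F \<alpha>' = (q powi cartan \<alpha> \<alpha>') *\<^sub>C (F \<alpha>' * Ki \<alpha>)"
proof -
  have K: "K \<alpha> * Ki \<alpha> = 1" "Ki \<alpha> * K \<alpha> = 1" using K_Ki Ki_K R by auto
  have "F \<alpha>' * Ki \<alpha> = Ki \<alpha> * (K \<alpha> * F \<alpha>') * Ki \<alpha>"
    by (simp add: K flip: mult.assoc)
  also have "\<dots> = (q powi (- cartan \<alpha> \<alpha>')) *\<^sub>C (Ki \<alpha> * F \<alpha>')"
    by (simp add: K_F calg_simps K)
  finally have "F \<alpha>' * Ki \<alpha> = (q powi (- cartan \<alpha> \<alpha>')) *\<^sub>C (Ki \<alpha> * F \<alpha>')" .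
  then show ?thesis using q0 by (simp add: cscale_cscale power_int_minus cscale_one)
qed

end

lemma generated: "subalg hull (range g) = UNIV"
proof -
  have "x \<in> subalg hull (range g)" for x
  proof -
    note h = subalgD[OF subalg_hull[of "range g"]]
    obtain p where "x = free_eval g p" using presented by (auto simp: Uq_presented_def surj_def)
    moreover have "prod_list (map g ws) \<in> subalg hull (range g)" for ws
      by (induction ws) (auto intro: h hull_inc)
    ultimately show ?thesis
      unfolding free_eval_def lin_ext_def by (auto intro!: cvec.subspace_sum h)
  qed
  then show ?thesis by blast
qed

lemma outside: assumes "\<alpha> \<notin> R" shows "E \<alpha> = 0" "F \<alpha> = 0" "K \<alpha> = 0" "Ki \<alpha> = 0"
proof -
  have "free_gen (GE \<alpha>) \<in> Uq_relators n q" "free_gen (GF \<alpha>) \<in> Uq_relators n q"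
    "free_gen (GK \<alpha>) \<in> Uq_relators n q" "free_gen (GKi \<alpha>) \<in> Uq_relators n q"
    using assms unfolding Uq_relators_def Let_def by blast+
  from this[THEN relator] show "E \<alpha> = 0" "F \<alpha> = 0" "K \<alpha> = 0" "Ki \<alpha> = 0"
    by (simp_all add: free_eval_simps)
qed

lemma lusztigD:
  assumes "\<alpha> \<in> R"
  shows "calg_hom (T \<alpha>)"
    "\<alpha>' \<in> R \<Longrightarrow> cartan \<alpha> \<alpha>' = -1 \<Longrightarrow> T \<alpha> (E \<alpha>') = E \<alpha> * E \<alpha>' - inverse q *\<^sub>C (E \<alpha>' * E \<alpha>)"
    "\<alpha>' \<in> R \<Longrightarrow> cartan \<alpha> \<alpha>' = -1 \<Longrightarrow> T \<alpha> (F \<alpha>') = F \<alpha>' * F \<alpha> - q *\<^sub>C (F \<alpha> * F \<alpha>')"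
    "\<alpha>' \<in> R \<Longrightarrow> cartan \<alpha> \<alpha>' = 0 \<Longrightarrow> T \<alpha> (E \<alpha>') = E \<alpha>'"
    "\<alpha>' \<in> R \<Longrightarrow> cartan \<alpha> \<alpha>' = 0 \<Longrightarrow> T \<alpha> (F \<alpha>') = F \<alpha>'"
  using lusztig assms by (simp_all add: lusztig_automorphisms_def)

sublocale Z: root_vectors n q "- inverse q" E T
proof
  fix \<alpha> \<alpha>' assume R: "\<alpha> \<in> R" "\<alpha>' \<in> R"
  show "T \<alpha> (E \<alpha>') = bracket (- inverse q) q (E \<alpha>) (E \<alpha>')" if "cartan \<alpha> \<alpha>' = -1"
    using lusztigD(2)[OF R that] q0 by (simp add: bracket_def calg_simps cscale_one)
qed (fact n_pos q0 q_facts(3) | rule lusztigD(1,4) EE_comm E_serre; assumption)+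

sublocale W: root_vectors n q 1 F T
proof
  fix \<alpha> \<alpha>' assume R: "\<alpha> \<in> R" "\<alpha>' \<in> R"
  show "T \<alpha> (F \<alpha>') = bracket 1 q (F \<alpha>) (F \<alpha>')" if "cartan \<alpha> \<alpha>' = -1"
    using lusztigD(3)[OF R that] by (simp add: bracket_def cscale_one)
qed (fact n_pos q0 q_facts(3) | rule lusztigD(1,5) FF_comm F_serre; assumption)+

lemma Z_el_eq: "Z_el g T (Suc i) (Suc j) = Z.z i j" and W_el_eq: "W_el g T (Suc i) (Suc j) = W.z i j"
  by (simp_all add: Z_el_def W_el_def Z.z_def W.z_def)

end

section \<open>Slices of tensors\<close>

text \<open>The map \<open>f \<otimes> id\<close>: the slice is named after the factor that is
  contracted.\<close>

definition left_slice :: "('a::cvec \<Rightarrow> complex) \<Rightarrow> ('a, 'b::cvec) tensor \<Rightarrow> 'b" where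
  "left_slice f = tensor_lift (\<lambda>a b. f a *\<^sub>C b)"

definition right_slice :: "('b::cvec \<Rightarrow> complex) \<Rightarrow> ('a::cvec, 'b) tensor \<Rightarrow> 'a" where
  "right_slice f = tensor_lift (\<lambda>a b. f b *\<^sub>C a)"

lemma left_slice_tens: "clinear f \<Longrightarrow> left_slice f (a \<otimes>\<^sub>t b) = f a *\<^sub>C b"
  unfolding left_slice_def
  by (rule tensor_lift_tens) (auto simp: cbilinear_def functional_simps calg_simps cscale_add_left
      cscale_cscale cscale_add_right mult.commute intro!: clinearI)

lemma right_slice_tens: "clinear f \<Longrightarrow> right_slice f (a \<otimes>\<^sub>t b) = f b *\<^sub>C a"
  unfolding right_slice_def
  by (rule tensor_lift_tens) (auto simp: cbilinear_def functional_simps cscale_add_left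
      cscale_cscale cscale_add_right mult.commute intro!: clinearI)

lemmas clinear_left_slice = clinear_tensor_lift[of "\<lambda>a b. f a *\<^sub>C b" for f, folded left_slice_def]
  and clinear_right_slice = clinear_tensor_lift[of "\<lambda>a b. f b *\<^sub>C a" for f, folded right_slice_def]

lemmas slice_simps = left_slice_tens right_slice_tens functional_simps[OF clinear_left_slice]
  functional_simps[OF clinear_right_slice]

definition tensor_square :: "'a::cvec set \<Rightarrow> ('a, 'a) tensor set" where
  "tensor_square B = cvec.span {a \<otimes>\<^sub>t b | a b. a \<in> B \<and> b \<in> B}"

lemma tens_in_tensor_square: "a \<in> B \<Longrightarrow> b \<in> B \<Longrightarrow> a \<otimes>\<^sub>t b \<in> tensor_square B"
  unfolding tensor_square_def by (rule cvec.span_base) blast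

lemma subspace_tensor_square: "cvec.subspace (tensor_square B)"
  by (simp add: tensor_square_def)

lemma tensor_square_mult:
  assumes B: "subalg B" and "t \<in> tensor_square B" "t' \<in> tensor_square B"
  shows "t * t' \<in> tensor_square B"
proof -
  note sub = subspaceD[OF subspace_tensor_square[of B]]
  have *: "(a \<otimes>\<^sub>t b) * t' \<in> tensor_square B" if "a \<in> B" "b \<in> B" for a b
    using assms(3) unfolding tensor_square_def
  proof (induction rule: span_induct_lin)
    case (base t')
    then show ?case using that B
      by (auto simp: tensor_mult_tens intro!: tens_in_tensor_square[unfolded tensor_square_def] subalgD(4)[OF B])
  qed (use sub in \<open>auto simp: calg_simps tensor_square_def\<close>)
  show ?thesis
    using assms(2) unfolding tensor_square_def
    by (induction rule: span_induct_lin) (use sub * in \<open>auto simp: calg_simps tensor_square_def\<close>)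
qed

text \<open>\<open>P\<close> is not assumed at 0 and may fail there, for example for empty
  \<open>B\<close>; hence the extra disjuncts. In the applications both sides vanish at 0 by
  linearity.\<close>

lemma tensor_square_induct [consumes 2, case_names tens add1 scale1 add2 scale2]:
  assumes "t \<in> tensor_square B" "t' \<in> tensor_square B"
    and "\<And>a b a' b'. a \<in> B \<Longrightarrow> b \<in> B \<Longrightarrow> a' \<in> B \<Longrightarrow> b' \<in> B \<Longrightarrow> P (a \<otimes>\<^sub>t b) (a' \<otimes>\<^sub>t b')"
    and "\<And>x y t'. P x t' \<Longrightarrow> P y t' \<Longrightarrow> P (x + y) t'" "\<And>c x t'. P x t' \<Longrightarrow> P (c *\<^sub>C x) t'"
    and "\<And>x y t. P t x \<Longrightarrow> P t y \<Longrightarrow> P t (x + y)" "\<And>c x t. P t x \<Longrightarrow> P t (c *\<^sub>C x)"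
  shows "P t t' \<or> t = 0 \<or> t' = 0"
proof -
  have *: "P (a \<otimes>\<^sub>t b) t' \<or> t' = 0" if "a \<in> B" "b \<in> B" for a b
    using assms(2) unfolding tensor_square_def
    by (induction rule: span_induct_lin) (use that assms in \<open>auto\<close>)
  show ?thesis
    using assms(1) unfolding tensor_square_def
    by (induction rule: span_induct_lin) (use assms * in \<open>auto\<close>)
qed

text \<open>The hypothesis says that \<open>f\<close>, as a functional, has coproduct
  \<open>f1 \<otimes> f1' + f2 \<otimes> f2'\<close>. For a functional given by pairing with a skew
  primitive element the conclusion is a twisted Leibniz rule.\<close>

lemma slice_mult:
  assumes lin: "clinear f" "clinear f1" "clinear f1'" "clinear f2" "clinear f2'"
    and f: "\<And>b b'. b \<in> B \<Longrightarrow> b' \<in> B \<Longrightarrow> f (b * b') = f1 b * f1' b' + f2 b * f2' b'"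
    and t: "t \<in> tensor_square B" "t' \<in> tensor_square B"
  shows "left_slice f (t * t') = left_slice f1 t * left_slice f1' t' + left_slice f2 t * left_slice f2' t'"
    and "right_slice f (t * t') = right_slice f1 t * right_slice f1' t' + right_slice f2 t * right_slice f2' t'"
proof -
  have "(left_slice f (t * t') = left_slice f1 t * left_slice f1' t' + left_slice f2 t * left_slice f2' t')
    \<or> t = 0 \<or> t' = 0"
    using t by (induction rule: tensor_square_induct)
      (simp_all add: tensor_mult_tens slice_simps lin f calg_simps cscale_add_left mult_ac)
  then show "left_slice f (t * t') = left_slice f1 t * left_slice f1' t' + left_slice f2 t * left_slice f2' t'"
    by (auto simp: slice_simps)
  have "(right_slice f (t * t') = right_slice f1 t * right_slice f1' t' + right_slice f2 t * right_slice f2' t')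
    \<or> t = 0 \<or> t' = 0"
    using t by (induction rule: tensor_square_induct)
      (simp_all add: tensor_mult_tens slice_simps lin f calg_simps cscale_add_left mult_ac)
  then show "right_slice f (t * t') = right_slice f1 t * right_slice f1' t' + right_slice f2 t * right_slice f2' t'"
    by (auto simp: slice_simps)
qed

lemma slice_grouplike_mult:
  assumes lin: "clinear f" "clinear f1" "clinear f1'"
    and f: "\<And>b b'. b \<in> B \<Longrightarrow> b' \<in> B \<Longrightarrow> f (b * b') = f1 b * f1' b'"
    and t: "t \<in> tensor_square B" "t' \<in> tensor_square B"
  shows "left_slice f (t * t') = left_slice f1 t * left_slice f1' t'"
    and "right_slice f (t * t') = right_slice f1 t * right_slice f1' t'"
proof -
  have zero: "clinear (\<lambda>_ :: 'a. 0 :: complex)" by (rule clinearI) auto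
  have "left_slice (\<lambda>_. 0) t = 0" "right_slice (\<lambda>_. 0) t = 0" for t :: "('a, 'a) tensor"
    by (induction t rule: tensor_induct) (simp_all add: slice_simps zero)
  then show "left_slice f (t * t') = left_slice f1 t * left_slice f1' t'"
    and "right_slice f (t * t') = right_slice f1 t * right_slice f1' t'"
    using slice_mult[OF lin zero zero _ t] f by simp_all
qed

lemma clinear_mult_complex:
  "clinear f \<Longrightarrow> clinear (\<lambda>x. c * f x :: complex)" "clinear f \<Longrightarrow> clinear (\<lambda>x. f x * c :: complex)"
  by (auto intro!: clinearI simp: functional_simps algebra_simps)

lemma tensor_lift_times:
  assumes "clinear f" "clinear h"
  shows "tensor_lift (\<lambda>a b. f a * h b) t = f (right_slice h t)"
    and "tensor_lift (\<lambda>a b. f a * h b) t = h (left_slice f t)"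
proof -
  have "cbilinear (\<lambda>a b. f a * h b)"
    using assms by (auto simp: cbilinear_def clinear_mult_complex)
  note T = tensor_lift_tens[OF this]
  show "tensor_lift (\<lambda>a b. f a * h b) t = f (right_slice h t)"
    by (induction t rule: tensor_induct)
      (simp_all add: T tensor_lift_add slice_simps assms functional_simps[OF assms(1)] mult.commute)
  show "tensor_lift (\<lambda>a b. f a * h b) t = h (left_slice f t)"
    by (induction t rule: tensor_induct)
      (simp_all add: T tensor_lift_add slice_simps assms functional_simps[OF assms(2)])
qed


section \<open>Skew derivations from a pairing\<close>

locale quantum_coproduct = quantum_group n q g T
  for n q and g :: "qgen \<Rightarrow> 'u::calg" and T +
  fixes \<Delta> :: "'u \<Rightarrow> ('u, 'u) tensor"
  assumes coprod: "coproduct n g \<Delta>"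
begin

abbreviation "Ule \<equiv> U_le n g"
abbreviation "Uge \<equiv> U_ge n g"

definition Um where "Um = subalg hull (F ` R)"
definition Up where "Up = subalg hull (E ` R)"

lemma subalgs: "subalg Ule" "subalg Uge" "subalg Um" "subalg Up"
  by (simp_all add: U_le_def U_ge_def Um_def Up_def subalg_hull)

lemmas Ule = subalgD[OF subalgs(1)] and Uge = subalgD[OF subalgs(2)]
  and Um = subalgD[OF subalgs(3)] and Up = subalgD[OF subalgs(4)]

lemma gens:
  assumes "\<alpha> \<in> R"
  shows "F \<alpha> \<in> Ule" "K \<alpha> \<in> Ule" "Ki \<alpha> \<in> Ule" "E \<alpha> \<in> Uge" "K \<alpha> \<in> Uge" "Ki \<alpha> \<in> Uge"
    "F \<alpha> \<in> Um" "E \<alpha> \<in> Up"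
  unfolding U_le_def U_ge_def Um_def Up_def by (rule hull_inc; use assms in blast)+

lemma Um_Ule: "y \<in> Um \<Longrightarrow> y \<in> Ule" and Up_Uge: "x \<in> Up \<Longrightarrow> x \<in> Uge"
proof -
  have "Um \<subseteq> Ule" "Up \<subseteq> Uge"
    unfolding Um_def Up_def by (rule subalg_hull_least; use subalgs gens in blast)+
  then show "y \<in> Um \<Longrightarrow> y \<in> Ule" and "x \<in> Up \<Longrightarrow> x \<in> Uge" by auto
qed

lemma \<Delta>_hom: "calg_hom \<Delta>"
  and \<Delta>_E: "\<alpha> \<in> R \<Longrightarrow> \<Delta> (E \<alpha>) = E \<alpha> \<otimes>\<^sub>t 1 + K \<alpha> \<otimes>\<^sub>t E \<alpha>"
  and \<Delta>_F: "\<alpha> \<in> R \<Longrightarrow> \<Delta> (F \<alpha>) = F \<alpha> \<otimes>\<^sub>t Ki \<alpha> + 1 \<otimes>\<^sub>t F \<alpha>"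
  and \<Delta>_K: "\<alpha> \<in> R \<Longrightarrow> \<Delta> (K \<alpha>) = K \<alpha> \<otimes>\<^sub>t K \<alpha>"
  using coprod by (simp_all add: coproduct_def)

lemma \<Delta>_1: "\<Delta> 1 = 1 \<otimes>\<^sub>t 1"
  by (simp add: calg_homD(2)[OF \<Delta>_hom] one_tensor_def)

text \<open>\<open>coproduct\<close> prescribes \<Delta> on \<open>K \<alpha>\<close> and not on its
  inverse, where the value is forced by uniqueness of inverses.\<close>

lemma \<Delta>_Ki:
  assumes "\<alpha> \<in> R" shows "\<Delta> (Ki \<alpha>) = Ki \<alpha> \<otimes>\<^sub>t Ki \<alpha>"
proof -
  have "\<Delta> (Ki \<alpha>) * (K \<alpha> \<otimes>\<^sub>t K \<alpha>) = \<Delta> (Ki \<alpha> * K \<alpha>)"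
    by (simp add: calg_homD(3)[OF \<Delta>_hom] \<Delta>_K assms)
  then have "\<Delta> (Ki \<alpha>) * (K \<alpha> \<otimes>\<^sub>t K \<alpha>) * (Ki \<alpha> \<otimes>\<^sub>t Ki \<alpha>) = Ki \<alpha> \<otimes>\<^sub>t Ki \<alpha>"
    by (simp add: Ki_K assms \<Delta>_1 tensor_mult_tens)
  then show ?thesis
    by (simp add: mult.assoc tensor_mult_tens K_Ki assms flip: one_tensor_def)
qed

lemmas \<Delta>_gens = \<Delta>_E \<Delta>_F \<Delta>_K \<Delta>_Ki \<Delta>_1

lemma \<Delta>_Ule: assumes "y \<in> Ule" shows "\<Delta> y \<in> tensor_square Ule"
proof -
  note h = calg_homD[OF \<Delta>_hom] and sub = subspaceD[OF subspace_tensor_square[of Ule]]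
  note t = tens_in_tensor_square[of _ Ule]
  show ?thesis using assms unfolding U_le_def
    by (induction rule: subalg_hull_induct)
      (auto simp: \<Delta>_gens h(3-6) simp flip: U_le_def intro!: sub t gens Ule tensor_square_mult subalgs)
qed

lemma \<Delta>_Uge: assumes "x \<in> Uge" shows "\<Delta> x \<in> tensor_square Uge"
proof -
  note h = calg_homD[OF \<Delta>_hom] and sub = subspaceD[OF subspace_tensor_square[of Uge]]
  note t = tens_in_tensor_square[of _ Uge]
  show ?thesis using assms unfolding U_ge_def
    by (induction rule: subalg_hull_induct)
      (auto simp: \<Delta>_gens h(3-6) simp flip: U_ge_def intro!: sub t gens Uge tensor_square_mult subalgs)
qed

end

text \<open>Here \<open>J\<close> is bilinear on the whole algebra; the \<open>q\<close>-Killing form is only constrained on \<open>U_le\<close> and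
  \<open>U_ge\<close>, but linear projections onto these subspaces extend it.\<close>

locale quantum_pairing = quantum_coproduct n q g T \<Delta>
  for n q and g :: "qgen \<Rightarrow> 'u::calg" and T \<Delta> +
  fixes J :: "'u \<Rightarrow> 'u \<Rightarrow> complex"
  assumes J_linear: "clinear (J y)" "clinear (\<lambda>y. J y x)"
    and J_mult_right: "y \<in> Ule \<Longrightarrow> x \<in> Uge \<Longrightarrow> x' \<in> Uge \<Longrightarrow>
      J y (x * x') = tensor_lift (\<lambda>a b. J a x' * J b x) (\<Delta> y)"
    and J_mult_left: "y \<in> Ule \<Longrightarrow> y' \<in> Ule \<Longrightarrow> x \<in> Uge \<Longrightarrow>
      J (y * y') x = tensor_lift (\<lambda>a b. J y a * J y' b) (\<Delta> x)"
    and J_Ki_K: "\<alpha> \<in> R \<Longrightarrow> \<alpha>' \<in> R \<Longrightarrow>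
      J (Ki \<alpha>) (K \<alpha>') = q powi cartan \<alpha> \<alpha>'"
    and J_1_K: "\<alpha> \<in> R \<Longrightarrow> J 1 (K \<alpha>) = 1" "\<alpha> \<in> R \<Longrightarrow> J 1 (Ki \<alpha>) = 1"
    and J_K_1: "\<alpha> \<in> R \<Longrightarrow> J (K \<alpha>) 1 = 1" "\<alpha> \<in> R \<Longrightarrow> J (Ki \<alpha>) 1 = 1"
    and J_1_1: "J 1 1 = 1"
    and J_K_E: "\<alpha> \<in> R \<Longrightarrow> \<alpha>' \<in> R \<Longrightarrow> J (Ki \<alpha>) (E \<alpha>') = 0"
      "\<alpha> \<in> R \<Longrightarrow> J 1 (E \<alpha>) = 0"
    and J_F_K: "\<alpha> \<in> R \<Longrightarrow> \<alpha>' \<in> R \<Longrightarrow> J (F \<alpha>) (K \<alpha>') = 0"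
      "\<alpha> \<in> R \<Longrightarrow> \<alpha>' \<in> R \<Longrightarrow> J (F \<alpha>) (Ki \<alpha>') = 0"
      "\<alpha> \<in> R \<Longrightarrow> J (F \<alpha>) 1 = 0"
    and J_F_E: "\<alpha> \<in> R \<Longrightarrow> \<alpha>' \<in> R \<Longrightarrow>
      J (F \<alpha>) (E \<alpha>') = (if \<alpha> = \<alpha>' then c0 else 0)"
begin

lemmas J_right = functional_simps[OF J_linear(1)] and J_left = functional_simps[OF J_linear(2)]

text \<open>In Sweedler notation, \<open>\<Phi> x y = (y\<^sub>(\<^sub>1\<^sub>), x) y\<^sub>(\<^sub>2\<^sub>)\<close>, \<open>\<Psi> x y = y\<^sub>(\<^sub>1\<^sub>) (y\<^sub>(\<^sub>2\<^sub>), x)\<close> and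
  \<open>\<Theta> y x = x\<^sub>(\<^sub>1\<^sub>) (y, x\<^sub>(\<^sub>2\<^sub>))\<close>.\<close>

definition \<Phi> :: "'u \<Rightarrow> 'u \<Rightarrow> 'u" where "\<Phi> x y = left_slice (\<lambda>a. J a x) (\<Delta> y)"
definition \<Psi> :: "'u \<Rightarrow> 'u \<Rightarrow> 'u" where "\<Psi> x y = right_slice (\<lambda>b. J b x) (\<Delta> y)"
definition \<Theta> :: "'u \<Rightarrow> 'u \<Rightarrow> 'u" where "\<Theta> y x = right_slice (J y) (\<Delta> x)"

text \<open>Pairing both factors of a coproduct is the same as slicing one and pairing the other.
  \<open>\<Theta>\<close> serves to remove factors \<open>F \<alpha>\<close> and
  \<open>Ki \<alpha>\<close> from the right end of the first argument.\<close>

lemma J_\<Phi>: "y \<in> Ule \<Longrightarrow> x \<in> Uge \<Longrightarrow> x' \<in> Uge \<Longrightarrow> J y (x * x') = J (\<Phi> x' y) x"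
  and J_\<Psi>: "y \<in> Ule \<Longrightarrow> x \<in> Uge \<Longrightarrow> x' \<in> Uge \<Longrightarrow> J y (x * x') = J (\<Psi> x y) x'"
  and J_\<Theta>: "y \<in> Ule \<Longrightarrow> y' \<in> Ule \<Longrightarrow> x \<in> Uge \<Longrightarrow> J (y * y') x = J y (\<Theta> y' x)"
  unfolding \<Phi>_def \<Psi>_def \<Theta>_def
  using J_mult_right[of y x x'] J_mult_left[of y y' x]
    tensor_lift_times[OF J_linear(2)[of x'] J_linear(2)[of x], of "\<Delta> y"]
    tensor_lift_times(1)[OF J_linear(1)[of y] J_linear(1)[of y'], of "\<Delta> x"] by simp_all

lemma slices_linear:
  "clinear (\<Phi> x)" "clinear (\<Psi> x)" "clinear (\<Theta> y)"
  unfolding \<Phi>_def \<Psi>_def \<Theta>_def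
  by (rule clinear_compose[OF clinear_left_slice] clinear_compose[OF clinear_right_slice],
      rule calg_homD(1)[OF \<Delta>_hom])+

lemmas \<Phi>_simps = functional_simps[OF slices_linear(1)]
  and \<Psi>_simps = functional_simps[OF slices_linear(2)]
  and \<Theta>_simps = functional_simps[OF slices_linear(3)]

lemma slices_gens:
  assumes "\<alpha> \<in> R"
  shows "\<Phi> x (F \<alpha>) = J (F \<alpha>) x *\<^sub>C Ki \<alpha> + J 1 x *\<^sub>C F \<alpha>"
    "\<Psi> x (F \<alpha>) = J (Ki \<alpha>) x *\<^sub>C F \<alpha> + J (F \<alpha>) x *\<^sub>C 1"
    "\<Phi> x (K \<alpha>) = J (K \<alpha>) x *\<^sub>C K \<alpha>" "\<Psi> x (K \<alpha>) = J (K \<alpha>) x *\<^sub>C K \<alpha>"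
    "\<Phi> x (Ki \<alpha>) = J (Ki \<alpha>) x *\<^sub>C Ki \<alpha>" "\<Psi> x (Ki \<alpha>) = J (Ki \<alpha>) x *\<^sub>C Ki \<alpha>"
    "\<Phi> x 1 = J 1 x *\<^sub>C 1" "\<Psi> x 1 = J 1 x *\<^sub>C 1"
    "\<Theta> y (E \<alpha>) = J y 1 *\<^sub>C E \<alpha> + J y (E \<alpha>) *\<^sub>C K \<alpha>" "\<Theta> y 1 = J y 1 *\<^sub>C 1"
  by (simp_all add: \<Phi>_def \<Psi>_def \<Theta>_def \<Delta>_gens assms slice_simps J_linear)

text \<open>Pairing with a group-like element is multiplicative and pairing with
  \<open>E \<alpha>\<close> is a twisted derivation; these are the hypotheses of the slicing
  lemmas.\<close>

lemma J_mult_gens: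
  assumes "b \<in> Ule" "b' \<in> Ule" "\<alpha> \<in> R"
  shows "J (b * b') (E \<alpha>) = J b (E \<alpha>) * J b' 1 + J b (K \<alpha>) * J b' (E \<alpha>)"
    "J (b * b') (K \<alpha>) = J b (K \<alpha>) * J b' (K \<alpha>)" "J (b * b') (Ki \<alpha>) = J b (Ki \<alpha>) * J b' (Ki \<alpha>)"
    "J (b * b') 1 = J b 1 * J b' 1"
  using assms by (simp_all add: J_mult_left gens Uge tensor_lift_times(1)[OF J_linear(1) J_linear(1)]
      \<Delta>_gens slice_simps J_linear J_right mult.commute)

lemma J_mult_gens':
  assumes "b \<in> Uge" "b' \<in> Uge" "\<alpha> \<in> R"
  shows "J (F \<alpha>) (b * b') = J (Ki \<alpha>) b * J (F \<alpha>) b' + J (F \<alpha>) b * J 1 b'"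
    "J (Ki \<alpha>) (b * b') = J (Ki \<alpha>) b * J (Ki \<alpha>) b'"
    "J 1 (b * b') = J 1 b * J 1 b'"
  using assms by (simp_all add: J_mult_right gens Ule tensor_lift_times(1)[OF J_linear(2) J_linear(2)]
      \<Delta>_gens slice_simps J_linear J_left mult.commute)

lemma grouplike_mult:
  assumes "\<And>b b'. b \<in> Ule \<Longrightarrow> b' \<in> Ule \<Longrightarrow> J (b * b') x = J b x * J b' x"
    and "y \<in> Ule" "y' \<in> Ule"
  shows "\<Phi> x (y * y') = \<Phi> x y * \<Phi> x y'" "\<Psi> x (y * y') = \<Psi> x y * \<Psi> x y'"
  unfolding \<Phi>_def \<Psi>_def calg_homD(3)[OF \<Delta>_hom]
  by (rule slice_grouplike_mult[of _ _ _ Ule]; use assms J_linear \<Delta>_Ule in blast)+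

lemma \<Phi>_1: assumes "y \<in> Ule" shows "\<Phi> 1 y = y"
  and \<Psi>_1: "\<Psi> 1 y = y"
proof -
  have R: "beta \<in> R" using n_pos by (simp add: simple_roots_def)
  have "\<Phi> 1 y = y \<and> \<Psi> 1 y = y"
    using assms unfolding U_le_def
    by (induction rule: subalg_hull_induct)
      (auto simp flip: U_le_def simp: slices_gens slices_gens(7,8)[OF R] J_K_1 J_F_K J_1_1 cscale_one \<Phi>_simps
        \<Psi>_simps grouplike_mult J_mult_gens(4)[OF _ _ R])
  then show "\<Phi> 1 y = y" "\<Psi> 1 y = y" by auto
qed

lemma \<Phi>_K:
  assumes "y \<in> Um" "\<alpha> \<in> R" shows "\<Phi> (K \<alpha>) y = y" "\<Phi> (Ki \<alpha>) y = y"
proof -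
  have "\<Phi> (K \<alpha>) y = y \<and> \<Phi> (Ki \<alpha>) y = y"
    using assms(1) unfolding Um_def
    by (induction rule: subalg_hull_induct)
      (use assms(2) in \<open>auto simp flip: Um_def simp: slices_gens slices_gens(7)[OF assms(2)] J_F_K J_1_K cscale_one
        \<Phi>_simps grouplike_mult J_mult_gens Um_Ule\<close>)
  then show "\<Phi> (K \<alpha>) y = y" "\<Phi> (Ki \<alpha>) y = y" by auto
qed

text \<open>In the coproduct of \<open>F \<gamma>\<close> the torus element stands in the second
  factor. Slicing the first factor by \<open>K \<alpha>\<close> is therefore trivial
  (\<open>\<Phi>_K\<close>), while slicing the second is a conjugation. This makes
  \<open>\<Phi> (E \<alpha>)\<close> an ordinary and \<open>\<Psi> (E \<alpha>)\<close> a twisted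
  derivation on \<open>Um\<close>.\<close>

lemma \<Psi>_K:
  assumes "y \<in> Um" "\<alpha> \<in> R" shows "\<Psi> (K \<alpha>) y = Ki \<alpha> * y * K \<alpha>"
  using assms(1) unfolding Um_def
proof (induction rule: subalg_hull_induct)
  case (gen y)
  then obtain \<gamma> where y: "y = F \<gamma>" "\<gamma> \<in> R" by auto
  have "Ki \<alpha> * F \<gamma> * K \<alpha> = (q powi cartan \<alpha> \<gamma>) *\<^sub>C F \<gamma>"
    using y assms(2) by (simp add: Ki_F calg_simps Ki_K)
  moreover have "cartan \<gamma> \<alpha> = cartan \<alpha> \<gamma>" by (simp add: cartan_def abs_minus_commute)
  ultimately show ?case using y assms(2) by (simp add: slices_gens J_Ki_K J_F_K)
next
  case (mult x y)
  have "Ki \<alpha> * (x * y) * K \<alpha> = (Ki \<alpha> * x * (K \<alpha> * Ki \<alpha>) * y * K \<alpha>)"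
    by (simp add: K_Ki assms(2) mult.assoc)
  also have "\<dots> = (Ki \<alpha> * x * K \<alpha>) * (Ki \<alpha> * y * K \<alpha>)" by (simp only: mult.assoc)
  finally show ?case using mult assms(2) J_mult_gens
    by (simp flip: Um_def add: grouplike_mult Um_Ule)
qed (use assms(2) in \<open>auto simp: slices_gens(8) J_1_K Ki_K \<Psi>_simps cscale_one calg_simps\<close>)

lemma \<Phi>_E_mult:
  assumes "y \<in> Um" "y' \<in> Ule" "\<alpha> \<in> R"
  shows "\<Phi> (E \<alpha>) (y * y') = \<Phi> (E \<alpha>) y * y' + y * \<Phi> (E \<alpha>) y'"
proof -
  have "\<Phi> (E \<alpha>) (y * y') = \<Phi> (E \<alpha>) y * \<Phi> 1 y' + \<Phi> (K \<alpha>) y * \<Phi> (E \<alpha>) y'"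
    unfolding \<Phi>_def calg_homD(3)[OF \<Delta>_hom]
    by (rule slice_mult(1)[of _ _ _ _ _ Ule])
      (use assms J_linear \<Delta>_Ule Um_Ule J_mult_gens in blast)+
  then show ?thesis using assms by (simp add: \<Phi>_1 \<Phi>_K)
qed

lemma \<Psi>_E_mult:
  assumes "y \<in> Um" "y' \<in> Ule" "\<alpha> \<in> R"
  shows "\<Psi> (E \<alpha>) (y * y') = \<Psi> (E \<alpha>) y * y' + (Ki \<alpha> * y * K \<alpha>) * \<Psi> (E \<alpha>) y'"
proof -
  have "\<Psi> (E \<alpha>) (y * y') = \<Psi> (E \<alpha>) y * \<Psi> 1 y' + \<Psi> (K \<alpha>) y * \<Psi> (E \<alpha>) y'"
    unfolding \<Psi>_def calg_homD(3)[OF \<Delta>_hom]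
    by (rule slice_mult(2)[of _ _ _ _ _ Ule])
      (use assms J_linear \<Delta>_Ule Um_Ule J_mult_gens in blast)+
  then show ?thesis using assms by (simp add: \<Psi>_1 \<Psi>_K)
qed

lemma \<Theta>_K:
  assumes "x \<in> Up" "\<alpha> \<in> R" shows "\<Theta> (Ki \<alpha>) x = x" "\<Theta> 1 x = x"
proof -
  have mult: "\<Theta> (Ki \<alpha>) (x * y) = \<Theta> (Ki \<alpha>) x * \<Theta> (Ki \<alpha>) y" "\<Theta> 1 (x * y) = \<Theta> 1 x * \<Theta> 1 y"
    if "x \<in> Up" "y \<in> Up" for x y
    unfolding \<Theta>_def calg_homD(3)[OF \<Delta>_hom]
    by (rule slice_grouplike_mult(2)[of _ _ _ Uge]; use that assms(2) J_linear \<Delta>_Uge Up_Uge J_mult_gens' in blast)+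
  have "\<Theta> (Ki \<alpha>) x = x \<and> \<Theta> 1 x = x"
    using assms(1) unfolding Up_def
    by (induction rule: subalg_hull_induct)
      (use assms(2) in \<open>auto simp flip: Up_def simp: slices_gens slices_gens(10)[OF assms(2)] J_K_E J_K_1 J_1_1 cscale_one
        \<Theta>_simps mult\<close>)
  then show "\<Theta> (Ki \<alpha>) x = x" "\<Theta> 1 x = x" by auto
qed

lemma \<Theta>_F_mult:
  assumes "x \<in> Up" "x' \<in> Up" "\<alpha> \<in> R"
  shows "\<Theta> (F \<alpha>) (x * x') = x * \<Theta> (F \<alpha>) x' + \<Theta> (F \<alpha>) x * x'"
proof -
  have "\<Theta> (F \<alpha>) (x * x') = \<Theta> (Ki \<alpha>) x * \<Theta> (F \<alpha>) x' + \<Theta> (F \<alpha>) x * \<Theta> 1 x'"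
    unfolding \<Theta>_def calg_homD(3)[OF \<Delta>_hom]
    by (rule slice_mult(2)[of _ _ _ _ _ Uge])
      (use assms J_linear \<Delta>_Uge Up_Uge J_mult_gens' in blast)+
  then show ?thesis using assms by (simp add: \<Theta>_K)
qed

lemma J_Ki_right: "y \<in> Ule \<Longrightarrow> x \<in> Up \<Longrightarrow> \<alpha> \<in> R \<Longrightarrow> J (y * Ki \<alpha>) x = J y x"
  by (simp add: J_\<Theta> gens Up_Uge \<Theta>_K)

lemma slices_E_F:
  assumes "\<alpha> \<in> R" "\<gamma> \<in> R"
  shows "\<Phi> (E \<alpha>) (F \<gamma>) = (if \<gamma> = \<alpha> then c0 *\<^sub>C Ki \<alpha> else 0)"
    "\<Psi> (E \<alpha>) (F \<gamma>) = (if \<gamma> = \<alpha> then c0 *\<^sub>C 1 else 0)"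
    "\<Theta> (F \<alpha>) (E \<gamma>) = (if \<gamma> = \<alpha> then c0 *\<^sub>C K \<alpha> else 0)"
    "\<Phi> (E \<alpha>) (Ki \<gamma>) = 0" "\<Phi> (E \<alpha>) 1 = 0" "\<Psi> (E \<alpha>) 1 = 0" "\<Theta> (F \<alpha>) 1 = 0"
  using assms by (simp_all add: slices_gens slices_gens(7,8,10)[OF assms(1)] J_F_E J_K_E J_F_K)

text \<open>The product rules of \<open>\<Phi>\<close> and \<open>\<Psi>\<close> fit the commutator,
  so generators suffice; there \<open>c0\<close> reproduces the relation for
  \<open>[E, F]\<close>.\<close>

lemma commutator:
  assumes "y \<in> Um" "\<alpha> \<in> R"
  shows "E \<alpha> * y = y * E \<alpha> + \<Phi> (E \<alpha>) y - K \<alpha> * \<Psi> (E \<alpha>) y"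
  using assms(1) unfolding Um_def
proof (induction rule: subalg_hull_induct)
  case (gen y)
  then obtain \<gamma> where y: "y = F \<gamma>" "\<gamma> \<in> R" by auto
  then show ?case using assms(2)
    by (simp add: E_F slices_E_F mult_cscale_right cvec.scale_right_diff_distrib inverse_eq_divide)
next
  case (mult x y)
  then have U: "x \<in> Um" "y \<in> Um" "y \<in> Ule" by (simp_all add: Um_def[symmetric] Um_Ule)
  have Ex: "E \<alpha> * x = x * E \<alpha> + \<Phi> (E \<alpha>) x - K \<alpha> * \<Psi> (E \<alpha>) x" by (fact mult)
  have "E \<alpha> * (x * y) = (x * E \<alpha> + \<Phi> (E \<alpha>) x - K \<alpha> * \<Psi> (E \<alpha>) x) * y"
    by (simp only: Ex mult.assoc[symmetric])
  also have "\<dots> = x * (E \<alpha> * y) + \<Phi> (E \<alpha>) x * y - K \<alpha> * \<Psi> (E \<alpha>) x * y"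
    by (simp add: algebra_simps)
  also have Ey: "E \<alpha> * y = y * E \<alpha> + \<Phi> (E \<alpha>) y - K \<alpha> * \<Psi> (E \<alpha>) y" by (fact mult)
  \<comment> \<open>Writing \<open>K \<alpha> * Ki \<alpha>\<close> for 1 in front of
    \<open>x\<close> creates the conjugate of \<open>x\<close> that occurs in the rule for
    \<open>\<Psi>\<close>.\<close>
  also have "x * (y * E \<alpha> + \<Phi> (E \<alpha>) y - K \<alpha> * \<Psi> (E \<alpha>) y) + \<Phi> (E \<alpha>) x * y - K \<alpha> * \<Psi> (E \<alpha>) x * y
      = x * y * E \<alpha> + (\<Phi> (E \<alpha>) x * y + x * \<Phi> (E \<alpha>) y)
      - (K \<alpha> * \<Psi> (E \<alpha>) x * y + (K \<alpha> * Ki \<alpha>) * x * K \<alpha> * \<Psi> (E \<alpha>) y)"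
    by (simp add: K_Ki assms(2)) (simp add: algebra_simps)
  also have "\<dots> = x * y * E \<alpha> + \<Phi> (E \<alpha>) (x * y) - K \<alpha> * \<Psi> (E \<alpha>) (x * y)"
    using U assms(2) by (simp add: \<Phi>_E_mult \<Psi>_E_mult algebra_simps)
  finally show ?case .
qed (use assms(2) in \<open>auto simp: slices_E_F \<Phi>_simps \<Psi>_simps calg_simps\<close>)

end

section \<open>Roots, weights, and the subalgebras \<open>A_plus\<close> and
  \<open>A_minus\<close>\<close>

definition rmu :: "nat \<Rightarrow> int" where "rmu i = - int (Suc i)"
definition rnu :: "nat \<Rightarrow> int" where "rnu j = int (Suc j)"

text \<open>A subdiagram of type A listed in order: both arms without beta have this form, and so do
  their tails.\<close>

definition root_path :: "nat \<Rightarrow> nat \<Rightarrow> (nat \<Rightarrow> int) \<Rightarrow> bool" where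
  "root_path n M \<rho> \<longleftrightarrow> (\<forall>k<M. \<rho> k \<in> simple_roots n) \<and>
     (\<forall>k m. k < m \<longrightarrow> m < M \<longrightarrow> cartan (\<rho> k) (\<rho> m) = (if m = Suc k then -1 else 0))"

lemma root_path_mu: "root_path n (n - 1) rmu" and root_path_nu: "root_path n (n - 1) rnu"
  by (auto simp: root_path_def rmu_def rnu_def simple_roots_def cartan_def)

lemma root_path_shift: "root_path n M \<rho> \<Longrightarrow> root_path n (M - b) (\<lambda>k. \<rho> (b + k))"
  by (auto simp: root_path_def)

lemma cartan_sym: "cartan \<alpha> \<alpha>' = cartan \<alpha>' \<alpha>"
  by (simp add: cartan_def abs_minus_commute)

lemma root_simps:
  "rmu i \<noteq> 0" "rnu i \<noteq> 0" "rmu i \<noteq> rnu j" "rnu j \<noteq> rmu i" "rmu i = rmu j \<longleftrightarrow> i = j" "rnu i = rnu j \<longleftrightarrow> i = j"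
  "cartan (rmu i) (rnu j) = 0" "cartan (rnu i) (rmu j) = 0"
  "cartan 0 (rmu (Suc i)) = 0" "cartan 0 (rnu (Suc i)) = 0" "cartan 0 (rmu 0) = -1" "cartan 0 (rnu 0) = -1"
  by (auto simp: rmu_def rnu_def cartan_def)

lemma root_mem: "Suc i < n \<Longrightarrow> rmu i \<in> simple_roots n" "Suc i < n \<Longrightarrow> rnu i \<in> simple_roots n"
  "n \<ge> 1 \<Longrightarrow> 0 \<in> simple_roots n"
  by (auto simp: rmu_def rnu_def simple_roots_def)

lemma root_cases:
  assumes "\<alpha> \<in> simple_roots n"
  obtains "\<alpha> = 0" | k where "\<alpha> = rmu k" "Suc k < n" | k where "\<alpha> = rnu k" "Suc k < n"
proof -
  consider "\<alpha> = 0" | "\<alpha> < 0" | "\<alpha> > 0" by linarith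
  then show ?thesis
  proof cases
    case 2
    then show ?thesis using that(2)[of "nat (- \<alpha> - 1)"] assms by (auto simp: rmu_def simple_roots_def)
  next
    case 3
    then show ?thesis using that(3)[of "nat (\<alpha> - 1)"] assms by (auto simp: rnu_def simple_roots_def)
  qed (use that in auto)
qed

text \<open>The inner product of \<open>\<alpha>\<close> with the root of \<open>Z.z i j\<close>,
  which is beta plus the first \<open>i\<close> roots of one arm and the first \<open>j\<close> of
  the other. In the sum everything cancels except at the ends of this chain; for
  \<open>i = j = 0\<close> the two positive terms add up to 2 at beta.\<close>

definition wt :: "int \<Rightarrow> nat \<Rightarrow> nat \<Rightarrow> int" where
  "wt \<alpha> i j = of_bool (\<alpha> = - int i) + of_bool (\<alpha> = int j) - of_bool (\<alpha> = rmu i) - of_bool (\<alpha> = rnu j)"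

lemma wt_simps:
  "wt \<alpha> 0 0 = cartan \<alpha> 0"
  "wt \<alpha> (Suc i) j = wt \<alpha> i j + cartan \<alpha> (rmu i)"
  "wt \<alpha> i (Suc j) = wt \<alpha> i j + cartan \<alpha> (rnu j)"
  "wt (rmu i) i j = -1" "wt (rnu j) i j = -1" "wt (rmu i) (Suc i) j = 1" "wt (rnu j) i (Suc j) = 1"
  by (auto simp: wt_def cartan_def rmu_def rnu_def)

context quantum_pairing
begin

lemma power_int_mult: "q powi a * q powi b = q powi (a + b)"
  using q0 by (simp add: power_int_add)

lemma beta_R: "0 \<in> R"
  using n_pos by (rule root_mem)

abbreviation "Ap \<equiv> A_plus n g T"
abbreviation "Am \<equiv> A_minus n g T"

lemma Ap_def: "Ap = subalg hull {Z.z i j | i j. i < n \<and> j < n}"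
  and Am_def: "Am = subalg hull {W.z i j | i j. i < n \<and> j < n}"
proof -
  have eq: "{f i j | i j. i \<in> {1..n} \<and> j \<in> {1..n}} = {f (Suc i) (Suc j) | i j. i < n \<and> j < n}"
    for f :: "nat \<Rightarrow> nat \<Rightarrow> 'u"
  proof safe
    fix i j assume "i \<in> {1..n}" "j \<in> {1..n}"
    then show "\<exists>i' j'. f i j = f (Suc i') (Suc j') \<and> i' < n \<and> j' < n"
      by (intro exI[of _ "i - 1"] exI[of _ "j - 1"]) auto
  qed force
  show "Ap = subalg hull {Z.z i j | i j. i < n \<and> j < n}"
    unfolding A_plus_def eq[of "Z_el g T"] by (simp add: Z_el_eq)
  show "Am = subalg hull {W.z i j | i j. i < n \<and> j < n}"
    unfolding A_minus_def eq[of "W_el g T"] by (simp add: W_el_eq)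
qed

lemma subalg_A: "subalg Ap" "subalg Am"
  by (simp_all add: A_plus_def A_minus_def subalg_hull)

lemmas Ap = subalgD[OF subalg_A(1)] and Am = subalgD[OF subalg_A(2)]

lemma Z_Ap: "i < n \<Longrightarrow> j < n \<Longrightarrow> Z.z i j \<in> Ap" and W_Am: "i < n \<Longrightarrow> j < n \<Longrightarrow> W.z i j \<in> Am"
  unfolding Ap_def Am_def by (rule hull_inc; blast)+

lemma W_Suc: "Suc i < n \<Longrightarrow> j < n \<Longrightarrow> W.z (Suc i) j = bracket 1 q (F (rmu i)) (W.z i j)"
  "i < n \<Longrightarrow> Suc j < n \<Longrightarrow> W.z i (Suc j) = bracket 1 q (F (rnu j)) (W.z i j)"
  "W.z 0 0 = F 0"
  by (simp_all only: W.z_Suc_left W.z_Suc_right W.z_0_0 rmu_def rnu_def)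

lemma Z_Suc: "Suc i < n \<Longrightarrow> j < n \<Longrightarrow> Z.z (Suc i) j = bracket (- inverse q) q (E (rmu i)) (Z.z i j)"
  "i < n \<Longrightarrow> Suc j < n \<Longrightarrow> Z.z i (Suc j) = bracket (- inverse q) q (E (rnu j)) (Z.z i j)"
  "Z.z 0 0 = E 0"
  by (simp_all only: Z.z_Suc_left Z.z_Suc_right Z.z_0_0 rmu_def rnu_def)

text \<open>A position is reached along the row \<open>i = 0\<close> and then down its column, in
  accordance with the order of the brackets in \<open>z_brackets\<close>.\<close>

lemma position_induct [consumes 2, case_names base right left]:
  assumes "i < n" "j < n" and "P 0 0"
    and "\<And>j. Suc j < n \<Longrightarrow> P 0 j \<Longrightarrow> P 0 (Suc j)"
    and "\<And>i j. Suc i < n \<Longrightarrow> j < n \<Longrightarrow> P i j \<Longrightarrow> P (Suc i) j"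
  shows "P i j"
proof -
  have "P 0 j" using assms(2) by (induction j) (auto intro: assms)
  then show ?thesis using assms(1,2) by (induction i) (auto intro: assms)
qed

lemma bracket_in: "subalg A \<Longrightarrow> a \<in> A \<Longrightarrow> x \<in> A \<Longrightarrow> bracket s q a x \<in> A"
  unfolding bracket_def by (intro subalgD)

lemma W_Um: "i < n \<Longrightarrow> j < n \<Longrightarrow> W.z i j \<in> Um"
  and Z_Up: "i < n \<Longrightarrow> j < n \<Longrightarrow> Z.z i j \<in> Up"
proof -
  show "W.z i j \<in> Um" if "i < n" "j < n"
    using that n_pos by (induction rule: position_induct)
      (auto simp: W_Suc root_mem intro!: bracket_in subalgs gens)
  show "Z.z i j \<in> Up" if "i < n" "j < n"
    using that n_pos by (induction rule: position_induct)
      (auto simp: Z_Suc root_mem intro!: bracket_in subalgs gens)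
qed

lemma Am_Um: "w \<in> Am \<Longrightarrow> w \<in> Um" and Ap_Up: "z \<in> Ap \<Longrightarrow> z \<in> Up"
proof -
  have "Am \<subseteq> Um" "Ap \<subseteq> Up"
    unfolding Am_def Ap_def by (rule subalg_hull_least; use subalgs W_Um Z_Up in blast)+
  then show "w \<in> Am \<Longrightarrow> w \<in> Um" and "z \<in> Ap \<Longrightarrow> z \<in> Up" by auto
qed

lemma K_bracket:
  assumes "K \<alpha> * y = c *\<^sub>C (y * K \<alpha>)" "K \<alpha> * f = d *\<^sub>C (f * K \<alpha>)"
  shows "K \<alpha> * bracket s q f y = (c * d) *\<^sub>C (bracket s q f y * K \<alpha>)"
proof -
  have "K \<alpha> * (y * f) = (c * d) *\<^sub>C (y * f * K \<alpha>)" "K \<alpha> * (f * y) = (c * d) *\<^sub>C (f * y * K \<alpha>)"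
    using assms by (simp_all add: calg_simps mult.commute flip: mult.assoc) (simp_all add: assms calg_simps mult.assoc mult.commute)
  then show ?thesis by (simp add: bracket_def calg_simps mult_ac)
qed

lemma K_W: "i < n \<Longrightarrow> j < n \<Longrightarrow> \<alpha> \<in> R \<Longrightarrow> K \<alpha> * W.z i j = (q powi - wt \<alpha> i j) *\<^sub>C (W.z i j * K \<alpha>)"
proof (induction rule: position_induct)
  case base then show ?case using beta_R by (simp add: W_Suc wt_simps K_F)
next
  case (right j)
  then have IH: "K \<alpha> * W.z 0 j = (q powi - wt \<alpha> 0 j) *\<^sub>C (W.z 0 j * K \<alpha>)" and R: "\<alpha> \<in> R" "rnu j \<in> R"
    by (auto simp: root_mem)
  from K_bracket[OF IH K_F[OF R], of "1"] show ?case using right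
    by (simp add: W_Suc wt_simps power_int_mult)
next
  case (left i j)
  then have IH: "K \<alpha> * W.z i j = (q powi - wt \<alpha> i j) *\<^sub>C (W.z i j * K \<alpha>)" and R: "\<alpha> \<in> R" "rmu i \<in> R"
    by (auto simp: root_mem)
  from K_bracket[OF IH K_F[OF R], of "1"] show ?case using left
    by (simp add: W_Suc wt_simps power_int_mult)
qed

lemma K_Z: "i < n \<Longrightarrow> j < n \<Longrightarrow> \<alpha> \<in> R \<Longrightarrow> K \<alpha> * Z.z i j = (q powi wt \<alpha> i j) *\<^sub>C (Z.z i j * K \<alpha>)"
proof (induction rule: position_induct)
  case base then show ?case using beta_R by (simp add: Z_Suc wt_simps K_E)
next
  case (right j)
  then have IH: "K \<alpha> * Z.z 0 j = (q powi wt \<alpha> 0 j) *\<^sub>C (Z.z 0 j * K \<alpha>)" and R: "\<alpha> \<in> R" "rnu j \<in> R"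
    by (auto simp: root_mem)
  from K_bracket[OF IH K_E[OF R], of "- inverse q"] show ?case using right
    by (simp add: Z_Suc wt_simps power_int_mult)
next
  case (left i j)
  then have IH: "K \<alpha> * Z.z i j = (q powi wt \<alpha> i j) *\<^sub>C (Z.z i j * K \<alpha>)" and R: "\<alpha> \<in> R" "rmu i \<in> R"
    by (auto simp: root_mem)
  from K_bracket[OF IH K_E[OF R], of "- inverse q"] show ?case using left
    by (simp add: Z_Suc wt_simps power_int_mult)
qed

lemma conj_K:
  assumes "\<alpha> \<in> R" "K \<alpha> * y = c *\<^sub>C (y * K \<alpha>)" "c \<noteq> 0"
  shows "Ki \<alpha> * y = inverse c *\<^sub>C (y * Ki \<alpha>)" "Ki \<alpha> * y * K \<alpha> = inverse c *\<^sub>C y"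
    "K \<alpha> * y * Ki \<alpha> = c *\<^sub>C y"
proof -
  have "y * K \<alpha> = inverse c *\<^sub>C (K \<alpha> * y)" using assms by (simp add: cscale_cscale cscale_one)
  then have 1: "Ki \<alpha> * (y * K \<alpha>) = inverse c *\<^sub>C (Ki \<alpha> * K \<alpha> * y)" by (simp add: calg_simps)
  then show "Ki \<alpha> * y * K \<alpha> = inverse c *\<^sub>C y" using assms by (simp add: Ki_K mult.assoc)
  from arg_cong[OF this, of "\<lambda>x. x * Ki \<alpha>"] show "Ki \<alpha> * y = inverse c *\<^sub>C (y * Ki \<alpha>)"
    using assms(1) by (simp add: mult.assoc K_Ki mult_cscale_left)
  show "K \<alpha> * y * Ki \<alpha> = c *\<^sub>C y" using assms by (simp add: calg_simps K_Ki)
qed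

lemma W_conj:
  assumes "i < n" "j < n" "\<alpha> \<in> R"
  shows "Ki \<alpha> * W.z i j = (q powi wt \<alpha> i j) *\<^sub>C (W.z i j * Ki \<alpha>)"
    "Ki \<alpha> * W.z i j * K \<alpha> = (q powi wt \<alpha> i j) *\<^sub>C W.z i j"
    "K \<alpha> * W.z i j * Ki \<alpha> = (q powi - wt \<alpha> i j) *\<^sub>C W.z i j"
  using conj_K[OF assms(3) K_W[OF assms]] q0 by (simp_all add: power_int_minus)

lemma \<Phi>_bracket:
  assumes "\<alpha> \<in> R" "\<gamma> \<in> R" "y \<in> Um"
  shows "\<Phi> (E \<alpha>) (bracket 1 q (F \<gamma>) y) = bracket 1 q (F \<gamma>) (\<Phi> (E \<alpha>) y) +
    (if \<gamma> = \<alpha> then c0 *\<^sub>C (y * Ki \<alpha> - q *\<^sub>C (Ki \<alpha> * y)) else 0)"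
  using assms
  by (simp add: bracket_def \<Phi>_simps \<Phi>_E_mult gens Um_Ule slices_E_F cscale_one calg_simps mult.commute)

lemma \<Psi>_bracket:
  assumes "\<alpha> \<in> R" "\<gamma> \<in> R" "y \<in> Um"
  shows "\<Psi> (E \<alpha>) (bracket 1 q (F \<gamma>) y) =
    \<Psi> (E \<alpha>) y * F \<gamma> - (q * q powi cartan \<alpha> \<gamma>) *\<^sub>C (F \<gamma> * \<Psi> (E \<alpha>) y) +
    (if \<gamma> = \<alpha> then c0 *\<^sub>C (Ki \<alpha> * y * K \<alpha> - q *\<^sub>C y) else 0)"
proof -
  have c: "Ki \<alpha> * F \<gamma> * K \<alpha> = (q powi cartan \<alpha> \<gamma>) *\<^sub>C F \<gamma>"
    using conj_K(2)[OF assms(1) K_F] assms q0 by (simp add: power_int_minus)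
  show ?thesis
    using assms
    by (simp add: bracket_def \<Psi>_simps \<Psi>_E_mult gens Um_Ule slices_E_F cscale_one c)
      (simp add: calg_simps mult.commute)
qed

lemma \<Theta>_bracket:
  assumes "\<alpha> \<in> R" "\<gamma> \<in> R" "x \<in> Up"
  shows "\<Theta> (F \<alpha>) (bracket s q (E \<gamma>) x) = bracket s q (E \<gamma>) (\<Theta> (F \<alpha>) x) +
    (if \<gamma> = \<alpha> then (s * c0) *\<^sub>C (x * K \<alpha> - q *\<^sub>C (K \<alpha> * x)) else 0)"
  using assms
  by (simp add: bracket_def \<Theta>_simps \<Theta>_F_mult gens slices_E_F calg_simps mult.commute mult.left_commute)

lemma bracket_0: "bracket s q' a 0 = (0 :: 'u)"
  by (simp add: bracket_def)

text \<open>A bracket with \<open>F \<alpha>\<close> contributes a multiple of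
  \<open>y * Ki \<alpha> - q *\<^sub>C (Ki \<alpha> * y)\<close>, which vanishes because the weight
  of \<open>y\<close> has inner product -1 with the new root.\<close>

lemma \<Phi>_W:
  assumes "i < n" "j < n" "\<alpha> \<in> R" "\<alpha> \<noteq> 0"
  shows "\<Phi> (E \<alpha>) (W.z i j) = 0"
  using assms
proof (induction rule: position_induct)
  case base then show ?case using beta_R by (simp add: W_Suc slices_E_F)
next
  case (right j)
  have "W.z 0 j * Ki (rnu j) - q *\<^sub>C (Ki (rnu j) * W.z 0 j) = 0"
    using right q0 by (simp add: W_conj root_mem wt_simps cscale_cscale power_int_minus cscale_one)
  with right show ?case by (auto simp: W_Suc \<Phi>_bracket root_mem W_Um bracket_0)
next
  case (left i j)
  have "W.z i j * Ki (rmu i) - q *\<^sub>C (Ki (rmu i) * W.z i j) = 0"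
    using left q0 by (simp add: W_conj root_mem wt_simps cscale_cscale power_int_minus cscale_one)
  with left show ?case by (auto simp: W_Suc \<Phi>_bracket root_mem W_Um bracket_0)
qed

lemma \<Phi>_Am: "w \<in> Am \<Longrightarrow> \<alpha> \<in> R \<Longrightarrow> \<alpha> \<noteq> 0 \<Longrightarrow> \<Phi> (E \<alpha>) w = 0"
  unfolding Am_def
  by (induction rule: subalg_hull_induct)
    (auto simp flip: Am_def simp: \<Phi>_W \<Phi>_simps \<Phi>_E_mult Am_Um Um_Ule slices_E_F)

text \<open>The same weight argument as for \<open>\<Phi>_W\<close>, on the positive side.\<close>

lemma \<Theta>_Z:
  assumes "i < n" "j < n" "\<alpha> \<in> R" "\<alpha> \<noteq> 0"
  shows "\<Theta> (F \<alpha>) (Z.z i j) = 0"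
  using assms
proof (induction rule: position_induct)
  case base then show ?case using beta_R by (simp add: Z_Suc slices_E_F)
next
  case (right j)
  have "Z.z 0 j * K (rnu j) - q *\<^sub>C (K (rnu j) * Z.z 0 j) = 0"
    using right q0 by (simp add: K_Z root_mem wt_simps cscale_cscale power_int_minus cscale_one)
  with right show ?case by (auto simp: Z_Suc \<Theta>_bracket root_mem Z_Up bracket_0)
next
  case (left i j)
  have "Z.z i j * K (rmu i) - q *\<^sub>C (K (rmu i) * Z.z i j) = 0"
    using left q0 by (simp add: K_Z root_mem wt_simps cscale_cscale power_int_minus cscale_one)
  with left show ?case by (auto simp: Z_Suc \<Theta>_bracket root_mem Z_Up bracket_0)
qed

lemma \<Theta>_Ap: "z \<in> Ap \<Longrightarrow> \<alpha> \<in> R \<Longrightarrow> \<alpha> \<noteq> 0 \<Longrightarrow> \<Theta> (F \<alpha>) z = 0"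
  unfolding Ap_def
  by (induction rule: subalg_hull_induct)
    (auto simp flip: Ap_def simp: \<Theta>_Z \<Theta>_simps \<Theta>_F_mult Ap_Up slices_E_F)

lemma J_F_right: "y \<in> Ule \<Longrightarrow> z \<in> Ap \<Longrightarrow> \<alpha> \<in> R \<Longrightarrow> \<alpha> \<noteq> 0 \<Longrightarrow> J (y * F \<alpha>) z = 0"
  by (simp add: J_\<Theta> gens Up_Uge Ap_Up \<Theta>_Ap J_right)

section \<open>Skew derivatives of chains\<close>

text \<open>The elements \<open>x_k\<close> and \<open>y_l\<close> of the overview. The value 1 for
  the empty chain lets all terms of the formula be treated as one double sum.\<close>

definition chainF :: "(nat \<Rightarrow> int) \<Rightarrow> nat \<Rightarrow> 'u" where
  "chainF \<rho> i = (case i of 0 \<Rightarrow> 1 | Suc k \<Rightarrow> brackets 1 q (\<lambda>k. F (\<rho> (Suc k))) (F (\<rho> 0)) k)"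

lemma chainF_simps: "chainF \<rho> 0 = 1" "chainF \<rho> (Suc 0) = F (\<rho> 0)"
  "chainF \<rho> (Suc (Suc k)) = bracket 1 q (F (\<rho> (Suc k))) (chainF \<rho> (Suc k))"
  by (simp_all add: chainF_def)

lemma root_pathD:
  assumes "root_path n M \<rho>" "k < m" "m < M"
  shows "\<rho> k \<in> R" "\<rho> m \<in> R" "cartan (\<rho> k) (\<rho> m) = (if m = Suc k then -1 else 0)" "\<rho> m \<noteq> \<rho> k"
proof -
  show R: "\<rho> k \<in> R" "\<rho> m \<in> R" and c: "cartan (\<rho> k) (\<rho> m) = (if m = Suc k then -1 else 0)"
    using assms unfolding root_path_def by (blast intro: less_trans)+
  have "cartan (\<rho> m) (\<rho> m) = 2" by (simp add: cartan_def)
  then show "\<rho> m \<noteq> \<rho> k" using c by (auto split: if_splits)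
qed

lemma root_path_mem: "root_path n M \<rho> \<Longrightarrow> k < M \<Longrightarrow> \<rho> k \<in> R"
  by (auto simp: root_path_def)

lemma chainF_Um: "root_path n M \<rho> \<Longrightarrow> k \<le> M \<Longrightarrow> chainF \<rho> k \<in> Um"
proof (induction k)
  case (Suc k)
  then show ?case using root_path_mem
    by (cases k) (auto simp: chainF_simps intro!: Um gens bracket_in subalgs)
qed (simp add: chainF_simps Um)

lemma chainF_comm:
  assumes "root_path n M \<rho>" "k \<le> M" "\<And>m. m < k \<Longrightarrow> F \<alpha> * F (\<rho> m) = F (\<rho> m) * F \<alpha>"
  shows "F \<alpha> * chainF \<rho> k = chainF \<rho> k * F \<alpha>"
  using assms(2,3)
proof (induction k)
  case (Suc k)
  then show ?case
    by (cases k) (simp_all add: chainF_simps commute_bracket)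
qed (simp add: chainF_simps)

lemma chainF_mu_nu:
  assumes "k < n" "l < n"
  shows "chainF rmu k * chainF rnu l = chainF rnu l * chainF rmu k"
  using assms(1)
proof (induction k)
  case (Suc k)
  have "F (rmu k) * chainF rnu l = chainF rnu l * F (rmu k)"
    using assms Suc.prems by (intro chainF_comm[OF root_path_nu] FF_comm) (auto simp: root_mem root_simps)
  then show ?case using Suc commute_bracket[of "chainF rnu l" "F (rmu k)" "chainF rmu k" 1]
    by (cases k) (simp_all add: chainF_simps)
qed (simp add: chainF_simps)

text \<open>The derivation at the first root removes that root. If nothing remains this costs
  \<open>c0\<close>; otherwise the bracket with the second generator multiplies by
  \<open>c0 * (inverse q - q) = 1\<close>, and later brackets just extend the remaining
  tail.\<close>

lemma \<Phi>_chainF: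
  assumes "root_path n M \<rho>" "Suc d \<le> M"
  shows "\<Phi> (E (\<rho> 0)) (chainF \<rho> (Suc d)) =
    (if d = 0 then c0 *\<^sub>C Ki (\<rho> 0) else chainF (\<lambda>k. \<rho> (Suc k)) d * Ki (\<rho> 0))"
  using assms(2)
proof (induction d)
  case 0
  then show ?case using root_path_mem[OF assms(1), of 0] by (simp add: chainF_simps slices_E_F)
next
  case (Suc d)
  note R = root_pathD[OF assms(1), of 0 "Suc d"]
  have Um: "chainF \<rho> (Suc d) \<in> Um" using chainF_Um[OF assms(1)] Suc.prems by simp
  have Ki: "Ki (\<rho> 0) * F (\<rho> (Suc d)) = (if d = 0 then inverse q else 1) *\<^sub>C (F (\<rho> (Suc d)) * Ki (\<rho> 0))"
    using Ki_F[OF R(1,2)] R(3) Suc.prems by (auto simp: power_int_minus)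
  have "\<Phi> (E (\<rho> 0)) (chainF \<rho> (Suc (Suc d))) = bracket 1 q (F (\<rho> (Suc d))) (\<Phi> (E (\<rho> 0)) (chainF \<rho> (Suc d)))"
    using R Suc.prems Um by (simp add: chainF_simps \<Phi>_bracket)
  also have "\<dots> = chainF (\<lambda>k. \<rho> (Suc k)) (Suc d) * Ki (\<rho> 0)"
  proof (cases d)
    case 0
    have "c0 * inverse q - q * c0 = inverse (q - inverse q) * (q - inverse q)" by (simp add: algebra_simps)
    then have "c0 * inverse q - q * c0 = 1" using q_facts by simp
    then show ?thesis using Suc 0 Ki
      by (simp add: bracket_def chainF_simps calg_simps cscale_one flip: cvec.scale_left_diff_distrib)
  next
    case (Suc m)
    then show ?thesis using Suc.IH Suc.prems Ki
      by (simp add: bracket_def chainF_simps calg_simps cscale_one)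
  qed
  finally show ?case by simp
qed

text \<open>Descending order of the factors puts \<open>E (\<rho> 0)\<close> on the right, so that
  it is the first to act on the chain.\<close>

primrec esE :: "(nat \<Rightarrow> int) \<Rightarrow> nat \<Rightarrow> 'u" where
  "esE \<rho> 0 = 1"
| "esE \<rho> (Suc b) = E (\<rho> b) * esE \<rho> b"

lemma esE_Up: "root_path n M \<rho> \<Longrightarrow> b \<le> M \<Longrightarrow> esE \<rho> b \<in> Up"
  by (induction b) (auto intro!: Up gens root_path_mem)

text \<open>Each \<open>E\<close> removes the next root of the chain or, when none is left, acts on
  \<open>p\<close>, which it kills. Thus the \<open>b\<close> factors leave a tail, use up the chain
  exactly, or give zero.\<close>

lemma strip:
  assumes \<rho>: "root_path n M \<rho>" and k: "k \<le> M"
    and p: "p \<in> Um" "\<And>m. m < M \<Longrightarrow> \<Phi> (E (\<rho> m)) p = 0"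
    and x: "x \<in> Up" and b: "b \<le> M"
  shows "J (p * chainF \<rho> k) (x * esE \<rho> b) =
    (if b < k then J (p * chainF (\<lambda>m. \<rho> (b + m)) (k - b)) x
     else if b = k then (if k = 0 then 1 else c0) * J p x else 0)"
  using x b
proof (induction b arbitrary: x)
  case 0
  then show ?case by (auto simp: chainF_simps)
next
  case (Suc b)
  have R: "\<rho> b \<in> R" using root_path_mem[OF \<rho>, of b] Suc.prems by simp
  have x': "x * E (\<rho> b) \<in> Up" using Suc.prems(1) R by (intro Up gens)
  have \<Phi>p: "\<Phi> (E (\<rho> b)) p = 0" using p(2)[of b] Suc.prems(2) by simp
  have chain: "chainF (\<lambda>m. \<rho> (b' + m)) (k - b') \<in> Um" for b'
    using chainF_Um[OF root_path_shift[OF \<rho>, of b'], of "k - b'"] k by simp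
  note side = Up_Uge Um_Ule p(1) Suc.prems gens R Um
  have "J (p * chainF \<rho> k) (x * esE \<rho> (Suc b)) = J (p * chainF \<rho> k) (x * E (\<rho> b) * esE \<rho> b)"
    by (simp add: mult.assoc)
  also have "\<dots> = (if b < k then J (p * chainF (\<lambda>m. \<rho> (b + m)) (k - b)) (x * E (\<rho> b))
     else if b = k then (if k = 0 then 1 else c0) * J p (x * E (\<rho> b)) else 0)"
    using Suc.IH[OF x'] Suc.prems by simp
  finally have step: "J (p * chainF \<rho> k) (x * esE \<rho> (Suc b)) =
    (if b < k then J (p * chainF (\<lambda>m. \<rho> (b + m)) (k - b)) (x * E (\<rho> b))
     else if b = k then (if k = 0 then 1 else c0) * J p (x * E (\<rho> b)) else 0)" .
  have zero: "J p (x * E (\<rho> b)) = 0"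
  proof -
    have "J p (x * E (\<rho> b)) = J (\<Phi> (E (\<rho> b)) p) x"
      using Suc.prems(1) R p(1) by (intro J_\<Phi> Um_Ule Up_Uge gens)
    then show ?thesis by (simp add: \<Phi>p J_left)
  qed
  have tail: "J (p * chainF (\<lambda>m. \<rho> (b + m)) (k - b)) (x * E (\<rho> b)) =
      (if Suc b = k then c0 * J p x else J (p * chainF (\<lambda>m. \<rho> (Suc b + m)) (k - Suc b)) x)" if "b < k"
  proof -
    obtain d where d: "k - b = Suc d" using \<open>b < k\<close> by (cases "k - b") auto
    have d': "k - Suc b = d" using d by simp
    have "\<Phi> (E (\<rho> b)) (p * chainF (\<lambda>m. \<rho> (b + m)) (k - b)) = p * \<Phi> (E (\<rho> b)) (chainF (\<lambda>m. \<rho> (b + m)) (k - b))"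
      using chain[of b] by (simp add: \<Phi>_E_mult side \<Phi>p)
    also have "\<dots> = (if d = 0 then c0 *\<^sub>C (p * Ki (\<rho> b)) else p * chainF (\<lambda>m. \<rho> (Suc b + m)) d * Ki (\<rho> b))"
      using \<Phi>_chainF[OF root_path_shift[OF \<rho>, of b], of d] k d by (simp add: mult.assoc mult_cscale_right)
    finally have "J (p * chainF (\<lambda>m. \<rho> (b + m)) (k - b)) (x * E (\<rho> b)) =
      J (if d = 0 then c0 *\<^sub>C (p * Ki (\<rho> b)) else p * chainF (\<lambda>m. \<rho> (Suc b + m)) d * Ki (\<rho> b)) x"
      using chain[of b] Suc.prems by (subst J_\<Phi>) (simp_all add: side)
    \<comment> \<open>The trailing \<open>Ki (\<rho> b)\<close> left behind by
      \<open>\<Phi>_chainF\<close> is dropped.\<close>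
    also have "\<dots> = (if d = 0 then c0 * J p x else J (p * chainF (\<lambda>m. \<rho> (Suc b + m)) d) x)"
      using chain[of "Suc b", unfolded d'] by (simp add: J_Ki_right Ule(4) side J_left)
    finally show ?thesis using d d' by auto
  qed
  show ?case
  proof (cases "b < k")
    case True
    then show ?thesis unfolding step by (simp add: tail)
  next
    case False
    then show ?thesis unfolding step using zero by auto
  qed
qed

text \<open>Every word of the chain ends in an \<open>F\<close> at a root other than beta, and this
  pairs to zero with \<open>A_plus\<close>; tails left by \<open>strip\<close> are killed in this
  way. \<open>y\<close> has to vary, since a bracket also puts letters in front of the shorter
  chain.\<close>

lemma J_chainF_right:
  assumes "root_path n M \<rho>" "k < M" "y \<in> Ule" "z \<in> Ap" "\<And>m. m \<le> k \<Longrightarrow> \<rho> m \<noteq> 0"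
  shows "J (y * chainF \<rho> (Suc k)) z = 0"
  using assms(2,3,5)
proof (induction k arbitrary: y)
  case 0
  then show ?case using root_path_mem[OF assms(1)] assms(4) by (simp add: chainF_simps J_F_right)
next
  case (Suc k)
  have R: "\<rho> (Suc k) \<in> R" "chainF \<rho> (Suc k) \<in> Um"
    using root_path_mem[OF assms(1)] chainF_Um[OF assms(1), of "Suc k"] Suc.prems by auto
  have "y * chainF \<rho> (Suc (Suc k)) = (y * chainF \<rho> (Suc k)) * F (\<rho> (Suc k)) - q *\<^sub>C ((y * F (\<rho> (Suc k))) * chainF \<rho> (Suc k))"
    by (simp add: chainF_simps(3) bracket_def cscale_one calg_simps)
  then show ?case using Suc R assms(4)
    by (simp add: J_left J_F_right Um_Ule Ule gens)
qed

lemma slices_E_1: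
  assumes "\<alpha> \<in> R"
  shows "\<Phi> (E \<alpha>) 1 = 0" "\<Psi> (E \<alpha>) 1 = 0"
  using slices_E_F(5,6)[OF assms assms] .

lemma F_chainF_comm:
  assumes "i < n" "Suc j < n"
  shows "F (rnu j) * chainF rmu i = chainF rmu i * F (rnu j)" "F (rmu j) * chainF rnu i = chainF rnu i * F (rmu j)"
  by (rule chainF_comm[OF root_path_mu] chainF_comm[OF root_path_nu];
      use assms in \<open>auto simp: root_mem root_simps intro!: FF_comm\<close>)+

text \<open>For the empty chain the bracket only measures the failure of \<open>F (\<rho> 0)\<close>
  to commute with \<open>Ki 0\<close>, and \<open>inverse q - q\<close> equals
  \<open>inverse c0\<close>.\<close>

lemma bracket_chainF_Ki:
  assumes "root_path n M \<rho>" "j < M" "cartan 0 (\<rho> j) = (if j = 0 then -1 else 0)"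
    and y: "F (\<rho> j) * y = y * F (\<rho> j)"
  shows "bracket 1 q (F (\<rho> j)) (y * chainF \<rho> j * Ki 0) =
    (if j = 0 then inverse c0 else 1) *\<^sub>C (y * chainF \<rho> (Suc j) * Ki 0)"
proof -
  have Ki: "Ki 0 * F (\<rho> j) = (if j = 0 then inverse q else 1) *\<^sub>C (F (\<rho> j) * Ki 0)"
    using Ki_F[OF beta_R root_path_mem[OF assms(1,2)]] assms(3) by (auto simp: power_int_minus)
  show ?thesis
    by (cases j) (use Ki y commute_left[OF y] in \<open>simp_all add: chainF_simps bracket_def calg_simps cscale_one
      flip: cvec.scale_left_diff_distrib\<close>)
qed

text \<open>The scalar left by \<open>strip\<close> when a chain of length \<open>i\<close> is used
  up: a single \<open>c0\<close>, whatever the positive length.\<close>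

definition pairing_const :: "nat \<Rightarrow> complex" where "pairing_const i = (if i = 0 then 1 else c0)"

text \<open>Starting from \<open>c0 *\<^sub>C Ki 0\<close>, the first bracket on each arm divides by
  \<open>c0\<close>, and later ones extend the chain without a scalar.\<close>

lemma \<Phi>_beta_W:
  assumes "i < n" "j < n"
  shows "\<Phi> (E 0) (W.z i j) = (c0 * inverse (pairing_const i) * inverse (pairing_const j)) *\<^sub>C (chainF rmu i * chainF rnu j * Ki 0)"
  using assms
proof (induction rule: position_induct)
  case base
  then show ?case using beta_R by (simp add: W_Suc slices_E_F chainF_simps pairing_const_def)
next
  case (right j)
  then have "\<Phi> (E 0) (W.z 0 (Suc j)) = (c0 * inverse (pairing_const j)) *\<^sub>C bracket 1 q (F (rnu j)) (1 * chainF rnu j * Ki 0)"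
    by (simp add: W_Suc \<Phi>_bracket beta_R root_mem W_Um root_simps chainF_simps pairing_const_def)
      (simp add: bracket_def calg_simps mult_ac)
  also have "\<dots> = (c0 * inverse (pairing_const (Suc j))) *\<^sub>C (chainF rnu (Suc j) * Ki 0)"
    using right q_facts by (subst bracket_chainF_Ki[OF root_path_nu])
      (auto simp: root_simps pairing_const_def cscale_cscale split: nat.split dest!: gr0_implies_Suc)
  finally show ?case by (simp add: chainF_simps pairing_const_def)
next
  case (left i j)
  let ?c = "c0 * inverse (pairing_const i) * inverse (pairing_const j)"
  have "\<Phi> (E 0) (W.z (Suc i) j) = bracket 1 q (F (rmu i)) (?c *\<^sub>C (chainF rnu j * chainF rmu i * Ki 0))"
    using left by (simp add: W_Suc \<Phi>_bracket beta_R root_mem W_Um root_simps chainF_mu_nu)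
  also have "\<dots> = ?c *\<^sub>C bracket 1 q (F (rmu i)) (chainF rnu j * chainF rmu i * Ki 0)"
    by (simp add: bracket_def calg_simps mult_ac)
  also have "\<dots> = (c0 * inverse (pairing_const (Suc i)) * inverse (pairing_const j)) *\<^sub>C (chainF rnu j * chainF rmu (Suc i) * Ki 0)"
    using left q_facts by (subst bracket_chainF_Ki[OF root_path_mu])
      (auto simp: root_simps pairing_const_def cscale_cscale F_chainF_comm split: nat.split dest!: gr0_implies_Suc)
  finally show ?case using left by (simp add: chainF_mu_nu)
qed

section \<open>Normal ordering with coefficients from \<open>A_minus\<close> on the left\<close>

definition AL :: "'u set \<Rightarrow> 'u set" where "AL L = cvec.span {a * l | a l. a \<in> Am \<and> l \<in> L}"

lemma subspace_AL: "cvec.subspace (AL L)"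
  by (simp add: AL_def)

lemmas AL = subspaceD[OF subspace_AL]

lemma AL_base: "a \<in> Am \<Longrightarrow> l \<in> L \<Longrightarrow> a * l \<in> AL L"
  unfolding AL_def by (rule cvec.span_base) blast

lemma AL_induct [consumes 1, case_names base]:
  assumes "x \<in> AL L" "\<And>a l. a \<in> Am \<Longrightarrow> l \<in> L \<Longrightarrow> h (a * l) \<in> A" "clinear h" "cvec.subspace A"
  shows "h x \<in> A"
  using assms(1) unfolding AL_def
  by (induction rule: span_induct_lin)
    (use assms(2) functional_simps[OF assms(3)] subspaceD[OF assms(4)] in auto)

lemma AL_left: "a \<in> Am \<Longrightarrow> x \<in> AL L \<Longrightarrow> a * x \<in> AL L"
  by (rule AL_induct[of x L "\<lambda>x. a * x"])
    (auto intro: AL_base Am subspace_AL clinear_mult_left simp flip: mult.assoc)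

context
  fixes L assumes closed: "\<And>l i j. l \<in> L \<Longrightarrow> i < n \<Longrightarrow> j < n \<Longrightarrow> l * W.z i j \<in> AL L"
begin

text \<open>Words that can be moved past the generators of \<open>A_minus\<close> can be moved past
  all of it, so that \<open>AL L\<close> is stable under \<open>A_minus\<close> on both
  sides.\<close>

lemma AL_mult_base:
  assumes "w \<in> Am" shows "\<forall>l\<in>L. l * w \<in> AL L"
  using assms unfolding Am_def
proof (induction rule: subalg_hull_induct)
  case (gen x) then show ?case using closed by blast
next
  case one
  show ?case using AL_base[of 1] Am by auto
next
  case (mult x y)
  have "u * y \<in> AL L" if "u \<in> AL L" for u
    using that by (rule AL_induct) (use mult in \<open>auto simp: mult.assoc intro: AL_left subspace_AL clinear_mult_right\<close>)
  then show ?case using mult by (simp flip: mult.assoc)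
qed (auto simp: calg_simps intro: AL)

lemma AL_right: "x \<in> AL L \<Longrightarrow> w \<in> Am \<Longrightarrow> x * w \<in> AL L"
  by (rule AL_induct[of x L "\<lambda>x. x * w"])
    (use AL_mult_base in \<open>auto simp: mult.assoc intro: AL_left subspace_AL clinear_mult_right\<close>)

end

lemma chainF_AL:
  assumes chain: "qchain q 1 (n - 1) (\<lambda>k. F (\<rho> k)) w" and w: "\<And>i. i < n \<Longrightarrow> w i \<in> Am" and "k < n" "i < n"
  shows "chainF \<rho> k * w i \<in> AL (chainF \<rho> ` {..<n})"
proof (cases k)
  case 0
  have "1 \<in> chainF \<rho> ` {..<n}" using n_pos by (intro image_eqI[of _ _ 0]) (simp_all add: chainF_simps)
  from AL_base[OF w[OF \<open>i < n\<close>] this] show ?thesis by (simp add: 0 chainF_simps)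
next
  case (Suc m)
  have x: "brackets 1 q (\<lambda>k. F (\<rho> (Suc k))) (F (\<rho> 0)) m = chainF \<rho> (Suc m)" for m by (simp add: chainF_def)
  have A: "w i' * chainF \<rho> k' \<in> AL (chainF \<rho> ` {..<n})" if "i' < n" "k' < n" for i' k'
    using that by (intro AL_base w) auto
  have A1: "w i' \<in> AL (chainF \<rho> ` {..<n})" if "i' < n" for i'
    using A[of i' 0] that n_pos by (simp add: chainF_simps)
  have m: "m < n - 1" using assms(3) Suc by simp
  note c = qchain.chain_w[OF chain refl m, unfolded x]
  consider "i = 0" | "0 < i" "i \<le> m" | "i = Suc m" | "Suc m < i" by linarith
  then show ?thesis
  proof cases
    case 1
    then show ?thesis unfolding Suc 1 c(1) using assms Suc by (intro AL A A1) auto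
  next
    case 2
    have "brackets 1 q (\<lambda>k. F (\<rho> (Suc k))) (F (\<rho> 0)) (i - 1) = chainF \<rho> i" using 2 by (cases i) (simp_all add: chainF_def)
    then show ?thesis unfolding Suc using c(2)[OF 2] x[of "i - 1"] 2 assms Suc by (auto intro!: AL A)
  next
    case 3
    then show ?thesis unfolding Suc 3 c(3) using assms Suc by (intro AL A) auto
  next
    case 4
    then show ?thesis unfolding Suc using c(4)[OF 4] assms Suc by (auto intro!: A)
  qed
qed

definition Lxy :: "'u set" where
  "Lxy = (\<lambda>(k, l). chainF rmu k * chainF rnu l * Ki 0) ` ({..<n} \<times> {..<n})"

text \<open>The torus factor passes \<open>W.z i j\<close> at the cost of a scalar; next the nu
  chain is moved past it, and then the mu chain past the coefficients so obtained.\<close>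

lemma Lxy_closed:
  assumes "l \<in> Lxy" "i < n" "j < n"
  shows "l * W.z i j \<in> AL Lxy"
proof -
  let ?X = "chainF rmu ` {..<n}" and ?Y = "chainF rnu ` {..<n}"
  obtain k m where l: "l = chainF rmu k * chainF rnu m * Ki 0" and km: "k < n" "m < n"
    using assms(1) by (auto simp: Lxy_def)
  have mu: "qchain q 1 (n - 1) (\<lambda>k. F (rmu k)) (\<lambda>i. W.z i j)" if "j < n" for j
    using W.grid.rows[of j] that by (simp add: rmu_def)
  have nu: "qchain q 1 (n - 1) (\<lambda>k. F (rnu k)) (W.z i)"
    using W.grid.columns[of i] assms by (simp add: rnu_def)
  have X: "x * a \<in> AL ?X" if "x \<in> ?X" "a \<in> Am" for x a
    using AL_mult_base[of ?X] chainF_AL[OF mu] W_Am that by auto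
  have "chainF rnu m * W.z i j \<in> AL ?Y"
    using chainF_AL[OF nu] W_Am assms km by auto
  then have "chainF rmu k * (chainF rnu m * W.z i j * Ki 0) \<in> AL Lxy"
  proof (rule AL_induct)
    fix a y assume a: "a \<in> Am" "y \<in> ?Y"
    then obtain m' where y: "y = chainF rnu m'" "m' < n" by auto
    have "chainF rmu k * a \<in> AL ?X" using X km a by auto
    then have "(chainF rmu k * a) * (y * Ki 0) \<in> AL Lxy"
    proof (rule AL_induct)
      fix b x assume b: "b \<in> Am" "x \<in> ?X"
      then have "x * y * Ki 0 \<in> Lxy" using y by (auto simp: Lxy_def)
      from AL_base[OF b(1) this] show "b * x * (y * Ki 0) \<in> AL Lxy" by (simp add: mult.assoc)
    qed (rule clinear_mult_right subspace_AL)+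
    then show "chainF rmu k * (a * y * Ki 0) \<in> AL Lxy" by (simp add: mult.assoc)
  qed (auto intro!: subspace_AL clinearI simp: calg_simps)
  then have "(q powi wt 0 i j) *\<^sub>C (chainF rmu k * (chainF rnu m * W.z i j * Ki 0)) \<in> AL Lxy" by (rule AL)
  then show ?thesis unfolding l using W_conj(1)[OF assms(2,3) beta_R] by (simp add: calg_simps)
qed

lemma \<Phi>_beta_AL: "w \<in> Am \<Longrightarrow> \<Phi> (E 0) w \<in> AL Lxy"
  unfolding Am_def
proof (induction rule: subalg_hull_induct)
  case (gen w)
  then obtain i j where w: "w = W.z i j" "i < n" "j < n" by auto
  have "1 * (chainF rmu i * chainF rnu j * Ki 0) \<in> AL Lxy"
    using w Am by (intro AL_base) (auto simp: Lxy_def)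
  then show ?case using w by (simp add: \<Phi>_beta_W AL)
next
  case one then show ?case by (simp add: slices_E_1 beta_R AL)
next
  case (mult w w')
  then have w: "w \<in> Am" "w' \<in> Am" by (simp_all add: Am_def)
  then have "\<Phi> (E 0) w * w' \<in> AL Lxy" "w * \<Phi> (E 0) w' \<in> AL Lxy"
    using mult AL_right[OF Lxy_closed] AL_left by blast+
  then show ?case using w beta_R by (simp add: \<Phi>_E_mult Am_Um Um_Ule AL)
qed (auto simp: \<Phi>_simps intro: AL)

lemma span_coefficients:
  assumes x: "x \<in> cvec.span {a * l | a l. a \<in> A \<and> l \<in> t ` P}" and P: "finite P" and A: "cvec.subspace A"
  shows "\<exists>D. (\<forall>p. D p \<in> A) \<and> x = (\<Sum>p\<in>P. D p * t p :: 'u)"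
  using x
proof (induction rule: span_induct_lin)
  case (base x)
  then obtain a p where x: "x = a * t p" "a \<in> A" "p \<in> P" by auto
  have "(\<Sum>p'\<in>P. (if p' = p then a else 0) * t p') = (\<Sum>p'\<in>P. if p' = p then a * t p' else 0)"
    by (rule sum.cong) auto
  then show ?case using x subspaceD[OF A] P by (intro exI[of _ "\<lambda>p'. if p' = p then a else 0"]) auto
next
  case zero then show ?case using subspaceD[OF A] by (intro exI[of _ "\<lambda>_. 0"]) auto
next
  case (add x y)
  then obtain D D' where "\<forall>p. D p \<in> A" "x = (\<Sum>p\<in>P. D p * t p)" "\<forall>p. D' p \<in> A" "y = (\<Sum>p\<in>P. D' p * t p)"
    by auto
  then show ?case using subspaceD[OF A]
    by (intro exI[of _ "\<lambda>p. D p + D' p"]) (auto simp: distrib_right sum.distrib)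
next
  case (scale c x)
  then obtain D where "\<forall>p. D p \<in> A" "x = (\<Sum>p\<in>P. D p * t p)" by auto
  then show ?case using subspaceD[OF A]
    by (intro exI[of _ "\<lambda>p. c *\<^sub>C D p"]) (auto simp: mult_cscale_left cvec.scale_sum_right)
qed

text \<open>The coefficients are merely chosen; uniqueness is not asserted. Their pairings with
  \<open>A_plus\<close> are determined by \<open>J_mult_Z\<close>, and the adjointness relation
  involves them only through these.\<close>

lemma \<Phi>_beta_coefficients:
  assumes "w \<in> Am"
  shows "\<exists>D. (\<forall>k l. D k l \<in> Am) \<and>
    \<Phi> (E 0) w = (\<Sum>k<n. \<Sum>l<n. D k l * (chainF rmu k * chainF rnu l * Ki 0))"
proof -
  obtain D where D: "\<forall>p. D p \<in> Am"
    "\<Phi> (E 0) w = (\<Sum>p\<in>{..<n} \<times> {..<n}. D p * (case p of (k, l) \<Rightarrow> chainF rmu k * chainF rnu l * Ki 0))"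
    using span_coefficients[OF \<Phi>_beta_AL[OF assms, unfolded AL_def Lxy_def] _ Am(1)] by auto
  show ?thesis
    by (rule exI[of _ "\<lambda>k l. D (k, l)"]) (use D in \<open>auto simp: sum.cartesian_product intro!: sum.cong\<close>)
qed

lemma \<Phi>_chainF_other:
  assumes "root_path n M \<rho>" "k \<le> M" "\<alpha> \<in> R" "\<And>m. m < k \<Longrightarrow> \<rho> m \<noteq> \<alpha>"
  shows "\<Phi> (E \<alpha>) (chainF \<rho> k) = 0"
  using assms(2,4)
proof (induction k)
  case (Suc k)
  have R: "\<rho> k \<in> R" "chainF \<rho> k \<in> Um" using root_path_mem[OF assms(1)] chainF_Um[OF assms(1)] Suc.prems by auto
  show ?case
    by (cases k) (use Suc R assms(3) in \<open>simp_all add: chainF_simps slices_E_F \<Phi>_bracket bracket_0\<close>)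
qed (simp add: chainF_simps slices_E_1 assms)

lemma J_esE_mu:
  assumes D: "D \<in> Um" "\<And>m. m < n - 1 \<Longrightarrow> \<Phi> (E (rmu m)) D = 0" and z: "z \<in> Ap" and "k < n" "i < n"
  shows "J (D * chainF rmu k) (z * esE rmu i) = (if k = i then pairing_const k * J D z else 0)"
proof -
  have "J (D * chainF (\<lambda>m. rmu (i + m)) (k - i)) z = 0" if "i < k"
    using J_chainF_right[OF root_path_shift[OF root_path_mu, where b = i], of "k - i - 1" D z] that assms
    by (auto simp: Um_Ule root_simps Suc_diff_Suc)
  then show ?thesis
    using strip[OF root_path_mu _ D, of k z i] assms by (auto simp: pairing_const_def Ap_Up)
qed

lemma J_esE:
  assumes D: "D \<in> Am" and z: "z \<in> Ap" and kl: "k < n" "l < n" "i < n" "j < n"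
  shows "J (D * chainF rmu k * chainF rnu l) (z * esE rmu i * esE rnu j) =
    (if k = i \<and> l = j then pairing_const k * pairing_const l * J D z else 0)"
proof -
  have D': "D \<in> Um" "\<And>m. Suc m < n \<Longrightarrow> \<Phi> (E (rmu m)) D = 0" "\<And>m. Suc m < n \<Longrightarrow> \<Phi> (E (rnu m)) D = 0"
    using D by (auto simp: Am_Um \<Phi>_Am root_mem root_simps)
  have Um_mu: "chainF rmu k \<in> Um" using chainF_Um[OF root_path_mu] kl by simp
  have es: "esE rmu i \<in> Up" using esE_Up[OF root_path_mu] kl by simp
  have 1: "J (D * chainF rmu k) (z * esE rmu i) = (if k = i then pairing_const k * J D z else 0)"
    using J_esE_mu[OF D'(1) _ z kl(1,3)] D' by simp
  \<comment> \<open>A surviving nu tail commutes with the mu chain, so it can be absorbed into the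
    coefficient before the mu factors are stripped; it then stands at the right end and pairs to
    zero.\<close>
  have "J (D * chainF rmu k * chainF (\<lambda>m. rnu (j + m)) (l - j)) (z * esE rmu i) = 0" if "j < l"
  proof -
    let ?v = "chainF (\<lambda>m. rnu (j + m)) (l - j)"
    note path = root_path_shift[OF root_path_nu, where b = j]
    have v: "?v \<in> Um" using chainF_Um[OF path, of "l - j"] kl by simp
    have comm: "chainF rmu k * ?v = ?v * chainF rmu k"
    proof -
      have "F \<alpha> * ?v = ?v * F \<alpha>" if "\<alpha> = rmu a" "Suc a < n" for \<alpha> a
        using that kl \<open>j < l\<close> by (intro chainF_comm[OF path] FF_comm) (auto simp: root_mem root_simps)
      then have "?v * F (rmu a) = F (rmu a) * ?v" if "Suc a < n" for a using that by simp
      then have "?v * chainF rmu k' = chainF rmu k' * ?v" if "k' < n" for k'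
        using that
      proof (induction k')
        case (Suc k')
        then show ?case using commute_bracket[of ?v "F (rmu k')" "chainF rmu k'" 1]
          by (cases k') (simp_all add: chainF_simps)
      qed (simp add: chainF_simps)
      then show ?thesis using kl by simp
    qed
    have \<Phi>v: "\<Phi> (E (rmu m)) (D * ?v) = 0" if "m < n - 1" for m
      using that D' v kl \<Phi>_chainF_other[OF path, of "l - j" "rmu m"]
      by (simp add: \<Phi>_E_mult root_mem Um_Ule root_simps)
    have "J (D * ?v) z = 0"
      using J_chainF_right[OF path, of "l - j - 1" D z] that kl z D'
      by (auto simp: Um_Ule root_simps Suc_diff_Suc)
    then have "J (D * ?v * chainF rmu k) (z * esE rmu i) = 0"
      using J_esE_mu[OF Um(4)[OF D'(1) v] \<Phi>v z kl(1,3)] by simp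
    then show ?thesis by (simp add: mult.assoc comm)
  qed
  moreover have "\<Phi> (E (rnu m)) (D * chainF rmu k) = 0" if "m < n - 1" for m
    using that D' Um_mu kl \<Phi>_chainF_other[OF root_path_mu, of k "rnu m"]
    by (simp add: \<Phi>_E_mult root_mem Um_Ule root_simps)
  ultimately show ?thesis
    using strip[OF root_path_nu _ Um(4)[OF D'(1) Um_mu], of l "z * esE rmu i" j] kl 1
    by (auto simp: pairing_const_def Up Ap_Up z es)
qed

text \<open>With this scalar the bracket is \<open>E z - q^-1 z E\<close>. Its second term has
  \<open>E \<alpha>\<close> on the right and vanishes, since \<open>\<Phi> (E \<alpha>)\<close>
  kills \<open>w\<close>.\<close>

lemma J_Z_step:
  assumes w: "w \<in> Am" and x: "x \<in> Up" and R: "\<alpha> \<in> R" "\<alpha> \<noteq> 0" and z: "z \<in> Up"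
  shows "J w (x * bracket (- inverse q) q (E \<alpha>) z) = J w ((x * E \<alpha>) * z)"
proof -
  have zE: "J w (x * z * E \<alpha>) = 0"
    using w x R z by (simp add: J_\<Phi> Am_Um Um_Ule Up_Uge Up gens \<Phi>_Am J_left)
  have "x * bracket (- inverse q) q (E \<alpha>) z = (x * E \<alpha>) * z - inverse q *\<^sub>C (x * z * E \<alpha>)"
    using q0 by (simp add: bracket_def calg_simps cscale_one)
  then show ?thesis by (simp add: J_right zE)
qed

text \<open>\<open>Z i j\<close> equals \<open>esE rmu i * esE rnu j * E 0\<close> modulo the left ideal generated by the \<open>E \<alpha>\<close> with
  \<open>\<alpha> \<noteq> 0\<close>, whose skew derivations vanish on \<open>Am\<close>.\<close>

lemma J_Z_esE:
  assumes w: "w \<in> Am" and "i < n" "j < n"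
  shows "\<forall>x\<in>Up. J w (x * Z.z i j) = J w (x * (esE rmu i * esE rnu j) * E 0)"
  using assms(2,3)
proof (induction rule: position_induct)
  case base then show ?case by (simp add: Z_Suc)
next
  case (right j)
  show ?case
  proof
    fix x assume x: "x \<in> Up"
    have R: "rnu j \<in> R" "rnu j \<noteq> 0" using right by (auto simp: root_mem root_simps)
    have "J w ((x * E (rnu j)) * Z.z 0 j) = J w ((x * E (rnu j)) * (esE rmu 0 * esE rnu j) * E 0)"
      using right x R by (intro right.IH[rule_format] Up gens)
    then show "J w (x * Z.z 0 (Suc j)) = J w (x * (esE rmu 0 * esE rnu (Suc j)) * E 0)"
      using J_Z_step[OF w x R Z_Up[of 0 j]] right by (simp add: Z_Suc mult.assoc)
  qed
next
  case (left i j)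
  show ?case
  proof
    fix x assume x: "x \<in> Up"
    have R: "rmu i \<in> R" "rmu i \<noteq> 0" using left by (auto simp: root_mem root_simps)
    have "J w ((x * E (rmu i)) * Z.z i j) = J w ((x * E (rmu i)) * (esE rmu i * esE rnu j) * E 0)"
      using left x R by (intro left.IH[rule_format] Up gens)
    then show "J w (x * Z.z (Suc i) j) = J w (x * (esE rmu (Suc i) * esE rnu j) * E 0)"
      using J_Z_step[OF w x R Z_Up[of i j]] left by (simp add: Z_Suc mult.assoc)
  qed
qed

text \<open>The factor \<open>E 0\<close> on the right turns \<open>w\<close> into
  \<open>\<Phi> (E 0) w\<close>; by \<open>J_esE\<close> the remaining factors select the one term
  with indices \<open>i, j\<close>.\<close>

lemma J_mult_Z:
  assumes w: "w \<in> Am" and z: "z \<in> Ap" and ij: "i < n" "j < n" and D: "\<And>k l. D k l \<in> Am"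
    and eq: "\<Phi> (E 0) w = (\<Sum>k<n. \<Sum>l<n. D k l * (chainF rmu k * chainF rnu l * Ki 0))"
  shows "J w (z * Z.z i j) = pairing_const i * pairing_const j * J (D i j) z"
proof -
  let ?e = "z * esE rmu i * esE rnu j"
  have e: "?e \<in> Up" using esE_Up[OF root_path_mu, of i] esE_Up[OF root_path_nu, of j] ij z
    by (intro Up) (auto simp: Ap_Up)
  have "J w (z * Z.z i j) = J w (?e * E 0)"
    using J_Z_esE[OF w ij] z by (simp add: Ap_Up mult.assoc)
  also have "\<dots> = J (\<Phi> (E 0) w) ?e"
    using w e beta_R by (intro J_\<Phi> gens) (auto simp: Am_Um Um_Ule Up_Uge)
  also have "\<dots> = (\<Sum>k<n. \<Sum>l<n. J (D k l * (chainF rmu k * chainF rnu l * Ki 0)) ?e)"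
    unfolding eq by (simp add: cvec.linear_sum[OF J_linear(2)])
  also have "\<dots> = (\<Sum>k<n. \<Sum>l<n. if k = i \<and> l = j then pairing_const k * pairing_const l * J (D k l) z else 0)"
  proof (intro sum.cong refl)
    fix k l assume kl: "k \<in> {..<n}" "l \<in> {..<n}"
    have "D k l * chainF rmu k * chainF rnu l \<in> Ule"
      using chainF_Um[OF root_path_mu, of k] chainF_Um[OF root_path_nu, of l] kl D
      by (intro Um_Ule Um(4)) (auto simp: Am_Um)
    from J_Ki_right[OF this e beta_R]
    have "J (D k l * (chainF rmu k * chainF rnu l * Ki 0)) ?e = J (D k l * chainF rmu k * chainF rnu l) ?e"
      by (simp add: mult.assoc)
    also have "\<dots> = (if k = i \<and> l = j then pairing_const k * pairing_const l * J (D k l) z else 0)"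
      using kl ij D z by (intro J_esE) auto
    finally show "J (D k l * (chainF rmu k * chainF rnu l * Ki 0)) ?e =
      (if k = i \<and> l = j then pairing_const k * pairing_const l * J (D k l) z else 0)" .
  qed
  also have "\<dots> = (\<Sum>k<n. if k = i then (\<Sum>l<n. if l = j then pairing_const k * pairing_const l * J (D k l) z else 0) else 0)"
    by (intro sum.cong) auto
  also have "\<dots> = pairing_const i * pairing_const j * J (D i j) z" using ij by simp
  finally show ?thesis .
qed

section \<open>Nondegeneracy\<close>

text \<open>At the first bracket after \<open>W.z 0 0\<close> the derivative of the previous vector
  is the scalar \<open>c0\<close>, and the two terms cancel because
  \<open>q * inverse q = 1\<close>; from then on all derivatives vanish.\<close>

lemma \<Psi>_beta_W:
  assumes "i < n" "j < n"
  shows "\<Psi> (E 0) (W.z i j) = (if i = 0 \<and> j = 0 then c0 *\<^sub>C 1 else 0)"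
  using assms
proof (induction rule: position_induct)
  case base
  then show ?case using beta_R by (simp add: W_Suc slices_E_F)
next
  case (right j)
  then have "rnu j \<in> R" by (simp add: root_mem)
  note B = \<Psi>_bracket[OF beta_R this W_Um[of 0 j]]
  show ?case
    by (cases j) (use right B W_Suc(2)[of 0 j] q0 in \<open>simp_all add: root_simps mult_cscale_left mult_cscale_right
        power_int_minus cscale_cscale\<close>)
next
  case (left i j)
  then have "rmu i \<in> R" by (simp add: root_mem)
  note B = \<Psi>_bracket[OF beta_R this W_Um[of i j]]
  show ?case
    by (cases i) (use left B W_Suc(1)[of i j] q0 in \<open>simp_all add: root_simps mult_cscale_left mult_cscale_right
        power_int_minus cscale_cscale\<close>)
qed

lemma F_W_comm:
  assumes "i < m" "Suc m < n" "j < n"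
  shows "F (rmu m) * W.z i j = W.z i j * F (rmu m)" "F (rnu m) * W.z j i = W.z j i * F (rnu m)"
  using qchain.f_w_greater[OF W.grid.rows[of j], of i m] qchain.f_w_greater[OF W.grid.columns[of j], of i m] assms
  by (simp_all add: rmu_def rnu_def)

lemma cartan_Suc: "cartan (rmu m) (rmu (Suc m)) = -1" "cartan (rnu m) (rnu (Suc m)) = -1"
  by (auto simp: cartan_def rmu_def rnu_def)

lemma W_conj_raise: "c0 *\<^sub>C ((q powi -1) *\<^sub>C w - q *\<^sub>C w) = (w :: 'u)"
proof -
  have "c0 * (inverse q - q) = inverse (q - inverse q) * (q - inverse q)" by (simp add: algebra_simps)
  then have "c0 * (inverse q - q) = 1" using q_facts by simp
  then show ?thesis
    by (simp add: power_int_minus cscale_cscale cscale_one flip: cvec.scale_left_diff_distrib)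
qed

text \<open>\<open>\<Psi>\<close> at a simple root undoes the bracket with this root, provided that
  it was the last one on its arm.\<close>

lemma \<Psi>_W:
  assumes "i < n" "j < n" "Suc m < n"
  shows "\<Psi> (E (rmu m)) (W.z i j) = (if i = Suc m then W.z m j else 0)"
    and "\<Psi> (E (rnu m)) (W.z i j) = (if j = Suc m then W.z i m else 0)"
proof -
  have R: "rmu m \<in> R" "rnu m \<in> R" using assms by (auto simp: root_mem)
  have "\<Psi> (E (rmu m)) (W.z i j) = (if i = Suc m then W.z m j else 0) \<and>
    \<Psi> (E (rnu m)) (W.z i j) = (if j = Suc m then W.z i m else 0)"
    using assms(1,2)
  proof (induction rule: position_induct)
    case base
    then show ?case using R beta_R by (simp add: W_Suc slices_E_F root_simps)
  next
    case (right j)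
    then have "rnu j \<in> R" by (simp add: root_mem)
    note B = \<Psi>_bracket[OF R(1) this W_Um[of 0 j]] \<Psi>_bracket[OF R(2) this W_Um[of 0 j]]
    have 1: "\<Psi> (E (rmu m)) (W.z 0 (Suc j)) = 0"
      using right B by (simp add: W_Suc root_simps)
    have 2: "\<Psi> (E (rnu m)) (W.z 0 (Suc j)) = (if Suc j = Suc m then W.z 0 m else 0)"
    \<comment> \<open>One further bracket destroys the derivative: \<open>W.z 0 m\<close> commutes
      with the new generator and the coefficients cancel.\<close>
    proof (cases "j = Suc m")
      case True
      then show ?thesis using right B q0 F_W_comm(2)[of m "Suc m" 0]
        by (simp add: W_Suc root_simps cartan_Suc power_int_minus cscale_one)
    next
      case False
      then show ?thesis using right B R(2) W_conj(2)[of 0 j "rnu j"]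
        by (auto simp: W_Suc root_simps wt_simps W_conj_raise[simplified])
    qed
    show ?case using 1 2 by simp
  next
    case (left i j)
    then have "rmu i \<in> R" by (simp add: root_mem)
    note B = \<Psi>_bracket[OF R(1) this W_Um[of i j]] \<Psi>_bracket[OF R(2) this W_Um[of i j]]
    have 1: "\<Psi> (E (rnu m)) (W.z (Suc i) j) = (if j = Suc m then W.z (Suc i) m else 0)"
      using left B assms(3) by (simp add: W_Suc root_simps bracket_def cscale_one)
    have 2: "\<Psi> (E (rmu m)) (W.z (Suc i) j) = (if Suc i = Suc m then W.z m j else 0)"
    proof (cases "i = Suc m")
      case True
      then show ?thesis using left B q0 F_W_comm(1)[of m "Suc m" j]
        by (simp add: W_Suc root_simps cartan_Suc power_int_minus cscale_one)
    next
      case False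
      then show ?thesis using left B R(1) W_conj(2)[of i j "rmu i"]
        by (auto simp: W_Suc root_simps wt_simps W_conj_raise[simplified])
    qed
    show ?case using 1 2 by simp
  qed
  then show "\<Psi> (E (rmu m)) (W.z i j) = (if i = Suc m then W.z m j else 0)"
    and "\<Psi> (E (rnu m)) (W.z i j) = (if j = Suc m then W.z i m else 0)" by auto
qed

text \<open>The entries outside the rectangle ending at \<open>(i, j)\<close>. They include all
  positions after \<open>(i, j)\<close> in column-major order (\<open>Wfrom_above\<close>), and
  lowering by \<open>\<Psi>\<close> leads from one such algebra to that of the preceding
  position.\<close>

definition above :: "nat \<Rightarrow> nat \<Rightarrow> 'u set" where
  "above i j = subalg hull {W.z k l | k l. k < n \<and> l < n \<and> \<not> (k \<le> i \<and> l \<le> j)}"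

lemma subalg_above: "subalg (above i j)"
  by (simp add: above_def subalg_hull)

lemmas above = subalgD[OF subalg_above]

lemma W_above: "k < n \<Longrightarrow> l < n \<Longrightarrow> \<not> (k \<le> i \<and> l \<le> j) \<Longrightarrow> W.z k l \<in> above i j"
  unfolding above_def by (rule hull_inc) blast

lemmas above_induct = subalg_hull_induct[of _ "{W.z k l | k l. k < n \<and> l < n \<and> \<not> (k \<le> i \<and> l \<le> j)}",
    folded above_def, consumes 1, case_names gen one add scale mult] for i j

lemma above_mono: "i \<le> i' \<Longrightarrow> j \<le> j' \<Longrightarrow> above i' j' \<subseteq> above i j"
  unfolding above_def by (rule hull_mono) force

lemma above_Um: "w \<in> above i j \<Longrightarrow> w \<in> Um"
proof -
  have "above i j \<subseteq> Um" unfolding above_def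
    by (rule subalg_hull_least) (use subalgs W_Um in blast)+
  then show "w \<in> above i j \<Longrightarrow> w \<in> Um" by blast
qed

lemma conj_mult:
  "\<alpha> \<in> R \<Longrightarrow> Ki \<alpha> * (x * y) * K \<alpha> = (Ki \<alpha> * x * K \<alpha>) * (Ki \<alpha> * y * K \<alpha>)"
proof -
  assume a: "\<alpha> \<in> R"
  have "Ki \<alpha> * (x * y) * K \<alpha> = Ki \<alpha> * x * (K \<alpha> * Ki \<alpha>) * y * K \<alpha>" by (simp add: K_Ki a mult.assoc)
  then show ?thesis by (simp only: mult.assoc)
qed

lemma conj_above: "w \<in> above i j \<Longrightarrow> \<alpha> \<in> R \<Longrightarrow> Ki \<alpha> * w * K \<alpha> \<in> above i j"
proof (induction rule: above_induct)
  case (gen w)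
  then obtain k l where w: "w = W.z k l" "k < n" "l < n" "\<not> (k \<le> i \<and> l \<le> j)" by blast
  then show ?case using gen.prems by (simp only: W_conj(2)) (intro above W_above)
next
  case (add x y)
  then show ?case by (simp only: distrib_left distrib_right above(5))
next
  case (scale c x)
  then show ?case by (simp only: mult_cscale_left mult_cscale_right above(7))
next
  case (mult x y)
  then show ?case by (simp only: conj_mult above(4))
qed (simp add: Ki_K above)

text \<open>Twisted power rule: each \<open>y\<close> that is passed contributes \<open>c\<close>
  from the conjugation and \<open>d\<close> from moving \<open>u\<close> to the left.\<close>

lemma \<Psi>_power:
  assumes "\<alpha> \<in> R" "y \<in> Um" "\<Psi> (E \<alpha>) y = u" "Ki \<alpha> * y * K \<alpha> = c *\<^sub>C y" "y * u = d *\<^sub>C (u * y)"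
  shows "\<Psi> (E \<alpha>) (y ^ Suc b) = (\<Sum>t\<le>b. (c * d) ^ t) *\<^sub>C (u * y ^ b)"
proof (induction b)
  case 0
  then show ?case using assms by (simp add: cscale_one)
next
  case (Suc b)
  have yb: "y ^ Suc b \<in> Um" using assms by (intro subalg_power subalgs)
  have "\<Psi> (E \<alpha>) (y ^ Suc (Suc b)) = u * y ^ Suc b + (c *\<^sub>C y) * \<Psi> (E \<alpha>) (y ^ Suc b)"
    using \<Psi>_E_mult[OF assms(2) Um_Ule[OF yb] assms(1)] assms by simp
  also have "\<dots> = u * y ^ Suc b + (c * (\<Sum>t\<le>b. (c * d) ^ t)) *\<^sub>C ((y * u) * y ^ b)"
    unfolding Suc by (simp add: calg_simps)
  also have "\<dots> = (1 + c * d * (\<Sum>t\<le>b. (c * d) ^ t)) *\<^sub>C (u * y ^ Suc b)"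
    by (simp add: assms(5) calg_simps cscale_add_left cscale_one mult_ac)
  also have "1 + c * d * (\<Sum>t\<le>b. (c * d) ^ t) = (\<Sum>t\<le>Suc b. (c * d) ^ t)"
    by (simp only: sum.atMost_Suc_shift sum_distrib_left power_0 power_Suc)
  finally show ?case .
qed

text \<open>The quantum integer \<open>[[b + 1]]\<close>, with \<open>b + 1\<close> terms.\<close>

definition qint :: "nat \<Rightarrow> complex" where "qint b = (\<Sum>t\<le>b. (q * q) ^ t)"

text \<open>Geometric series: \<open>(1 - q^2) [[b + 1]] = 1 - q^(2b + 2)\<close>. Here q not being
  a root of unity is used for arbitrarily large exponents.\<close>

lemma qint_nonzero: "qint b \<noteq> 0"
proof -
  have "(q * q) ^ Suc b \<noteq> 1"
    using not_root[of "2 * Suc b"] by (simp add: power_mult power2_eq_square del: mult_Suc_right)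
  moreover have "(1 - q * q) * qint b = 1 - (q * q) ^ Suc b"
    unfolding qint_def using sum_gp_basic[of "q * q" b] by simp
  ultimately show ?thesis by auto
qed

text \<open>The triangularity step in a form that survives induction over positions:
  \<open>x\<close> is an arbitrary element of \<open>Up\<close> rather than a monomial, so that
  further factors can be absorbed into it.\<close>

definition orthogonal_above :: "nat \<Rightarrow> nat \<Rightarrow> bool" where
  "orthogonal_above i j \<longleftrightarrow> (\<forall>w\<in>above i j. \<forall>x\<in>Up. J w (Z.z i j * x) = 0 \<and>
     (\<forall>b. J (W.z i j ^ Suc b * w) (Z.z i j * x) = c0 * qint b * J (W.z i j ^ b * w) x))"

lemma \<Psi>_above:
  assumes "w \<in> above i j" "\<alpha> \<in> R" and A: "subalg A" "above i j \<subseteq> A"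
    and gens: "\<And>k l. k < n \<Longrightarrow> l < n \<Longrightarrow> \<not> (k \<le> i \<and> l \<le> j) \<Longrightarrow> \<Psi> (E \<alpha>) (W.z k l) \<in> A"
  shows "\<Psi> (E \<alpha>) w \<in> A"
  using assms(1)
proof (induction rule: above_induct)
  case (gen w)
  then show ?case using gens by blast
next
  case (mult x y)
  then have "x \<in> A" "y \<in> A" "Ki \<alpha> * x * K \<alpha> \<in> A" using A conj_above assms(2) by blast+
  then show ?case using mult assms(2) A
    by (simp add: \<Psi>_E_mult above_Um Um_Ule subalgD)
qed (use assms(2) in \<open>auto simp: \<Psi>_simps slices_E_1 intro: subalgD[OF A(1)]\<close>)

text \<open>Write \<open>Z.z i j\<close> as \<open>E Z' - q^-1 Z' E\<close>, where \<open>Z'\<close>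
  belongs to the preceding position. Against \<open>above i' j'\<close>, which contains
  \<open>above i j\<close> and \<open>W.z i j\<close>, the second term vanishes by hypothesis. In
  the first, \<open>E\<close> passes to the other argument as \<open>\<Psi>\<close> and lowers
  \<open>W.z i j\<close> to the preceding entry.\<close>

lemma orthogonal_above_step:
  assumes IH: "orthogonal_above i' j'" and ij: "i < n" "j < n" "i' < n" "j' < n" and \<alpha>: "\<alpha> \<in> R"
    and Z: "Z.z i j = bracket (- inverse q) q (E \<alpha>) (Z.z i' j')"
    and \<Psi>: "\<Psi> (E \<alpha>) (W.z i j) = W.z i' j'"
    and conj: "Ki \<alpha> * W.z i j * K \<alpha> = q *\<^sub>C W.z i j"
    and WW: "W.z i j * W.z i' j' = q *\<^sub>C (W.z i' j' * W.z i j)"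
    and \<Psi>_ab: "\<And>w. w \<in> above i j \<Longrightarrow> \<Psi> (E \<alpha>) w \<in> above i' j'"
    and ab: "above i j \<subseteq> above i' j'" "W.z i j \<in> above i' j'"
  shows "orthogonal_above i j"
  unfolding orthogonal_above_def
proof (intro ballI conjI allI)
  fix w x assume w: "w \<in> above i j" and x: "x \<in> Up"
  have Ex: "E \<alpha> * x \<in> Up" and Zx: "Z.z i' j' * x \<in> Up" using \<alpha> x Z_Up ij by (auto intro: Up gens)
  have IH0: "J w' (Z.z i' j' * x') = 0" if "w' \<in> above i' j'" "x' \<in> Up" for w' x'
    using IH that by (auto simp: orthogonal_above_def)
  have Z': "J y (Z.z i j * x) = J (\<Psi> (E \<alpha>) y) (Z.z i' j' * x)" if y: "y \<in> above i' j'" for y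
  proof -
    have "Z.z i j * x = E \<alpha> * (Z.z i' j' * x) - inverse q *\<^sub>C (Z.z i' j' * (E \<alpha> * x))"
      unfolding Z using q0 by (simp add: bracket_def calg_simps cscale_one)
    then have "J y (Z.z i j * x) = J y (E \<alpha> * (Z.z i' j' * x))"
      by (simp add: J_right IH0[OF y Ex])
    then show ?thesis using y Zx \<alpha> by (simp add: J_\<Psi> above_Um Um_Ule Up_Uge gens)
  qed
  show "J w (Z.z i j * x) = 0"
    using w ab x by (simp add: Z' IH0 \<Psi>_ab subsetD)
  fix b
  have p: "W.z i j ^ k \<in> above i' j'" for k using ab above by (intro subalg_power subalg_above)
  have "J (W.z i j ^ Suc b * w) (Z.z i j * x) = J (\<Psi> (E \<alpha>) (W.z i j ^ Suc b * w)) (Z.z i' j' * x)"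
    by (intro Z' above(4) p subsetD[OF ab(1) w])
  also have "\<Psi> (E \<alpha>) (W.z i j ^ Suc b * w) = \<Psi> (E \<alpha>) (W.z i j ^ Suc b) * w +
      Ki \<alpha> * W.z i j ^ Suc b * K \<alpha> * \<Psi> (E \<alpha>) w"
    using w p[of "Suc b"] \<alpha> by (intro \<Psi>_E_mult) (auto simp: above_Um Um_Ule)
  also have "J \<dots> (Z.z i' j' * x) = J (\<Psi> (E \<alpha>) (W.z i j ^ Suc b) * w) (Z.z i' j' * x)"
    using IH0[OF _ x] w p[of "Suc b"] \<alpha>
    by (simp add: J_left above conj_above \<Psi>_ab del: power_Suc)
  also have "\<Psi> (E \<alpha>) (W.z i j ^ Suc b) = qint b *\<^sub>C (W.z i' j' * W.z i j ^ b)"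
    unfolding qint_def by (rule \<Psi>_power[OF \<alpha> W_Um[OF ij(1,2)] \<Psi> conj WW])
  also have "J (qint b *\<^sub>C (W.z i' j' * W.z i j ^ b) * w) (Z.z i' j' * x)
      = qint b * J (W.z i' j' ^ Suc 0 * (W.z i j ^ b * w)) (Z.z i' j' * x)"
    by (simp add: J_left mult_cscale_left mult.assoc)
  also have "\<dots> = qint b * (c0 * qint 0 * J (W.z i' j' ^ 0 * (W.z i j ^ b * w)) x)"
  proof -
    have "W.z i j ^ b * w \<in> above i' j'" by (intro above(4) p subsetD[OF ab(1) w])
    then have "J (W.z i' j' ^ Suc 0 * (W.z i j ^ b * w)) (Z.z i' j' * x) = c0 * qint 0 * J (W.z i' j' ^ 0 * (W.z i j ^ b * w)) x"
      using IH x unfolding orthogonal_above_def by blast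
    then show ?thesis by simp
  qed
  finally show "J (W.z i j ^ Suc b * w) (Z.z i j * x) = c0 * qint b * J (W.z i j ^ b * w) x"
    by (simp add: qint_def)
qed

lemma W_W:
  "Suc i < n \<Longrightarrow> j < n \<Longrightarrow> W.z (Suc i) j * W.z i j = q *\<^sub>C (W.z i j * W.z (Suc i) j)"
  "i < n \<Longrightarrow> Suc j < n \<Longrightarrow> W.z i (Suc j) * W.z i j = q *\<^sub>C (W.z i j * W.z i (Suc j))"
  using W.grid.z_column[of i "Suc i" j] W.grid.z_row[of j "Suc j" i] q0
  by (simp_all add: cscale_cscale cscale_one)

lemma orthogonal_above:
  assumes "i < n" "j < n" shows "orthogonal_above i j"
  using assms
proof (induction rule: position_induct)
  case base
  have 0: "0 < n" using n_pos by simp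
  have \<Psi>0: "\<Psi> (E 0) w = 0" if "w \<in> above 0 0" for w
    using that
    by (induction rule: above_induct)
      (auto simp: \<Psi>_beta_W \<Psi>_simps slices_E_1 beta_R \<Psi>_E_mult above_Um Um_Ule)
  show ?case unfolding orthogonal_above_def
  proof (intro ballI conjI allI)
    fix w x assume w: "w \<in> above 0 0" and x: "x \<in> Up"
    have Z: "J y (Z.z 0 0 * x) = J (\<Psi> (E 0) y) x" if "y \<in> Um" for y
      using that x beta_R by (simp add: Z_Suc J_\<Psi> Um_Ule Up_Uge gens)
    show "J w (Z.z 0 0 * x) = 0"
      using w by (simp add: Z above_Um \<Psi>0 J_left)
    fix b
    have Wb: "W.z 0 0 ^ Suc b \<in> Um" by (intro subalg_power subalgs W_Um 0)
    \<comment> \<open>Here the conjugation alone gives \<open>q^2\<close>; at all other positions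
      one \<open>q\<close> comes from conjugation and one from \<open>W_W\<close>. Hence the same
      \<open>qint\<close> everywhere.\<close>
    have "Ki 0 * W.z 0 0 * K 0 = (q * q) *\<^sub>C W.z 0 0"
      using W_conj(2)[OF 0 0 beta_R] by (simp add: wt_simps cartan_def power2_eq_square)
    from \<Psi>_power[OF beta_R W_Um[OF 0 0] \<Psi>_beta_W[OF 0 0] this, of 1 b]
    have "\<Psi> (E 0) (W.z 0 0 ^ Suc b) = (c0 * qint b) *\<^sub>C W.z 0 0 ^ b"
      by (simp add: qint_def calg_simps mult.commute cscale_one)
    then have "\<Psi> (E 0) (W.z 0 0 ^ Suc b * w) = (c0 * qint b) *\<^sub>C (W.z 0 0 ^ b * w)"
      using \<Psi>_E_mult[OF Wb _ beta_R, of w] w by (simp add: above_Um Um_Ule \<Psi>0 mult_cscale_left)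
    then show "J (W.z 0 0 ^ Suc b * w) (Z.z 0 0 * x) = c0 * qint b * J (W.z 0 0 ^ b * w) x"
      using Z[OF Um(4)[OF Wb above_Um[OF w]]] by (simp add: J_left)
  qed
next
  case (right j)
  show ?case
  proof (rule orthogonal_above_step)
    have mono: "above (0) (Suc j) \<subseteq> above 0 j" by (rule above_mono) auto
    then show "above (0) (Suc j) \<subseteq> above 0 j" .
    show R: "rnu j \<in> R" using right by (simp add: root_mem)
    show "orthogonal_above 0 j" by (fact right)
    show b: "0 < n" "Suc j < n" "0 < n" "j < n" using right by auto
    show "Z.z (0) (Suc j) = bracket (- inverse q) q (E (rnu j)) (Z.z 0 j)" using b by (intro Z_Suc)
    show "\<Psi> (E (rnu j)) (W.z (0) (Suc j)) = W.z 0 j" using b by (simp add: \<Psi>_W)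
    show "Ki (rnu j) * W.z (0) (Suc j) * K (rnu j) = q *\<^sub>C W.z (0) (Suc j)"
      using W_conj(2)[OF b(1,2) R] by (simp add: wt_simps(6,7))
    show "W.z (0) (Suc j) * W.z 0 j = q *\<^sub>C (W.z 0 j * W.z (0) (Suc j))" using b by (intro W_W)
    show "W.z (0) (Suc j) \<in> above 0 j" using b by (intro W_above) auto
    fix w assume w: "w \<in> above (0) (Suc j)"
    show "\<Psi> (E (rnu j)) w \<in> above 0 j"
    proof (rule \<Psi>_above[OF w R subalg_above mono])
      fix k l assume kl: "k < n" "l < n" "\<not> (k \<le> 0 \<and> l \<le> Suc j)"
      show "\<Psi> (E (rnu j)) (W.z k l) \<in> above 0 j"
        using kl b by (auto simp: \<Psi>_W intro!: above(2) W_above)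
    qed
  qed
next
  case (left i j)
  show ?case
  proof (rule orthogonal_above_step)
    have mono: "above (Suc i) (j) \<subseteq> above i j" by (rule above_mono) auto
    then show "above (Suc i) (j) \<subseteq> above i j" .
    show R: "rmu i \<in> R" using left by (simp add: root_mem)
    show "orthogonal_above i j" by (fact left)
    show b: "Suc i < n" "j < n" "i < n" "j < n" using left by auto
    show "Z.z (Suc i) (j) = bracket (- inverse q) q (E (rmu i)) (Z.z i j)" using b by (intro Z_Suc)
    show "\<Psi> (E (rmu i)) (W.z (Suc i) (j)) = W.z i j" using b by (simp add: \<Psi>_W)
    show "Ki (rmu i) * W.z (Suc i) (j) * K (rmu i) = q *\<^sub>C W.z (Suc i) (j)"
      using W_conj(2)[OF b(1,2) R] by (simp add: wt_simps(6,7))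
    show "W.z (Suc i) (j) * W.z i j = q *\<^sub>C (W.z i j * W.z (Suc i) (j))" using b by (intro W_W)
    show "W.z (Suc i) (j) \<in> above i j" using b by (intro W_above) auto
    fix w assume w: "w \<in> above (Suc i) (j)"
    show "\<Psi> (E (rmu i)) w \<in> above i j"
    proof (rule \<Psi>_above[OF w R subalg_above mono])
      fix k l assume kl: "k < n" "l < n" "\<not> (k \<le> Suc i \<and> l \<le> j)"
      show "\<Psi> (E (rmu i)) (W.z k l) \<in> above i j"
        using kl b by (auto simp: \<Psi>_W intro!: above(2) W_above)
    qed
  qed
qed

text \<open>The content is in \<open>m \<ge> k\<close>; the branch \<open>m < k\<close> repeats the
  left side, so that one formula covers the whole induction.\<close>

lemma J_powers:
  assumes ij: "i < n" "j < n" and w: "w \<in> above i j" and x: "x \<in> Up"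
  shows "J (W.z i j ^ k * w) (Z.z i j ^ m * x) = (if m < k then J (W.z i j ^ k * w) (Z.z i j ^ m * x)
     else if m = k then (\<Prod>t<k. c0 * qint t) * J w x else 0)"
proof (induction m arbitrary: k)
  case 0
  then show ?case by simp
next
  case (Suc m)
  have Zx: "Z.z i j ^ m * x \<in> Up" using Z_Up ij x by (intro Up subalg_power subalgs)
  note o = orthogonal_above[OF ij, unfolded orthogonal_above_def, rule_format, OF w Zx]
  show ?case
  proof (cases k)
    case 0
    then show ?thesis using o by (simp add: mult.assoc)
  next
    case (Suc b)
    have "J (W.z i j ^ k * w) (Z.z i j ^ Suc m * x) = c0 * qint b * J (W.z i j ^ b * w) (Z.z i j ^ m * x)"
      using o Suc by (simp add: mult.assoc)
    then show ?thesis using Suc.IH[of b] Suc by (auto simp: mult_ac)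
  qed
qed

lemma ordered_span_coefficients:
  assumes "z \<in> ordered_span f (p # ps)"
  shows "\<exists>M y. (\<forall>k. y k \<in> ordered_span f ps) \<and> z = (\<Sum>k<M. f p ^ k * y k :: 'u)"
  using assms unfolding ordered_span.simps
proof (induction rule: span_induct_lin)
  case (base x)
  note sub = subspaceD[OF subspace_ordered_span[of f ps]]
  from base obtain k y where x: "x = f p ^ k * y" "y \<in> ordered_span f ps" by auto
  have "(\<Sum>k'<Suc k. f p ^ k' * (if k' = k then y else 0)) = (\<Sum>k'<Suc k. if k' = k then f p ^ k * y else 0)"
    by (rule sum.cong) auto
  then show ?case using x sub
    by (intro exI[of _ "Suc k"] exI[of _ "\<lambda>k'. if k' = k then y else 0"]) auto
next
  case zero then show ?case
    using subspaceD[OF subspace_ordered_span[of f ps]] by (intro exI[of _ 0] exI[of _ "\<lambda>_. 0"]) auto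
next
  case (add x y)
  note sub = subspaceD[OF subspace_ordered_span[of f ps]]
  from add obtain M a M' a' where a: "\<forall>k. a k \<in> ordered_span f ps" "x = (\<Sum>k<M. f p ^ k * a k)"
    "\<forall>k. a' k \<in> ordered_span f ps" "y = (\<Sum>k<M'. f p ^ k * a' k)" by blast
  let ?b = "\<lambda>M a k. if k < M then a k else 0"
  have ext: "(\<Sum>k<M. f p ^ k * a k) = (\<Sum>k<max M M'. f p ^ k * ?b M a k)"
    "(\<Sum>k<M'. f p ^ k * a' k) = (\<Sum>k<max M M'. f p ^ k * ?b M' a' k)"
    by (rule sum.mono_neutral_cong_left; auto)+
  show ?case unfolding a ext
    by (intro exI[of _ "max M M'"] exI[of _ "\<lambda>k. ?b M a k + ?b M' a' k"])
      (use a sub in \<open>auto simp: distrib_left sum.distrib\<close>)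
next
  case (scale c x)
  note sub = subspaceD[OF subspace_ordered_span[of f ps]]
  from scale obtain M a where a: "\<forall>k. a k \<in> ordered_span f ps" "x = (\<Sum>k<M. f p ^ k * a k)" by blast
  then show ?case using sub
    by (intro exI[of _ M] exI[of _ "\<lambda>k. c *\<^sub>C a k"]) (auto simp: mult_cscale_right cvec.scale_sum_right)
qed

definition Wfrom :: "nat \<Rightarrow> 'u set" where
  "Wfrom a = subalg hull (position n W.z ` {a..<n * n})"

lemma position_bounds: "m < n * n \<Longrightarrow> m mod n < n \<and> m div n < n"
  using n_pos by (auto simp: less_mult_imp_div_less)

lemma Wfrom_above: "w \<in> Wfrom (Suc a) \<Longrightarrow> w \<in> above (a mod n) (a div n)"
proof -
  have "Wfrom (Suc a) \<subseteq> above (a mod n) (a div n)"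
    unfolding Wfrom_def
  proof (rule subalg_hull_least[OF subalg_above], safe)
    fix m assume m: "m \<in> {Suc a..<n * n}"
    have "\<not> (m mod n \<le> a mod n \<and> m div n \<le> a div n)"
    proof
      assume "m mod n \<le> a mod n \<and> m div n \<le> a div n"
      then have "m div n * n + m mod n \<le> a div n * n + a mod n" by (intro add_mono mult_le_mono1) auto
      then show False using m by simp
    qed
    then show "position n W.z m \<in> above (a mod n) (a div n)"
      unfolding position_def using m position_bounds by (intro W_above) auto
  qed
  then show "w \<in> Wfrom (Suc a) \<Longrightarrow> w \<in> above (a mod n) (a div n)" by blast
qed

lemma ordered_span_Up: "a \<le> n * n \<Longrightarrow> ordered_span (position n Z.z) [a..<n * n] \<subseteq> Up"
proof (induction a rule: inc_induct)
  case base
  have "cvec.span {1} \<subseteq> Up" by (rule span_subsetI[OF Up(1)]) (use Up(3) in blast)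
  then show ?case by simp
next
  case (step a)
  have p: "position n Z.z a \<in> Up" unfolding position_def using position_bounds step by (intro Z_Up) auto
  have "cvec.span {position n Z.z a ^ k * y | k y. y \<in> ordered_span (position n Z.z) [Suc a..<n * n]} \<subseteq> Up"
  proof (rule span_subsetI[OF Up(1)], safe)
    fix k y assume "y \<in> ordered_span (position n Z.z) [Suc a..<n * n]"
    then have "y \<in> Up" using step.IH by blast
    then show "position n Z.z a ^ k * y \<in> Up" by (rule Up(4)[OF subalg_power[OF subalgs(4) p]])
  qed
  then show ?case unfolding upt_conv_Cons[OF step.hyps(2)] ordered_span.simps .
qed

text \<open>Expand \<open>z\<close> in powers of its first variable. Testing against
  \<open>W^k w\<close> isolates the coefficient \<open>y k\<close>: higher powers pair to zero by
  \<open>J_powers\<close>, lower coefficients are already known to vanish, and the diagonal factor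
  is a product of nonzero numbers \<open>c0 * qint t\<close>.\<close>

lemma nondegenerate_ordered:
  assumes "a \<le> n * n" "z \<in> ordered_span (position n Z.z) [a..<n * n]" "\<And>w. w \<in> Wfrom a \<Longrightarrow> J w z = 0"
  shows "z = 0"
  using assms
proof (induction a arbitrary: z rule: inc_induct)
  case base
  then obtain c where z: "z = c *\<^sub>C 1" by (auto simp: cvec.span_singleton)
  have "J 1 z = 0" using base subalgD(3)[OF subalg_hull] by (auto simp: Wfrom_def)
  then show ?case unfolding z by (simp add: J_right J_1_1)
next
  case (step a)
  let ?i = "a mod n" and ?j = "a div n"
  have ij: "?i < n" "?j < n" using position_bounds step by auto
  obtain M y where y: "\<And>k. y k \<in> ordered_span (position n Z.z) [Suc a..<n * n]"
    and z: "z = (\<Sum>k<M. Z.z ?i ?j ^ k * y k)"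
  proof -
    have "z \<in> ordered_span (position n Z.z) (a # [Suc a..<n * n])"
      using step.prems(1) step.hyps by (simp only: upt_conv_Cons)
    from ordered_span_coefficients[OF this] obtain M y
      where "\<forall>k. y k \<in> ordered_span (position n Z.z) [Suc a..<n * n]" "z = (\<Sum>k<M. position n Z.z a ^ k * y k)"
      by blast
    then show thesis using that[of y M] by (simp only: position_def[of n Z.z a])
  qed
  have y_Up: "y k \<in> Up" for k using ordered_span_Up[of "Suc a"] step y by auto
  have "y k = 0" if "k < M" for k
    using that
  proof (induction k rule: less_induct)
    case (less k)
    show ?case
    proof (rule step.IH[OF y])
      fix w assume w: "w \<in> Wfrom (Suc a)"
      have wa: "w \<in> above ?i ?j" using Wfrom_above[OF w] .
      have "J (W.z ?i ?j ^ k * w) z = 0"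
      proof (rule step.prems)
        have "Wfrom (Suc a) \<subseteq> Wfrom a" unfolding Wfrom_def by (intro hull_mono image_mono) auto
        moreover have "W.z ?i ?j \<in> Wfrom a" unfolding Wfrom_def
          by (rule hull_inc) (use step in \<open>auto simp: position_def intro!: image_eqI[of _ _ a]\<close>)
        ultimately show "W.z ?i ?j ^ k * w \<in> Wfrom a" using w subalgD[OF subalg_hull]
          unfolding Wfrom_def by (auto intro!: subalgD(4)[OF subalg_hull] subalg_power[OF subalg_hull])
      qed
      also have "J (W.z ?i ?j ^ k * w) z = (\<Sum>m<M. J (W.z ?i ?j ^ k * w) (Z.z ?i ?j ^ m * y m))"
        unfolding z by (simp add: cvec.linear_sum[OF J_linear(1)])
      also have "\<dots> = (\<Sum>m<M. if m = k then (\<Prod>t<k. c0 * qint t) * J w (y k) else 0)"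
      proof (rule sum.cong[OF refl])
        fix m assume "m \<in> {..<M}"
        then have zero: "m < k \<Longrightarrow> y m = 0" using less.IH by simp
        show "J (W.z ?i ?j ^ k * w) (Z.z ?i ?j ^ m * y m) =
          (if m = k then (\<Prod>t<k. c0 * qint t) * J w (y k) else 0)"
        proof (cases "m < k")
          case True
          then show ?thesis by (simp add: zero J_right)
        next
          case False
          then show ?thesis using J_powers[OF ij wa y_Up[of m], of k m] by (auto split: if_splits)
        qed
      qed
      also have "\<dots> = (\<Prod>t<k. c0 * qint t) * J w (y k)" using less.prems by simp
      finally show "J w (y k) = 0" using qint_nonzero q_facts by auto
    qed
  qed
  then show ?case by (simp add: z)
qed

lemma nondegenerate:
  assumes "z \<in> Ap" "\<And>w. w \<in> Am \<Longrightarrow> J w z = 0"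
  shows "z = 0"
proof (rule nondegenerate_ordered[of 0])
  have "{Z.z i j | i j. i < n \<and> j < n} \<subseteq> position n Z.z ` {0..<n * n}"
  proof safe
    fix i j assume ij: "i < n" "j < n"
    have "j * n + i < n * n" using ij mult_le_mono1[of "Suc j" n n] by simp
    then show "Z.z i j \<in> position n Z.z ` {0..<n * n}"
      using ij by (intro image_eqI[of _ _ "j * n + i"]) (auto simp: position_def)
  qed
  then have "Ap \<subseteq> subalg hull (position n Z.z ` {0..<n * n})" unfolding Ap_def by (rule hull_mono)
  also have "\<dots> \<subseteq> ordered_span (position n Z.z) [0..<n * n]"
    by (rule Z.grid.subalg_hull_subset_ordered_monomials) (use n_pos in simp)
  finally show "z \<in> ordered_span (position n Z.z) [0..<n * n]" using assms by auto
  have "Wfrom 0 \<subseteq> Am" unfolding Wfrom_def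
    by (rule subalg_hull_least[OF subalg_A(2)]) (auto simp: position_def position_bounds intro!: W_Am)
  then show "\<And>w. w \<in> Wfrom 0 \<Longrightarrow> J w z = 0" using assms by auto
qed simp

end

section \<open>The generalized Verma module\<close>

lemma tens_zero: "0 \<otimes>\<^sub>t b = 0" "a \<otimes>\<^sub>t 0 = 0"
  using tens_scale_left[of 0 0 b] tens_scale_right[of a 0 0] by simp_all

lemma tens_diff_left: "(a - a') \<otimes>\<^sub>t b = a \<otimes>\<^sub>t b - a' \<otimes>\<^sub>t b"
  using tens_add_left[of "a - a'" a' b] by (simp add: algebra_simps)

lemma tens_sum_left: "(\<Sum>i\<in>I. f i) \<otimes>\<^sub>t b = (\<Sum>i\<in>I. f i \<otimes>\<^sub>t b)"
  by (induction I rule: infinite_finite_induct) (simp_all add: tens_zero tens_add_left)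

lemma tens_sum_right: "a \<otimes>\<^sub>t (\<Sum>i\<in>I. f i) = (\<Sum>i\<in>I. a \<otimes>\<^sub>t f i)"
  by (induction I rule: infinite_finite_induct) (simp_all add: tens_zero tens_add_right)

lemma dual_eqI: "(\<And>v. dual_app f v = dual_app h v) \<Longrightarrow> f = h"
  by (simp add: dual_app_inject[symmetric] fun_eq_iff)

lemma dual_app_simps:
  "dual_app (f + h) v = dual_app f v + dual_app h v" "dual_app (c *\<^sub>C f) v = c * dual_app f v" "dual_app 0 v = 0"
  by (transfer, simp)+

lemma dual_app_sum: "dual_app (\<Sum>i\<in>I. f i) v = (\<Sum>i\<in>I. dual_app (f i) v)"
  by (induction I rule: infinite_finite_induct) (simp_all add: dual_app_simps)

lemma clinear_transpose_op: "clinear (transpose_op A)"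
proof -
  have "transpose_op A f = 0" if "\<not> clinear A" for f
    using that by transfer simp
  then show ?thesis
    by (cases "clinear A") (auto intro!: clinearI dual_eqI simp: dual_app_transpose_op dual_app_simps)
qed

lemma transpose_op_id: "transpose_op (\<lambda>v. v) = id"
  by (auto intro!: ext dual_eqI simp: dual_app_transpose_op clinearI)

text \<open>With independent second factors, \<open>B_nondegenerate\<close> can treat each first
  factor separately.\<close>

lemma tensor_dual_independent:
  assumes "d \<in> tensor_dual A" "cvec.subspace A"
  obtains f :: "'v::cvec dual \<Rightarrow> 'u::calg" and S where "finite S" "cvec.independent S" "\<And>s. f s \<in> A"
    "d = (\<Sum>s\<in>S. f s \<otimes>\<^sub>t s)"
proof -
  note sub = subspaceD[OF assms(2)]
  obtain Bs :: "'v dual set" where Bs: "cvec.independent Bs" "UNIV \<subseteq> cvec.span Bs"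
    by (rule cvec.basis_exists[of UNIV])
  \<comment> \<open>One basis \<open>Bs\<close> is fixed beforehand and the first factors are set to
    0 outside the support, so that two representations can be added.\<close>
  have "\<exists>f S. finite S \<and> S \<subseteq> Bs \<and> (\<forall>s. f s \<in> A) \<and> (\<forall>s. s \<notin> S \<longrightarrow> f s = 0) \<and> d = (\<Sum>s\<in>S. f s \<otimes>\<^sub>t s)"
    using assms(1) unfolding tensor_dual_def
  proof (induction rule: span_induct_lin)
    case (base d)
    then obtain z v' where d: "d = z \<otimes>\<^sub>t v'" "z \<in> A" by auto
    have "v' \<in> cvec.span Bs" using Bs by blast
    then obtain S r where S: "finite S" "S \<subseteq> Bs" "v' = (\<Sum>a\<in>S. r a *\<^sub>C a)"
      unfolding cvec.span_explicit by auto
    have "d = (\<Sum>s\<in>S. (if s \<in> S then r s *\<^sub>C z else 0) \<otimes>\<^sub>t s)"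
      by (auto simp: d S(3) tens_sum_right tens_scale_right tens_scale_left intro!: sum.cong)
    then show ?case using S d sub
      by (intro exI[of _ "\<lambda>s. if s \<in> S then r s *\<^sub>C z else 0"] exI[of _ S]) auto
  next
    case zero then show ?case using sub by (intro exI[of _ "\<lambda>_. 0"] exI[of _ "{}"]) auto
  next
    case (add x y)
    then obtain f S f' S' where f: "finite S" "S \<subseteq> Bs" "\<forall>s. f s \<in> A" "\<forall>s. s \<notin> S \<longrightarrow> f s = 0"
        "x = (\<Sum>s\<in>S. f s \<otimes>\<^sub>t s)"
      and f': "finite S'" "S' \<subseteq> Bs" "\<forall>s. f' s \<in> A" "\<forall>s. s \<notin> S' \<longrightarrow> f' s = 0" "y = (\<Sum>s\<in>S'. f' s \<otimes>\<^sub>t s)"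
      by blast
    have "x = (\<Sum>s\<in>S \<union> S'. f s \<otimes>\<^sub>t s)" "y = (\<Sum>s\<in>S \<union> S'. f' s \<otimes>\<^sub>t s)"
      unfolding f(5) f'(5) by (rule sum.mono_neutral_left; use f f' in \<open>auto simp: tens_zero\<close>)+
    then have "x + y = (\<Sum>s\<in>S \<union> S'. (f s + f' s) \<otimes>\<^sub>t s)" by (simp add: tens_add_left sum.distrib)
    then show ?case using f f' sub
      by (intro exI[of _ "\<lambda>s. f s + f' s"] exI[of _ "S \<union> S'"]) auto
  next
    case (scale c x)
    then obtain f S where f: "finite S" "S \<subseteq> Bs" "\<forall>s. f s \<in> A" "\<forall>s. s \<notin> S \<longrightarrow> f s = 0"
        "x = (\<Sum>s\<in>S. f s \<otimes>\<^sub>t s)" by blast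
    then show ?case using sub
      by (intro exI[of _ "\<lambda>s. c *\<^sub>C f s"] exI[of _ S]) (auto simp: tens_scale_left cvec.scale_sum_right)
  qed
  then obtain f S where "finite S" "S \<subseteq> Bs" "\<forall>s. f s \<in> A" "d = (\<Sum>s\<in>S. f s \<otimes>\<^sub>t s)" by blast
  then show ?thesis using that[of S f] Bs cvec.independent_mono by blast
qed

section \<open>Moving generators of the algebra past \<open>A_minus\<close>\<close>

context quantum_pairing
begin

lemma chain_F_AL:
  assumes chain: "qchain q 1 (n - 1) (\<lambda>k. F (\<rho> k)) w" and w: "\<And>i. i < n \<Longrightarrow> w i \<in> Am" and mi: "Suc m < n" "i < n"
  shows "F (\<rho> m) * w i \<in> AL {1, F (\<rho> m)}"
proof -
  interpret qchain q 1 "n - 1" "\<lambda>k. F (\<rho> k)" w by (rule chain)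
  have A: "w i' * F (\<rho> m) \<in> AL {1, F (\<rho> m)}" "w i' \<in> AL {1, F (\<rho> m)}" if "i' < n" for i'
    using AL_base[OF w[OF that], of "F (\<rho> m)" "{1, F (\<rho> m)}"] AL_base[OF w[OF that], of 1 "{1, F (\<rho> m)}"] by simp_all
  consider "i < m" | "i = m" | "i = Suc m" | "Suc m < i" by linarith
  then show ?thesis
  proof cases
    case 1 then show ?thesis using f_w_greater[of i m] mi A by simp
  next
    case 2
    have "F (\<rho> m) * w m = inverse q *\<^sub>C (w m * F (\<rho> m)) - inverse q *\<^sub>C w (Suc m)"
      using w_Suc[of m] mi q0 by (simp add: calg_simps cscale_one)
    then show ?thesis using 2 mi A AL by simp
  next
    case 3 then show ?thesis using f_w_Suc[of m] mi A AL by simp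
  next
    case 4 then show ?thesis using f_w_less[of m i] mi A by simp
  qed
qed

lemma F_AL: assumes "\<alpha> \<in> R" "\<alpha> \<noteq> 0" "w \<in> Am" shows "F \<alpha> * w \<in> AL {1, F \<alpha>}"
proof -
  have gen: "F \<alpha> * W.z i j \<in> AL {1, F \<alpha>}" if ij: "i < n" "j < n" for i j
  proof -
    have mu: "qchain q 1 (n - 1) (\<lambda>k. F (rmu k)) (\<lambda>i. W.z i j)"
      using W.grid.rows[of j] ij by (simp add: rmu_def)
    have nu: "qchain q 1 (n - 1) (\<lambda>k. F (rnu k)) (W.z i)"
      using W.grid.columns[of i] ij by (simp add: rnu_def)
    from assms(1) show ?thesis
      by (cases rule: root_cases)
        (use assms(2) chain_F_AL[OF mu] chain_F_AL[OF nu] W_Am ij in auto)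
  qed
  have "l * W.z i j \<in> AL {1, F \<alpha>}" if "l \<in> {1, F \<alpha>}" "i < n" "j < n" for l i j
    using that gen AL_base[OF W_Am, of i j 1 "{1, F \<alpha>}"] by auto
  from AL_mult_base[OF this assms(3)] show ?thesis by simp
qed

lemma K_AL:
  assumes "\<alpha> \<in> R" "w \<in> Am" shows "K \<alpha> * w \<in> AL {K \<alpha>}" "Ki \<alpha> * w \<in> AL {Ki \<alpha>}"
proof -
  have "l * W.z i j \<in> AL {K \<alpha>}" if "l \<in> {K \<alpha>}" "i < n" "j < n" for l i j
    using that AL_base[OF W_Am, of i j "K \<alpha>" "{K \<alpha>}"] assms(1) by (auto simp: K_W AL)
  from AL_mult_base[OF this assms(2)] show "K \<alpha> * w \<in> AL {K \<alpha>}" by simp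
  have "l * W.z i j \<in> AL {Ki \<alpha>}" if "l \<in> {Ki \<alpha>}" "i < n" "j < n" for l i j
    using that AL_base[OF W_Am, of i j "Ki \<alpha>" "{Ki \<alpha>}"] assms(1) by (auto simp: W_conj(1) AL)
  from AL_mult_base[OF this assms(2)] show "Ki \<alpha> * w \<in> AL {Ki \<alpha>}" by simp
qed

lemma conj_Am: assumes "\<alpha> \<in> R" "w \<in> Am" shows "Ki \<alpha> * w * K \<alpha> \<in> Am"
  using K_AL(2)[OF assms]
  by (rule AL_induct) (auto simp: mult.assoc Ki_K assms(1) intro: Am clinear_mult_right)

lemma conj_Ap:
  assumes "\<alpha> \<in> R" "z \<in> Ap" shows "K \<alpha> * z * Ki \<alpha> \<in> Ap"
  using assms(2) unfolding Ap_def
proof (induction rule: subalg_hull_induct)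
  case (gen z)
  then obtain i j where z: "z = Z.z i j" "i < n" "j < n" by auto
  show ?case using conj_K(3)[OF assms(1) K_Z[OF z(2,3) assms(1)]] z q0 Z_Ap Ap(7) unfolding Ap_def by simp
next
  case (mult x y)
  have "K \<alpha> * (x * y) * Ki \<alpha> = K \<alpha> * x * (Ki \<alpha> * K \<alpha>) * y * Ki \<alpha>" by (simp add: Ki_K assms(1) mult.assoc)
  also have "\<dots> = (K \<alpha> * x * Ki \<alpha>) * (K \<alpha> * y * Ki \<alpha>)" by (simp only: mult.assoc)
  finally show ?case using mult by (simp add: subalgD(4)[OF subalg_hull])
qed (use assms(1) in \<open>auto simp: K_Ki distrib_left distrib_right mult_cscale_left mult_cscale_right intro: subalgD[OF subalg_hull]\<close>)

lemma \<Psi>_Am: assumes "\<alpha> \<in> R" "w \<in> Am" shows "\<Psi> (E \<alpha>) w \<in> Am"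
  using assms(2) unfolding Am_def
proof (induction rule: subalg_hull_induct)
  case (gen w)
  then obtain i j where w: "w = W.z i j" "i < n" "j < n" by auto
  from assms(1) have "\<Psi> (E \<alpha>) w \<in> Am"
    by (cases rule: root_cases) (use w in \<open>auto simp: \<Psi>_W \<Psi>_beta_W W_Am intro!: Am\<close>)
  then show ?case by (simp add: Am_def)
next
  case (mult x y)
  then have xy: "x \<in> Am" "y \<in> Am" "\<Psi> (E \<alpha>) x \<in> Am" "\<Psi> (E \<alpha>) y \<in> Am" by (simp_all add: Am_def)
  then have "\<Psi> (E \<alpha>) (x * y) \<in> Am"
    using assms(1) by (simp add: \<Psi>_E_mult Am_Um Um_Ule Am conj_Am)
  then show ?case by (simp add: Am_def)
qed (use assms(1) in \<open>auto simp: \<Psi>_simps slices_E_1 intro: subalgD[OF subalg_hull]\<close>)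

text \<open>Removing \<open>Ki 0\<close> on the right costs nothing by \<open>\<Phi>_K\<close>, and
  removing \<open>K 0\<close> on the left is a conjugation by \<open>\<Psi>_K\<close>. This is where
  \<open>Ad_K\<close> comes from.\<close>

lemma J_conj:
  assumes "D \<in> Am" "z \<in> Ap"
  shows "J D (K 0 * z * Ki 0) = J (Ki 0 * D * K 0) z"
proof -
  have D: "D \<in> Um" "D \<in> Ule" and z: "z \<in> Uge" using assms by (auto simp: Am_Um Um_Ule Ap_Up Up_Uge)
  have Kz: "K 0 * z \<in> Uge" using z beta_R by (intro Uge gens)
  have "J D (K 0 * z * Ki 0) = J (\<Phi> (Ki 0) D) (K 0 * z)"
    using D Kz beta_R by (intro J_\<Phi> gens)
  also have "\<dots> = J (\<Psi> (K 0) D) z"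
    using D z beta_R by (simp add: \<Phi>_K J_\<Psi> gens)
  finally show ?thesis using D beta_R by (simp add: \<Psi>_K)
qed

text \<open>A nonempty chain contains exactly one root adjacent to beta, its first; this gives one
  \<open>inverse q\<close> per arm.\<close>

lemma Ki_chainF:
  assumes "k < n"
  shows "Ki 0 * chainF rmu k = (if k = 0 then 1 else inverse q) *\<^sub>C (chainF rmu k * Ki 0)"
    "Ki 0 * chainF rnu k = (if k = 0 then 1 else inverse q) *\<^sub>C (chainF rnu k * Ki 0)"
proof -
  have *: "Ki 0 * chainF \<rho> k = (if k = 0 then 1 else inverse q) *\<^sub>C (chainF \<rho> k * Ki 0)"
    if path: "root_path n (n - 1) \<rho>" and c: "\<And>k. cartan 0 (\<rho> k) = (if k = 0 then -1 else 0)" for \<rho>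
    using assms
  proof (induction k)
    case (Suc k)
    have F: "Ki 0 * F (\<rho> k) = (if k = 0 then inverse q else 1) *\<^sub>C (F (\<rho> k) * Ki 0)"
      using Ki_F[OF beta_R root_path_mem[OF path, of k]] c[of k] Suc.prems by (auto simp: power_int_minus)
    then have F': "Ki 0 * (F (\<rho> k) * y) = (if k = 0 then inverse q else 1) *\<^sub>C (F (\<rho> k) * (Ki 0 * y))" for y
      by (metis mult.assoc mult_cscale_left)
    show ?case
    proof (cases k)
      case 0 then show ?thesis using F by (simp add: chainF_simps)
    next
      case (Suc m)
      then have IH: "Ki 0 * chainF \<rho> k = inverse q *\<^sub>C (chainF \<rho> k * Ki 0)" using Suc.IH Suc.prems by simp
      have IH': "Ki 0 * (chainF \<rho> k * y) = inverse q *\<^sub>C (chainF \<rho> k * (Ki 0 * y))" for y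
        using arg_cong[OF IH, of "\<lambda>x. x * y"] by (simp add: calg_simps)
      show ?thesis using IH IH' F F' unfolding Suc
        by (simp add: chainF_simps bracket_def calg_simps cscale_one mult_ac)
    qed
  qed (simp add: chainF_simps cscale_one)
  have "cartan 0 (rmu k) = (if k = 0 then -1 else 0)" "cartan 0 (rnu k) = (if k = 0 then -1 else 0)" for k
    by (cases k; simp add: root_simps)+
  then show "Ki 0 * chainF rmu k = (if k = 0 then 1 else inverse q) *\<^sub>C (chainF rmu k * Ki 0)"
    "Ki 0 * chainF rnu k = (if k = 0 then 1 else inverse q) *\<^sub>C (chainF rnu k * Ki 0)"
    using *[OF root_path_mu] *[OF root_path_nu] by blast+
qed

end

section \<open>The induced module and the adjointness relation\<close>

locale generalized_Verma = quantum_pairing n q g T \<Delta> J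
  for n q and g :: "qgen \<Rightarrow> 'u::calg" and T \<Delta> J +
  fixes S :: "'u \<Rightarrow> 'u" and \<rho> :: "'u \<Rightarrow> 'v::cvec \<Rightarrow> 'v" and \<kappa> :: "('u, 'v) tensor \<Rightarrow> 'm::cvec"
    and L :: "'u \<Rightarrow> 'm \<Rightarrow> 'm" and B :: "'m \<Rightarrow> ('u, 'v dual) tensor \<Rightarrow> complex"
  assumes antipode: "antipode n g S"
    and acts: "acts_on (U_kA n g T) \<rho>"
    and Z_acts: "\<And>i j v. i < n \<Longrightarrow> j < n \<Longrightarrow> \<rho> (Z_el g T (Suc i) (Suc j)) v = 0"
    and induced: "induced_module (U_kA n g T) \<rho> \<kappa> L"
    and pairing: "Verma_pairing (A_minus n g T) (A_plus n g T) J \<kappa> B"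
begin

abbreviation "P \<equiv> U_kA n g T"

lemma subalg_U_k: "subalg (U_k n g)"
  by (simp add: U_k_def subalg_hull)

lemma U_k_P: "x \<in> U_k n g \<Longrightarrow> x \<in> P"
proof -
  assume "x \<in> U_k n g"
  then have "x * 1 \<in> P" unfolding U_kA_def using Ap(3) by (intro cvec.span_base) blast
  then show ?thesis by simp
qed

lemma Z_P: "i < n \<Longrightarrow> j < n \<Longrightarrow> Z.z i j \<in> P"
proof -
  assume "i < n" "j < n"
  then have "1 * Z.z i j \<in> P" unfolding U_kA_def using Z_Ap subalgD(3)[OF subalg_U_k] by (intro cvec.span_base) blast
  then show ?thesis by simp
qed

lemma U_k_gens:
  assumes "\<alpha> \<in> R"
  shows "K \<alpha> \<in> U_k n g" "Ki \<alpha> \<in> U_k n g" "\<alpha> \<noteq> 0 \<Longrightarrow> E \<alpha> \<in> U_k n g" "\<alpha> \<noteq> 0 \<Longrightarrow> F \<alpha> \<in> U_k n g"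
  unfolding U_k_def by (rule hull_inc; use assms in blast)+

lemmas U_k = subalgD[OF subalg_U_k]

lemma chainF_U_k: "k < n \<Longrightarrow> chainF rmu k \<in> U_k n g" "k < n \<Longrightarrow> chainF rnu k \<in> U_k n g"
proof -
  have *: "chainF \<tau> k \<in> U_k n g" if "root_path n (n - 1) \<tau>" "\<And>m. \<tau> m \<noteq> 0" "k < n" for \<tau> k
    using that(3)
  proof (induction k)
    case (Suc k)
    have "F (\<tau> k) \<in> U_k n g" using root_path_mem[OF that(1), of k] that(2) Suc.prems by (intro U_k_gens) auto
    then show ?case using Suc
      by (cases k) (auto simp: chainF_simps intro!: bracket_in subalg_U_k)
  qed (simp add: chainF_simps U_k)
  show "k < n \<Longrightarrow> chainF rmu k \<in> U_k n g" "k < n \<Longrightarrow> chainF rnu k \<in> U_k n g"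
    using *[OF root_path_mu] *[OF root_path_nu] by (simp_all add: root_simps)
qed

lemma \<rho>_linear: "p \<in> P \<Longrightarrow> clinear (\<rho> p)"
  and \<rho>_mult: "p \<in> P \<Longrightarrow> p' \<in> P \<Longrightarrow> \<rho> (p * p') v = \<rho> p (\<rho> p' v)"
  and \<rho>_scale: "p \<in> P \<Longrightarrow> \<rho> (c *\<^sub>C p) v = c *\<^sub>C \<rho> p v"
  and \<rho>_1: "\<rho> 1 v = v"
  using acts by (simp_all add: acts_on_def)

lemma \<kappa>_linear: "clinear \<kappa>" and \<kappa>_surj: "surj \<kappa>"
  and L_linear: "clinear (L u)" and L_\<kappa>: "L u (\<kappa> (a \<otimes>\<^sub>t v)) = \<kappa> ((u * a) \<otimes>\<^sub>t v)"
  using induced by (auto simp: induced_module_def)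

lemmas \<kappa>_simps = functional_simps[OF \<kappa>_linear]

lemma \<kappa>_move:
  assumes "p \<in> P" shows "\<kappa> ((u * p) \<otimes>\<^sub>t v) = \<kappa> (u \<otimes>\<^sub>t \<rho> p v)"
proof -
  have "(u * p) \<otimes>\<^sub>t v - u \<otimes>\<^sub>t \<rho> p v \<in> {t. \<kappa> t = 0}"
    using induced assms unfolding induced_module_def by (auto intro!: cvec.span_base)
  then show ?thesis by (simp add: \<kappa>_simps)
qed

definition A_minus_part :: "'m set" where "A_minus_part = cvec.span {\<kappa> (w \<otimes>\<^sub>t v) | w v. w \<in> Am}"

lemmas A_minus_part = subspaceD[OF cvec.subspace_span[of "{\<kappa> (w \<otimes>\<^sub>t v) | w v. w \<in> Am}", folded A_minus_part_def]]

lemma \<kappa>_tens_linear: "clinear (\<lambda>x. \<kappa> (x \<otimes>\<^sub>t v))"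
  by (rule clinearI) (simp_all add: tens_add_left tens_scale_left \<kappa>_simps)

lemma AL_part:
  assumes "x \<in> AL Q" "Q \<subseteq> P" shows "\<kappa> (x \<otimes>\<^sub>t v) \<in> A_minus_part"
  using assms(1)
proof (rule AL_induct)
  fix a l assume "a \<in> Am" "l \<in> Q"
  then show "\<kappa> ((a * l) \<otimes>\<^sub>t v) \<in> A_minus_part"
    using assms(2) by (subst \<kappa>_move) (auto simp: A_minus_part_def intro!: cvec.span_base)
qed (auto simp: \<kappa>_tens_linear A_minus_part_def)

text \<open>Generators are moved to the right of \<open>w\<close>, where the resulting words lie in
  \<open>P\<close> and act on \<open>v\<close>. For \<open>E \<alpha>\<close> this is the commutator
  formula, while \<open>F 0\<close> is itself in \<open>A_minus\<close>.\<close>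

lemma gen_part:
  assumes w: "w \<in> Am" shows "\<kappa> ((g x * w) \<otimes>\<^sub>t v) \<in> A_minus_part"
proof -
  have out: ?thesis if "g x = 0" using that A_minus_part by (simp add: tens_zero \<kappa>_simps)
  show ?thesis
  proof (cases x)
    case (GK \<alpha>)
    then show ?thesis using outside(3) out AL_part[OF K_AL(1)[OF _ w]] U_k_gens U_k_P by (cases "\<alpha> \<in> R") auto
  next
    case (GKi \<alpha>)
    then show ?thesis using outside(4) out AL_part[OF K_AL(2)[OF _ w]] U_k_gens U_k_P by (cases "\<alpha> \<in> R") auto
  next
    case (GF \<alpha>)
    consider "\<alpha> \<notin> R" | "\<alpha> = 0" | "\<alpha> \<in> R" "\<alpha> \<noteq> 0" by blast
    then show ?thesis
    proof cases
      case 1 then show ?thesis using outside(2) out GF by simp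
    next
      case 2
      have "F 0 \<in> Am" using W_Am[of 0 0] n_pos by (simp add: W_Suc)
      then have "g x * w \<in> Am" using w 2 GF Am by simp
      then show ?thesis unfolding A_minus_part_def by (intro cvec.span_base) blast
    next
      case 3
      then show ?thesis using AL_part[OF F_AL[OF 3 w]] U_k_gens U_k U_k_P GF by auto
    qed
  next
    case (GE \<alpha>)
    consider "\<alpha> \<notin> R" | "\<alpha> \<in> R" by blast
    then show ?thesis
    proof cases
      case 1 then show ?thesis using outside(1) out GE by simp
    next
      case 2
      have E: "E \<alpha> \<in> P"
        using 2 U_k_gens U_k_P Z_P[of 0 0] n_pos by (cases "\<alpha> = 0") (auto simp: Z_Suc)
      have "w * E \<alpha> \<in> AL {E \<alpha>}" using w by (intro AL_base) auto
      then have a: "\<kappa> ((w * E \<alpha>) \<otimes>\<^sub>t v) \<in> A_minus_part" by (rule AL_part) (use E in auto)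
      have b: "\<kappa> (\<Phi> (E \<alpha>) w \<otimes>\<^sub>t v) \<in> A_minus_part"
      proof (cases "\<alpha> = 0")
        case True
        have "Lxy \<subseteq> P"
          unfolding Lxy_def using chainF_U_k U_k_gens(2)[OF beta_R] by (auto intro!: U_k_P U_k)
        then show ?thesis using AL_part[OF \<Phi>_beta_AL[OF w]] True by simp
      next
        case False
        then show ?thesis using 2 w A_minus_part by (simp add: \<Phi>_Am tens_zero \<kappa>_simps)
      qed
      have c: "\<kappa> ((K \<alpha> * \<Psi> (E \<alpha>) w) \<otimes>\<^sub>t v) \<in> A_minus_part"
        using K_AL(1)[OF 2 \<Psi>_Am[OF 2 w]] by (rule AL_part) (use U_k_gens(1)[OF 2] U_k_P in auto)
      show ?thesis using a b c A_minus_part commutator[OF Am_Um[OF w] 2] GE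
        by (simp add: tens_add_left tens_diff_left \<kappa>_simps)
    qed
  qed
qed

text \<open>\<open>Verma_pairing\<close> prescribes \<open>B\<close> only on the elements
  \<open>\<kappa> (w \<otimes>\<^sub>t v)\<close> with \<open>w\<close> in \<open>A_minus\<close>.
  Since these span the module, adjointness may be checked on them.\<close>

lemma A_minus_part_UNIV: "\<eta> \<in> A_minus_part"
proof -
  have L_part: "L a \<eta> \<in> A_minus_part" if "\<eta> \<in> A_minus_part" "\<And>w v. w \<in> Am \<Longrightarrow> \<kappa> ((a * w) \<otimes>\<^sub>t v) \<in> A_minus_part" for a \<eta>
    using that(1) unfolding A_minus_part_def[of, abs_def]
  proof (induction rule: span_induct_lin)
    case (base x)
    then show ?case using that(2) by (auto simp: L_\<kappa> A_minus_part_def)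
  qed (auto simp: functional_simps[OF L_linear] intro: cvec.span_zero cvec.span_add cvec.span_scale)
  have *: "\<forall>w\<in>Am. \<forall>v. \<kappa> ((a * w) \<otimes>\<^sub>t v) \<in> A_minus_part" for a
  proof -
    have "a \<in> subalg hull (range g)" using generated by simp
    then show ?thesis
    proof (induction rule: subalg_hull_induct)
      case (gen x) then show ?case using gen_part by auto
    next
      case one show ?case unfolding A_minus_part_def by (auto intro: cvec.span_base)
    next
      case (mult x y)
      then show ?case using L_part by (auto simp: mult.assoc simp flip: L_\<kappa>)
    qed (auto simp: distrib_right tens_add_left \<kappa>_simps mult_cscale_left tens_scale_left intro: A_minus_part)
  qed
  obtain t where t: "\<eta> = \<kappa> t" using \<kappa>_surj by (auto simp: surj_def)
  have "\<kappa> t \<in> A_minus_part" for t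
  proof (induction t rule: tensor_induct)
    case (1 a v) then show ?case using *[of a] Am(3) by force
  next
    case (2 x y) then show ?case by (simp add: \<kappa>_simps A_minus_part)
  qed
  then show ?thesis by (simp add: t)
qed

definition summand :: "nat \<Rightarrow> nat \<Rightarrow> ('u, 'v dual) tensor \<Rightarrow> ('u, 'v dual) tensor" where
  "summand k l = tensor_map (rmult (Z.z k l) \<circ> Ad_K g beta)
     (transpose_op (\<rho> (chainF rmu k)) \<odot> transpose_op (\<rho> (chainF rnu l)) \<odot> dual_action S \<rho> (K 0 ^ 2))"

text \<open>For \<open>k > 0\<close> this is \<open>inverse q / pairing_const k\<close>. With the
  minus sign before the double sum in \<open>formula\<close>, one nonzero index gives
  \<open>+ \<gamma> q^-1\<close> and two give \<open>- \<gamma>^2 q^-2\<close>.\<close>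

definition summand_const :: "nat \<Rightarrow> complex" where "summand_const k = (if k = 0 then 1 else - (q - inverse q) * inverse q)"

definition formula :: "('u, 'v dual) tensor \<Rightarrow> ('u, 'v dual) tensor" where
  "formula \<xi> = tensor_map (lmult (Z.z 0 0)) id \<xi> - (\<Sum>k<n. \<Sum>l<n. (summand_const k * summand_const l) *\<^sub>C summand k l \<xi>)"

lemma S_facts: "S (K 0 ^ 2) = Ki 0 * Ki 0" "S (E 0) = - (Ki 0 * E 0)"
proof -
  have "S (x * y) = S y * S x" for x y using antipode by (simp add: antipode_def calg_antihom_def)
  then show "S (K 0 ^ 2) = Ki 0 * Ki 0" "S (E 0) = - (Ki 0 * E 0)"
    using antipode beta_R by (simp_all add: antipode_def power2_eq_square)
qed

lemma clinear_lmult: "clinear (lmult a)" and clinear_rmult: "clinear (rmult a)"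
  and clinear_Ad: "clinear (Ad_K g \<alpha>)"
  unfolding lmult_def[abs_def] rmult_def[abs_def] Ad_K_def[abs_def]
  by (auto intro!: clinearI simp: calg_simps)

lemma clinear_dual_times: "clinear A \<Longrightarrow> clinear A' \<Longrightarrow> clinear (A \<odot> A')"
  unfolding dual_times_def comp_def by (rule clinear_compose)

lemma summand_tens:
  "summand k l (z \<otimes>\<^sub>t v') = (K 0 * z * Ki 0 * Z.z k l) \<otimes>\<^sub>t
     (transpose_op (\<rho> (chainF rmu k)) \<odot> transpose_op (\<rho> (chainF rnu l)) \<odot> dual_action S \<rho> (K 0 ^ 2)) v'"
  unfolding summand_def
  by (subst tensor_map_tens)
    (auto simp: comp_def rmult_def Ad_K_def dual_action_def
      intro!: clinear_compose[OF clinear_rmult clinear_Ad, unfolded rmult_def Ad_K_def] clinear_dual_times clinear_transpose_op)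

lemma clinear_formula: "clinear formula"
proof -
  have "clinear (tensor_map f h)" for f :: "'u \<Rightarrow> 'u" and h :: "'v dual \<Rightarrow> 'v dual"
    unfolding tensor_map_def by (rule clinear_tensor_lift)
  note lin = functional_simps[OF this]
  show ?thesis
    by (rule clinearI) (simp_all add: formula_def summand_def lin calg_simps(4,5) sum.distrib cvec.scale_sum_right
      cscale_cscale mult.commute algebra_simps)
qed

text \<open>Both torus factors are collected at the right end, where they form
  \<open>S (K 0 ^ 2)\<close>; moving the left one there produces the powers of
  \<open>inverse q\<close>.\<close>

lemma \<rho>_word:
  assumes "k < n" "l < n"
  shows "\<rho> (Ki 0 * chainF rmu k * chainF rnu l * Ki 0) v =
    ((if k = 0 then 1 else inverse q) * (if l = 0 then 1 else inverse q)) *\<^sub>C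
      \<rho> (chainF rmu k) (\<rho> (chainF rnu l) (\<rho> (Ki 0 * Ki 0) v))"
proof -
  note mem = chainF_U_k[OF assms(1)] chainF_U_k[OF assms(2)] U_k_gens(2)[OF beta_R]
  have "Ki 0 * chainF rmu k * chainF rnu l * Ki 0 =
    ((if k = 0 then 1 else inverse q) * (if l = 0 then 1 else inverse q)) *\<^sub>C
      (chainF rmu k * (chainF rnu l * (Ki 0 * Ki 0)))"
    using Ki_chainF(1)[OF assms(1)] Ki_chainF(2)[OF assms(2)] by (simp add: calg_simps)
  then show ?thesis using mem by (simp add: \<rho>_scale \<rho>_mult U_k_P U_k)
qed

lemma B_simps:
  "x \<in> tensor_dual Ap \<Longrightarrow> B (\<eta> + \<eta>') x = B \<eta> x + B \<eta>' x"
  "x \<in> tensor_dual Ap \<Longrightarrow> B (c *\<^sub>C \<eta>) x = c * B \<eta> x"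
  "x \<in> tensor_dual Ap \<Longrightarrow> y \<in> tensor_dual Ap \<Longrightarrow> B \<eta> (x + y) = B \<eta> x + B \<eta> y"
  "x \<in> tensor_dual Ap \<Longrightarrow> B \<eta> (c *\<^sub>C x) = c * B \<eta> x"
  and B_tens: "w \<in> Am \<Longrightarrow> z \<in> Ap \<Longrightarrow> B (\<kappa> (w \<otimes>\<^sub>t v)) (z \<otimes>\<^sub>t v') = J w z * dual_app v' v"
  using pairing by (auto simp: Verma_pairing_def bilinear_on_def)

lemma tensor_dual_sub: "cvec.subspace (tensor_dual Ap)"
  by (simp add: tensor_dual_def)

lemmas td = subspaceD[OF tensor_dual_sub]

lemma tens_td: "z \<in> Ap \<Longrightarrow> z \<otimes>\<^sub>t v' \<in> tensor_dual Ap"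
  unfolding tensor_dual_def by (rule cvec.span_base) blast

lemma B_0: "x \<in> tensor_dual Ap \<Longrightarrow> B 0 x = 0" "B \<eta> 0 = 0"
  using B_simps(2)[of x 0 0] B_simps(4)[of 0 \<eta> 0] td(1) by simp_all

lemma B_neg: "x \<in> tensor_dual Ap \<Longrightarrow> B (- \<eta>) x = - B \<eta> x" "x \<in> tensor_dual Ap \<Longrightarrow> B \<eta> (- x) = - B \<eta> x"
  using B_simps(1)[of x \<eta> "- \<eta>"] B_simps(3)[of x "- x" \<eta>] B_0 td(5)[of x]
  by (simp_all add: eq_neg_iff_add_eq_0 add.commute)

lemma B_diff: "x \<in> tensor_dual Ap \<Longrightarrow> y \<in> tensor_dual Ap \<Longrightarrow> B \<eta> (x - y) = B \<eta> x - B \<eta> y"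
  "x \<in> tensor_dual Ap \<Longrightarrow> B (\<eta> - \<eta>') x = B \<eta> x - B \<eta>' x"
  using B_simps(3)[of x "- y" \<eta>] B_simps(1)[of x \<eta> "- \<eta>'"] B_neg td(5)[of y] by simp_all

lemma B_sum: "x \<in> tensor_dual Ap \<Longrightarrow> B (\<Sum>i\<in>I. f i) x = (\<Sum>i\<in>I. B (f i) x)"
  "(\<And>i. i \<in> I \<Longrightarrow> h i \<in> tensor_dual Ap) \<Longrightarrow> B \<eta> (\<Sum>i\<in>I. h i) = (\<Sum>i\<in>I. B \<eta> (h i))"
  by (induction I rule: infinite_finite_induct; simp add: B_0 B_simps cvec.subspace_sum[OF tensor_dual_sub])+

lemma A_minus_part_induct:
  assumes "\<And>w v. w \<in> Am \<Longrightarrow> Q (\<kappa> (w \<otimes>\<^sub>t v))" "Q 0" "\<And>x y. Q x \<Longrightarrow> Q y \<Longrightarrow> Q (x + y)" "\<And>c x. Q x \<Longrightarrow> Q (c *\<^sub>C x)"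
  shows "Q \<eta>"
  using A_minus_part_UNIV[of \<eta>] unfolding A_minus_part_def
  by (induction rule: span_induct_lin) (use assms in auto)

text \<open>The commutator formula applied to \<open>S (E 0) * w\<close>; the term with
  \<open>E 0\<close> on the right dies, because \<open>E 0\<close> is \<open>Z.z 0 0\<close> and
  acts on V by zero.\<close>

lemma L_S_E:
  assumes w: "w \<in> Am" and D: "\<And>k l. D k l \<in> Am"
    and eq: "\<Phi> (E 0) w = (\<Sum>k<n. \<Sum>l<n. D k l * (chainF rmu k * chainF rnu l * Ki 0))"
  shows "L (S (E 0)) (\<kappa> (w \<otimes>\<^sub>t v)) = \<kappa> (\<Psi> (E 0) w \<otimes>\<^sub>t v) -
    (\<Sum>k<n. \<Sum>l<n. \<kappa> ((Ki 0 * D k l * K 0) \<otimes>\<^sub>t \<rho> (Ki 0 * chainF rmu k * chainF rnu l * Ki 0) v))"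
proof -
  have ZE: "\<rho> (E 0) v = 0" using Z_acts[of 0 0 v] n_pos by (simp add: Z_el_eq Z_Suc)
  have E: "E 0 \<in> P" using Z_P[of 0 0] n_pos by (simp add: Z_Suc)
  have zero: "\<kappa> ((Ki 0 * w * E 0) \<otimes>\<^sub>t v) = 0"
    by (simp add: \<kappa>_move[OF E] ZE tens_zero \<kappa>_simps)
  have "S (E 0) * w = - (Ki 0 * (E 0 * w))" by (simp add: S_facts mult.assoc)
  also have "\<dots> = - (Ki 0 * w * E 0) - Ki 0 * \<Phi> (E 0) w + (Ki 0 * K 0) * \<Psi> (E 0) w"
    unfolding commutator[OF Am_Um[OF w] beta_R] by (simp add: algebra_simps)
  also have "Ki 0 * K 0 = 1" using Ki_K beta_R by simp
  finally have "S (E 0) * w = (\<Psi> (E 0) w - Ki 0 * w * E 0) - Ki 0 * \<Phi> (E 0) w" by simp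
  moreover have "\<kappa> ((Ki 0 * \<Phi> (E 0) w) \<otimes>\<^sub>t v) =
    (\<Sum>k<n. \<Sum>l<n. \<kappa> ((Ki 0 * D k l * K 0) \<otimes>\<^sub>t \<rho> (Ki 0 * chainF rmu k * chainF rnu l * Ki 0) v))"
  proof -
    have "\<kappa> ((Ki 0 * (D k l * (chainF rmu k * chainF rnu l * Ki 0))) \<otimes>\<^sub>t v) =
      \<kappa> ((Ki 0 * D k l * K 0) \<otimes>\<^sub>t \<rho> (Ki 0 * chainF rmu k * chainF rnu l * Ki 0) v)" if "k < n" "l < n" for k l
    proof -
      \<comment> \<open>Inserting \<open>K 0 * Ki 0 = 1\<close> splits the product into a conjugate
        of \<open>D k l\<close>, which stays in \<open>A_minus\<close>, and a word of
        \<open>U_k\<close>.\<close>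
      have "Ki 0 * (D k l * (chainF rmu k * chainF rnu l * Ki 0)) =
        Ki 0 * D k l * (K 0 * Ki 0) * (chainF rmu k * chainF rnu l * Ki 0)"
        using K_Ki beta_R by (simp add: mult.assoc)
      also have "\<dots> = (Ki 0 * D k l * K 0) * (Ki 0 * chainF rmu k * chainF rnu l * Ki 0)"
        by (simp only: mult.assoc)
      finally show ?thesis
        using that U_k_gens(2)[OF beta_R] chainF_U_k by (simp only: \<kappa>_move U_k_P U_k)
    qed
    then show ?thesis
      unfolding eq by (simp add: sum_distrib_left tens_sum_left cvec.linear_sum[OF \<kappa>_linear])
  qed
  ultimately show ?thesis by (simp add: L_\<kappa> tens_diff_left \<kappa>_simps zero)
qed

lemma formula_td: assumes "z \<in> Ap" shows "formula (z \<otimes>\<^sub>t v') \<in> tensor_dual Ap"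
proof -
  have "summand k l (z \<otimes>\<^sub>t v') \<in> tensor_dual Ap" if "k < n" "l < n" for k l
    unfolding summand_tens using that by (intro tens_td Ap(4)[OF conj_Ap[OF beta_R assms]] Z_Ap)
  moreover have "tensor_map (lmult (Z.z 0 0)) id (z \<otimes>\<^sub>t v') \<in> tensor_dual Ap"
    using assms Z_Ap[of 0 0] n_pos cvec.linear_id
    by (subst tensor_map_tens[OF clinear_lmult]) (auto simp: lmult_def id_def intro!: tens_td Ap)
  ultimately show ?thesis unfolding formula_def
    by (intro td cvec.subspace_sum[OF tensor_dual_sub]) auto
qed

text \<open>Both sides reduce to one double sum over \<open>J (D k l) (K 0 * z * Ki 0)\<close>: on
  the left through \<open>J_mult_Z\<close>, on the right through \<open>L_S_E\<close> and
  \<open>J_conj\<close>. Left multiplication by \<open>Z.z 0 0\<close> matches the term with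
  \<open>\<Psi> (E 0) w\<close>.\<close>

lemma adjoint_tens:
  assumes z: "z \<in> Ap"
  shows "B \<eta> (formula (z \<otimes>\<^sub>t v')) = B (L (S (E 0)) \<eta>) (z \<otimes>\<^sub>t v')"
proof (induction \<eta> rule: A_minus_part_induct)
  case (1 w v)
  from \<Phi>_beta_coefficients[OF 1] obtain D where D_eq: "(\<forall>k l. D k l \<in> Am) \<and>
    \<Phi> (E 0) w = (\<Sum>k<n. \<Sum>l<n. D k l * (chainF rmu k * chainF rnu l * Ki 0))" ..
  have D: "D k l \<in> Am" for k l using conjunct1[OF D_eq] by blast
  note eq = conjunct2[OF D_eq]
  define f where "f k l = dual_app v' (\<rho> (chainF rmu k) (\<rho> (chainF rnu l) (\<rho> (Ki 0 * Ki 0) v)))" for k l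
  define c where "c k = (if k = 0 then 1 else inverse q)" for k :: nat
  let ?z = "K 0 * z * Ki 0"
  have z': "?z \<in> Ap" using conj_Ap[OF beta_R z] .
  have B_op: "B (\<kappa> (w \<otimes>\<^sub>t v)) (summand k l (z \<otimes>\<^sub>t v')) = pairing_const k * pairing_const l * J (D k l) ?z * f k l" if kl: "k < n" "l < n" for k l
  proof -
    have P: "chainF rmu k \<in> P" "chainF rnu l \<in> P" "Ki 0 * Ki 0 \<in> P"
      by (intro U_k_P chainF_U_k U_k(4) U_k_gens(2) beta_R kl)+
    \<comment> \<open>Since \<open>\<odot>\<close> applies its left factor first, the operators on V
      stand in the written order, with \<open>Ki 0 * Ki 0\<close> acting first on
      \<open>v\<close>.\<close>
    have "dual_app ((transpose_op (\<rho> (chainF rmu k)) \<odot> transpose_op (\<rho> (chainF rnu l)) \<odot> dual_action S \<rho> (K 0 ^ 2)) v') v = f k l"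
      using P by (simp add: dual_times_def dual_action_def S_facts dual_app_transpose_op \<rho>_linear f_def)
    then show ?thesis
      unfolding summand_tens using 1 z' Z_Ap kl Ap J_mult_Z[OF 1 z' kl D eq] by (simp add: B_tens)
  qed
  have B_term: "B (\<kappa> (w \<otimes>\<^sub>t v)) ((summand_const k * summand_const l) *\<^sub>C summand k l (z \<otimes>\<^sub>t v')) = c k * c l * J (D k l) ?z * f k l"
    if kl: "k < n" "l < n" for k l
  proof -
    \<comment> \<open>The coefficients of the formula are such that
      \<open>summand_const k * pairing_const k\<close> is exactly the scalar \<open>c k\<close>
      produced by \<open>Ki_chainF\<close>.\<close>
    have "- a * b * - inverse a = b" if "a \<noteq> 0" for a b :: complex
      using that by simp
    from this[OF q_facts(2)] have "summand_const k * pairing_const k = c k" for k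
      by (simp only: summand_const_def pairing_const_def c_def) simp
    moreover have "summand k l (z \<otimes>\<^sub>t v') \<in> tensor_dual Ap"
      unfolding summand_tens using kl by (intro tens_td Ap(4)[OF z'] Z_Ap)
    moreover have "(summand_const k * summand_const l) * (pairing_const k * pairing_const l * J (D k l) ?z * f k l) = (summand_const k * pairing_const k) * (summand_const l * pairing_const l) * J (D k l) ?z * f k l"
      by (simp only: mult_ac)
    ultimately show ?thesis using B_op[OF kl] by (simp only: B_simps(4))
  qed
  have summand_td: "(summand_const k * summand_const l) *\<^sub>C summand k l (z \<otimes>\<^sub>t v') \<in> tensor_dual Ap" if "k < n" "l < n" for k l
    unfolding summand_tens using that by (intro td(4) tens_td Ap(4)[OF z'] Z_Ap)
  let ?t = "\<lambda>k l. (summand_const k * summand_const l) *\<^sub>C summand k l (z \<otimes>\<^sub>t v')"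
  have "B (\<kappa> (w \<otimes>\<^sub>t v)) (\<Sum>k<n. \<Sum>l<n. ?t k l) = (\<Sum>k<n. B (\<kappa> (w \<otimes>\<^sub>t v)) (\<Sum>l<n. ?t k l))"
    by (rule B_sum(2)) (auto intro!: cvec.subspace_sum[OF tensor_dual_sub] summand_td)
  also have "\<dots> = (\<Sum>k<n. \<Sum>l<n. B (\<kappa> (w \<otimes>\<^sub>t v)) (?t k l))"
    by (intro sum.cong refl B_sum(2)) (auto intro: summand_td)
  also have "\<dots> = (\<Sum>k<n. \<Sum>l<n. c k * c l * J (D k l) ?z * f k l)"
    by (intro sum.cong refl B_term) auto
  finally have B_double: "B (\<kappa> (w \<otimes>\<^sub>t v)) (\<Sum>k<n. \<Sum>l<n. ?t k l) = (\<Sum>k<n. \<Sum>l<n. c k * c l * J (D k l) ?z * f k l)" .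
  have double_td: "(\<Sum>k<n. \<Sum>l<n. ?t k l) \<in> tensor_dual Ap"
    by (intro cvec.subspace_sum[OF tensor_dual_sub] summand_td) auto
  have lm: "tensor_map (lmult (Z.z 0 0)) id (z \<otimes>\<^sub>t v') = (E 0 * z) \<otimes>\<^sub>t v'"
    using cvec.linear_id by (subst tensor_map_tens[OF clinear_lmult]) (auto simp: lmult_def id_def Z_Suc)
  have Ez: "E 0 * z \<in> Ap" using Ap(4)[OF Z_Ap[of 0 0] z] n_pos by (simp add: Z_Suc)
  have left: "B (\<kappa> (w \<otimes>\<^sub>t v)) (formula (z \<otimes>\<^sub>t v')) =
      J w (E 0 * z) * dual_app v' v - (\<Sum>k<n. \<Sum>l<n. c k * c l * J (D k l) ?z * f k l)"
    unfolding formula_def lm B_diff(1)[OF tens_td[OF Ez] double_td] B_double by (simp add: B_tens 1 Ez)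
  have "B (\<kappa> ((Ki 0 * D k l * K 0) \<otimes>\<^sub>t \<rho> (Ki 0 * chainF rmu k * chainF rnu l * Ki 0) v)) (z \<otimes>\<^sub>t v')
      = c k * c l * J (D k l) ?z * f k l" if "k < n" "l < n" for k l
    using that D z conj_Am[OF beta_R D]
    by (simp add: \<rho>_word tens_scale_right \<kappa>_simps B_simps tens_td B_tens J_conj f_def c_def)
  then have right: "B (L (S (E 0)) (\<kappa> (w \<otimes>\<^sub>t v))) (z \<otimes>\<^sub>t v') =
      J (\<Psi> (E 0) w) z * dual_app v' v - (\<Sum>k<n. \<Sum>l<n. c k * c l * J (D k l) ?z * f k l)"
    unfolding L_S_E[OF 1 D eq] using z \<Psi>_Am[OF beta_R 1] by (simp add: B_diff B_sum tens_td B_tens)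
  have "J w (E 0 * z) = J (\<Psi> (E 0) w) z"
    using 1 z beta_R by (intro J_\<Psi> gens) (auto simp: Am_Um Um_Ule Ap_Up Up_Uge)
  with left right show ?case by simp
qed (use assms in \<open>auto simp: B_0 formula_td tens_td B_simps functional_simps[OF L_linear]\<close>)

lemma adjoint:
  assumes "\<xi> \<in> tensor_dual Ap"
  shows "formula \<xi> \<in> tensor_dual Ap \<and> (\<forall>\<eta>. B \<eta> (formula \<xi>) = B (L (S (E 0)) \<eta>) \<xi>)"
proof -
  have "\<xi> \<in> cvec.span {z \<otimes>\<^sub>t v' | z v'. z \<in> Ap}" using assms by (simp only: tensor_dual_def)
  then have "\<xi> \<in> tensor_dual Ap \<and> formula \<xi> \<in> tensor_dual Ap \<and> (\<forall>\<eta>. B \<eta> (formula \<xi>) = B (L (S (E 0)) \<eta>) \<xi>)"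
  proof (induction rule: span_induct_lin)
    case (base x)
    then obtain z v' where "x = z \<otimes>\<^sub>t v'" "z \<in> Ap" by auto
    then show ?case using adjoint_tens formula_td tens_td by simp
  qed (auto simp: functional_simps[OF clinear_formula] B_0 B_simps td)
  then show ?thesis by blast
qed

text \<open>For fixed \<open>w\<close>, varying \<open>v\<close> gives a vanishing combination of
  independent functionals; hence every first factor is orthogonal to \<open>A_minus\<close>, and
  \<open>nondegenerate\<close> applies.\<close>

lemma B_nondegenerate:
  assumes d: "d \<in> tensor_dual Ap" and zero: "\<And>\<eta>. B \<eta> d = 0"
  shows "d = 0"
proof -
  obtain f :: "'v dual \<Rightarrow> 'u" and I where I: "finite I" "cvec.independent I" and f: "\<And>s. f s \<in> Ap"
    and eq: "d = (\<Sum>s\<in>I. f s \<otimes>\<^sub>t s)"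
    using tensor_dual_independent[OF d Ap(1)] by metis
  have "J w (f s) = 0" if w: "w \<in> Am" and s: "s \<in> I" for w s
  proof -
    have "dual_app (\<Sum>s\<in>I. J w (f s) *\<^sub>C s) v = 0" for v
    proof -
      have "B (\<kappa> (w \<otimes>\<^sub>t v)) d = (\<Sum>s\<in>I. J w (f s) * dual_app s v)"
        unfolding eq using f w by (simp add: B_sum tens_td B_tens)
      then show ?thesis using zero by (simp add: dual_app_sum dual_app_simps)
    qed
    then have "(\<Sum>s\<in>I. J w (f s) *\<^sub>C s) = 0" by (intro dual_eqI) (simp add: dual_app_simps)
    with I s show ?thesis
      using cvec.independentD[OF I(2) I(1) subset_refl, of "\<lambda>s. J w (f s)"] by blast
  qed
  then have "f s = 0" if "s \<in> I" for s using nondegenerate[OF f] that by blast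
  then show ?thesis by (simp add: eq tens_zero)
qed

text \<open>\<open>adjoint\<close> gives existence and \<open>B_nondegenerate\<close> the uniqueness
  required by the definite description.\<close>

lemma dual_operator_eq:
  assumes "\<xi> \<in> tensor_dual Ap"
  shows "dual_operator Ap S L B (E 0) \<xi> = formula \<xi>"
  unfolding dual_operator_def
proof (rule the_equality)
  show "formula \<xi> \<in> tensor_dual Ap \<and> (\<forall>\<eta>. B \<eta> (formula \<xi>) = B (L (S (E 0)) \<eta>) \<xi>)" by (rule adjoint[OF assms])
  fix \<zeta> assume \<zeta>: "\<zeta> \<in> tensor_dual Ap \<and> (\<forall>\<eta>. B \<eta> \<zeta> = B (L (S (E 0)) \<eta>) \<xi>)"
  have "\<zeta> - formula \<xi> = 0"
    using \<zeta> adjoint[OF assms] by (intro B_nondegenerate td) (auto simp: B_diff)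
  then show "\<zeta> = formula \<xi>" by simp
qed

lemma X_el_eq: "i \<ge> 1 \<Longrightarrow> i < n \<Longrightarrow> X_el g T i = chainF rmu i"
  and Y_el_eq: "i \<ge> 1 \<Longrightarrow> i < n \<Longrightarrow> Y_el g T i = chainF rnu i"
proof -
  \<comment> \<open>\<open>X_el\<close> and \<open>Y_el\<close> number the simple roots from 1 and
    the paths from 0, so \<open>mu (Suc k)\<close> becomes \<open>rmu k\<close>.\<close>
  have shift: "fold (\<lambda>k. T (h k)) [2..<Suc (Suc d)] = fold (\<lambda>k. T (h (Suc k))) [1..<Suc d]" for h d
  proof -
    have "[2..<Suc (Suc d)] = map Suc [1..<Suc d]" by (simp only: map_Suc_upt numeral_2_eq_2 One_nat_def)
    then show ?thesis by (simp only: fold_map comp_def)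
  qed
  have *: "fold (\<lambda>k. T (\<tau> k)) [1..<Suc d] (F (\<tau> 0)) = chainF \<tau> (Suc d)"
    if "root_path n (n - 1) \<tau>" "Suc d < n" for \<tau> d
    using W.fold_T[of d \<tau>] that cartan_sym unfolding root_path_def chainF_def
    by (auto simp: less_diff_conv)
  show "i \<ge> 1 \<Longrightarrow> i < n \<Longrightarrow> X_el g T i = chainF rmu i"
    using *[OF root_path_mu, of "i - 1"] shift[of mu "i - 1"] by (cases i) (simp_all add: X_el_def rmu_def)
  show "i \<ge> 1 \<Longrightarrow> i < n \<Longrightarrow> Y_el g T i = chainF rnu i"
    using *[OF root_path_nu, of "i - 1"] shift[of nu "i - 1"] by (cases i) (simp_all add: Y_el_def rnu_def)
qed

lemma sum_split_0: "(\<Sum>k<n. h k) = h 0 + (\<Sum>k=1..n-1. h k)" for h :: "nat \<Rightarrow> 'b::ab_group_add"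
proof -
  have "{..<n} = insert 0 {1..n-1}" using n_pos by auto
  then show ?thesis by simp
qed

text \<open>Index 0 is split off in both sums; there the chain is 1 and its transpose the identity.
  This separates the double sum into the groups of terms in the final formula.\<close>

lemma formula_expanded:
  fixes \<gamma> assumes \<gamma>: "\<gamma> = q - inverse q"
  shows "formula \<xi> =
      tensor_map (lmult (Z_el g T 1 1)) id \<xi>
    - tensor_map (rmult (Z_el g T 1 1) \<circ> Ad_K g beta) (dual_action S \<rho> (g (GK beta) ^ 2)) \<xi>
    + (\<Sum>i=1..n-1. (\<gamma> * inverse q) *\<^sub>C
         tensor_map (rmult (Z_el g T (i+1) 1) \<circ> Ad_K g beta)
           (transpose_op (\<rho> (X_el g T i)) \<odot> dual_action S \<rho> (g (GK beta) ^ 2)) \<xi>)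
    + (\<Sum>j=1..n-1. (\<gamma> * inverse q) *\<^sub>C
         tensor_map (rmult (Z_el g T 1 (j+1)) \<circ> Ad_K g beta)
           (transpose_op (\<rho> (Y_el g T j)) \<odot> dual_action S \<rho> (g (GK beta) ^ 2)) \<xi>)
    - (\<Sum>i=1..n-1. \<Sum>j=1..n-1. (\<gamma>\<^sup>2 * inverse (q\<^sup>2)) *\<^sub>C
         tensor_map (rmult (Z_el g T (i+1) (j+1)) \<circ> Ad_K g beta)
           (transpose_op (\<rho> (X_el g T i)) \<odot> transpose_op (\<rho> (Y_el g T j)) \<odot> dual_action S \<rho> (g (GK beta) ^ 2)) \<xi>)"
    (is "_ = ?Z - ?O + ?X + ?Y - ?XY")
proof -
  let ?t = "\<lambda>k l. (summand_const k * summand_const l) *\<^sub>C summand k l \<xi>"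
  have id: "transpose_op (\<rho> 1) = (id :: 'v dual \<Rightarrow> _)"
    using transpose_op_id by (simp add: \<rho>_1[abs_def])
  have Zel: "Z_el g T (i + 1) (j + 1) = Z.z i j" "Z_el g T 1 1 = Z.z 0 0" "Z_el g T (i + 1) 1 = Z.z i 0"
    "Z_el g T 1 (j + 1) = Z.z 0 j" for i j
    using Z_el_eq[of i j] Z_el_eq[of 0 0] Z_el_eq[of i 0] Z_el_eq[of 0 j] by simp_all
  define r where "r = \<gamma> * inverse q"
  have summand_const: "summand_const 0 = 1" "k \<ge> 1 \<Longrightarrow> summand_const k = - r" for k
    by (simp_all add: summand_const_def r_def \<gamma> algebra_simps)
  have r2: "\<gamma>\<^sup>2 * inverse (q\<^sup>2) = r * r" by (simp add: r_def power2_eq_square)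
  have O: "?O = ?t 0 0"
    unfolding summand_def chainF_simps id Zel by (simp add: summand_const cscale_one dual_times_def)
  have X: "?X = - (\<Sum>k=1..n-1. ?t k 0)"
    unfolding sum_negf[symmetric] r_def[symmetric] Zel
    by (rule sum.cong) (auto simp: summand_def chainF_simps id summand_const dual_times_def X_el_eq)
  have Y: "?Y = - (\<Sum>l=1..n-1. ?t 0 l)"
    unfolding sum_negf[symmetric] r_def[symmetric] Zel
    by (rule sum.cong) (auto simp: summand_def chainF_simps id summand_const dual_times_def Y_el_eq)
  have XY: "?XY = (\<Sum>k=1..n-1. \<Sum>l=1..n-1. ?t k l)"
    unfolding r2 Zel by (intro sum.cong) (auto simp: summand_def summand_const X_el_eq Y_el_eq)
  have "(\<Sum>k<n. \<Sum>l<n. ?t k l) = ?t 0 0 + (\<Sum>l=1..n-1. ?t 0 l) + ((\<Sum>k=1..n-1. ?t k 0) + (\<Sum>k=1..n-1. \<Sum>l=1..n-1. ?t k l))"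
    by (simp only: sum_split_0 sum.distrib) (simp only: add_ac)
  moreover have "z - (a + b + (c + d)) = z - a + - c + - b - d" for z a b c d :: "('u, 'v dual) tensor"
    by simp
  ultimately show ?thesis unfolding O X Y XY unfolding formula_def Zel(2) by (simp only:)
qed

end

section \<open>Extension of the \<open>q\<close>-Killing form\<close>

lemma ex_projection:
  assumes "cvec.subspace (A :: 'a::cvec set)"
  shows "\<exists>P. clinear P \<and> range P \<subseteq> A \<and> (\<forall>x\<in>A. P x = x)"
proof -
  obtain Bs where Bs: "Bs \<subseteq> A" "cvec.independent Bs" "A \<subseteq> cvec.span Bs"
    by (rule cvec.basis_exists[of A])
  have span: "cvec.span Bs = A" using Bs span_subsetI[OF assms Bs(1)] by blast
  obtain P :: "'a \<Rightarrow> 'a" where P: "clinear P" "\<forall>x\<in>Bs. P x = x" "range P = cvec.span ((\<lambda>x. x) ` Bs)"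
    using cvec.linear_independent_extend_subspace[OF Bs(2), of "\<lambda>x. x"] by blast
  have "clinear (\<lambda>x :: 'a. x)" by (rule clinearI) auto
  from cvec.linear_eq_on[OF P(1) this] have "P x = x" if "x \<in> A" for x
    using P(2) that span by blast
  then show ?thesis using P span by auto
qed

lemma tensor_square_list:
  assumes "cvec.subspace B" "t \<in> tensor_square B"
  shows "\<exists>ts. set ts \<subseteq> B \<times> B \<and> t = (\<Sum>(a, b)\<leftarrow>ts. a \<otimes>\<^sub>t b)"
  using assms(2) unfolding tensor_square_def
proof (induction rule: span_induct_lin)
  case (base t)
  then obtain x y where "t = x \<otimes>\<^sub>t y" "x \<in> B" "y \<in> B" by auto
  then show ?case by (intro exI[of _ "[(x, y)]"]) auto
next
  case zero
  show ?case by (intro exI[of _ "[]"]) auto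
next
  case (add t t')
  then obtain ts ts' where "set ts \<subseteq> B \<times> B" "t = (\<Sum>(a, b)\<leftarrow>ts. a \<otimes>\<^sub>t b)"
    "set ts' \<subseteq> B \<times> B" "t' = (\<Sum>(a, b)\<leftarrow>ts'. a \<otimes>\<^sub>t b)" by auto
  then show ?case by (intro exI[of _ "ts @ ts'"]) auto
next
  case (scale c t)
  then obtain ts where ts: "set ts \<subseteq> B \<times> B" "t = (\<Sum>(a, b)\<leftarrow>ts. a \<otimes>\<^sub>t b)" by auto
  have "c *\<^sub>C (\<Sum>(a, b)\<leftarrow>ts. a \<otimes>\<^sub>t b) = (\<Sum>(a, b)\<leftarrow>map (\<lambda>(a, b). (c *\<^sub>C a, b)) ts. a \<otimes>\<^sub>t b)" for ts :: "('a \<times> 'a) list"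
    by (induction ts) (auto simp: cscale_add_right tens_scale_left)
  then show ?case using ts subspaceD(4)[OF assms(1)]
    by (intro exI[of _ "map (\<lambda>(a, b). (c *\<^sub>C a, b)) ts"]) auto
qed

text \<open>The indexed form over which the axioms of \<open>q_Killing_form\<close>
  quantify.\<close>

lemma tensor_square_representation:
  assumes "cvec.subspace B" "t \<in> tensor_square B"
  obtains N :: nat and a b where "\<forall>k<N. a k \<in> B \<and> b k \<in> B" "t = (\<Sum>k<N. a k \<otimes>\<^sub>t b k)"
proof -
  obtain ts where ts: "set ts \<subseteq> B \<times> B" "t = (\<Sum>(a, b)\<leftarrow>ts. a \<otimes>\<^sub>t b)"
    using tensor_square_list[OF assms] by auto
  show thesis
  proof (rule that)
    show "\<forall>k<length ts. fst (ts ! k) \<in> B \<and> snd (ts ! k) \<in> B"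
      using ts(1) nth_mem by fastforce
    show "t = (\<Sum>k<length ts. fst (ts ! k) \<otimes>\<^sub>t snd (ts ! k))"
      by (simp add: ts(2) sum_list_sum_nth atLeast0LessThan case_prod_unfold)
  qed
qed

lemma prod_list_single:
  assumes "distinct xs" "x \<in> set xs"
  shows "prod_list (map (\<lambda>y. if y = x then c else 1) xs) = (c :: 'a::monoid_mult)"
  using assms
proof (induction xs)
  case (Cons y xs)
  have "prod_list (map (\<lambda>y. if y = x then c else 1) xs) = 1" if "x \<notin> set xs" for xs
    using that by (induction xs) auto
  with Cons show ?case by auto
qed simp

lemma K_lattice_single:
  assumes "\<alpha> \<in> simple_roots n"
  shows "K_lattice n g (\<lambda>x. if x = \<alpha> then m else 0) = K_pow g \<alpha> m"
proof -
  have "(\<lambda>x. K_pow g x (if x = \<alpha> then m else 0)) = (\<lambda>x. if x = \<alpha> then K_pow g \<alpha> m else 1)"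
    by (auto simp: K_pow_def)
  then show ?thesis
    using prod_list_single[of "[- (int n - 1)..int n - 1]" \<alpha> "K_pow g \<alpha> m"] assms
    by (simp add: K_lattice_def simple_roots_def)
qed

lemma lattice_form_single:
  assumes "\<alpha> \<in> simple_roots n" "\<alpha>' \<in> simple_roots n"
  shows "lattice_form n (\<lambda>x. if x = \<alpha> then m else 0) (\<lambda>x. if x = \<alpha>' then m' else 0) = m * m' * cartan \<alpha> \<alpha>'"
proof -
  have fin: "finite (simple_roots n)" by (simp add: simple_roots_def)
  have "lattice_form n (\<lambda>x. if x = \<alpha> then m else 0) (\<lambda>x. if x = \<alpha>' then m' else 0) =
    (\<Sum>x\<in>simple_roots n. if x = \<alpha> then (\<Sum>y\<in>simple_roots n. if y = \<alpha>' then m * m' * cartan \<alpha> \<alpha>' else 0) else 0)"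
    unfolding lattice_form_def by (intro sum.cong refl) (auto intro!: sum.cong)
  then show ?thesis using assms fin by simp
qed

text \<open>Projections onto \<open>Ule\<close> and \<open>Uge\<close> leave \<open>J\<close>
  unchanged there. As \<Delta> preserves both subalgebras, a coproduct can be represented by tensors
  within them, and the product axioms turn into statements about \<open>tensor_lift\<close>.\<close>

lemma (in quantum_coproduct) pairing_extension:
  assumes killing: "q_Killing_form n q g \<Delta> J"
  obtains J' where "quantum_pairing n q g T \<Delta> J'" "\<And>y x. y \<in> Ule \<Longrightarrow> x \<in> Uge \<Longrightarrow> J' y x = J y x"
proof -
  obtain P where P: "clinear P" "range P \<subseteq> Ule" "\<forall>x\<in>Ule. P x = x"
    using ex_projection[OF Ule(1)] by blast
  obtain Q where Q: "clinear Q" "range Q \<subseteq> Uge" "\<forall>x\<in>Uge. Q x = x"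
    using ex_projection[OF Uge(1)] by blast
  note k = killing[unfolded q_Killing_form_def]
  define J' where "J' y x = J (P y) (Q x)" for y x
  have J': "J' y x = J y x" if "y \<in> Ule" "x \<in> Uge" for y x
    using that P Q by (simp add: J'_def)
  have PQ: "P y \<in> Ule" "Q x \<in> Uge" for y x using P Q by auto
  have bil: "bilinear_on Ule Uge J" using killing unfolding q_Killing_form_def by (rule conjunct1)
  have lin: "clinear (J' y)" "clinear (\<lambda>y. J' y x)" for y x
    using bil PQ unfolding J'_def bilinear_on_def
    by (auto intro!: clinearI simp: functional_simps[OF P(1)] functional_simps[OF Q(1)])
  have right: "J' y (x * x') = tensor_lift (\<lambda>a b. J' a x' * J' b x) (\<Delta> y)"
    if y: "y \<in> Ule" and x: "x \<in> Uge" "x' \<in> Uge" for y x x'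
  proof -
    obtain N :: nat and a b where N: "\<forall>k<N. a k \<in> Ule \<and> b k \<in> Ule" "\<Delta> y = (\<Sum>k<N. a k \<otimes>\<^sub>t b k)"
      by (rule tensor_square_representation[OF Ule(1) \<Delta>_Ule[OF y]])
    have ax: "(\<forall>k<N. a k \<in> Ule \<and> b k \<in> Ule) \<and> \<Delta> y = (\<Sum>k<N. a k \<otimes>\<^sub>t b k) \<longrightarrow>
        J y (x * x') = (\<Sum>k<N. J (a k) x' * J (b k) x)"
      by (rule k[THEN conjunct2, THEN conjunct1, THEN bspec, OF y, THEN bspec, OF x(1), THEN bspec, OF x(2),
            THEN spec, THEN spec, THEN spec])
    have cb: "cbilinear (\<lambda>a b. J' a x' * J' b x)"
      using lin by (auto simp: cbilinear_def clinear_mult_complex)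
    have "J' y (x * x') = J y (x * x')" using y x by (intro J' Uge)
    also have "\<dots> = (\<Sum>k<N. J (a k) x' * J (b k) x)"
      by (rule ax[THEN mp, OF conjI, OF N])
    also have "\<dots> = (\<Sum>k<N. J' (a k) x' * J' (b k) x)"
      using N x by (intro sum.cong) (auto simp: J')
    also have "\<dots> = tensor_lift (\<lambda>a b. J' a x' * J' b x) (\<Delta> y)"
      unfolding N(2) by (simp add: cvec.linear_sum[OF clinear_tensor_lift] tensor_lift_tens[OF cb])
    finally show ?thesis .
  qed
  have left: "J' (y * y') x = tensor_lift (\<lambda>a b. J' y a * J' y' b) (\<Delta> x)"
    if y: "y \<in> Ule" "y' \<in> Ule" and x: "x \<in> Uge" for y y' x
  proof -
    obtain N :: nat and a b where N: "\<forall>k<N. a k \<in> Uge \<and> b k \<in> Uge" "\<Delta> x = (\<Sum>k<N. a k \<otimes>\<^sub>t b k)"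
      by (rule tensor_square_representation[OF Uge(1) \<Delta>_Uge[OF x]])
    have ax: "(\<forall>k<N. a k \<in> Uge \<and> b k \<in> Uge) \<and> \<Delta> x = (\<Sum>k<N. a k \<otimes>\<^sub>t b k) \<longrightarrow>
        J (y * y') x = (\<Sum>k<N. J y (a k) * J y' (b k))"
      by (rule k[THEN conjunct2, THEN conjunct2, THEN conjunct1, THEN bspec, OF y(1), THEN bspec, OF y(2), THEN bspec, OF x,
            THEN spec, THEN spec, THEN spec])
    have cb: "cbilinear (\<lambda>a b. J' y a * J' y' b)"
      using lin by (auto simp: cbilinear_def clinear_mult_complex)
    have "J' (y * y') x = J (y * y') x" using y x by (intro J' Ule)
    also have "\<dots> = (\<Sum>k<N. J y (a k) * J y' (b k))"
      by (rule ax[THEN mp, OF conjI, OF N])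
    also have "\<dots> = (\<Sum>k<N. J' y (a k) * J' y' (b k))"
      using N y by (intro sum.cong) (auto simp: J')
    also have "\<dots> = tensor_lift (\<lambda>a b. J' y a * J' y' b) (\<Delta> x)"
      unfolding N(2) by (simp add: cvec.linear_sum[OF clinear_tensor_lift] tensor_lift_tens[OF cb])
    finally show ?thesis .
  qed
  \<comment> \<open>Integer multiples of a single simple root; the multiples 0, 1 and -1 give the
    unit, \<open>K \<alpha>\<close> and \<open>Ki \<alpha>\<close>.\<close>
  let ?m = "\<lambda>\<alpha> (m::int) x. if x = \<alpha> then m else 0"
  have KK: "J (K_pow g \<alpha> m) (K_pow g \<alpha>' m') = q powi (- (m * m' * cartan \<alpha> \<alpha>'))"
    if "\<alpha> \<in> R" "\<alpha>' \<in> R" for \<alpha> \<alpha>' m m'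
    using k[THEN conjunct2, THEN conjunct2, THEN conjunct2, THEN conjunct1, THEN spec, THEN spec, of "?m \<alpha> m" "?m \<alpha>' m'"]
    by (simp only: K_lattice_single[OF that(1)] K_lattice_single[OF that(2)] lattice_form_single[OF that])
  have KE: "J (K_pow g \<alpha> m) (E \<alpha>') = 0" "J (F \<alpha>') (K_pow g \<alpha> m) = 0" if "\<alpha> \<in> R" "\<alpha>' \<in> R" for \<alpha> \<alpha>' m
    using k[THEN conjunct2, THEN conjunct2, THEN conjunct2, THEN conjunct2, THEN conjunct2, THEN bspec, OF that(2), THEN spec, of "?m \<alpha> m"]
    by (simp_all only: K_lattice_single[OF that(1)])
  have pow: "K_pow g \<alpha> 0 = 1" "K_pow g \<alpha> 1 = K \<alpha>" "K_pow g \<alpha> (-1) = Ki \<alpha>" for \<alpha>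
    by (simp_all add: K_pow_def)
  note KK' = KK[of _ _ 0 1, unfolded pow] KK[of _ _ 0 "-1", unfolded pow] KK[of _ _ 1 0, unfolded pow]
    KK[of _ _ "-1" 0, unfolded pow] KK[of _ _ "-1" 1, unfolded pow] KK[of _ _ 0 0, unfolded pow]
  note KE' = KE[of _ _ 0, unfolded pow] KE[of _ _ 1, unfolded pow] KE[of _ _ "-1", unfolded pow]
  have FE: "J (F \<alpha>) (E \<alpha>') = (if \<alpha> = \<alpha>' then c0 else 0)" if "\<alpha> \<in> R" "\<alpha>' \<in> R" for \<alpha> \<alpha>'
    using k[THEN conjunct2, THEN conjunct2, THEN conjunct2, THEN conjunct2, THEN conjunct1] that by simp
  have R0: "0 \<in> R" using n_pos by (simp add: simple_roots_def)
  note in_simps = gens Ule(3) Uge(3)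
  have "quantum_pairing n q g T \<Delta> J'"
  proof
    show "J' (Ki \<alpha>) (K \<alpha>') = q powi cartan \<alpha> \<alpha>'" if "\<alpha> \<in> R" "\<alpha>' \<in> R" for \<alpha> \<alpha>'
      using that KK'(5)[OF that] by (simp add: J' in_simps)
    show "J' 1 (K \<alpha>) = 1" "J' 1 (Ki \<alpha>) = 1" "J' (K \<alpha>) 1 = 1" "J' (Ki \<alpha>) 1 = 1" if "\<alpha> \<in> R" for \<alpha>
      using that KK'(1)[OF that that] KK'(2)[OF that that] KK'(3)[OF that that] KK'(4)[OF that that]
      by (simp_all add: J' in_simps)
    show "J' 1 1 = 1" using KK'(6)[OF R0 R0] by (simp add: J' in_simps)
    show "J' (Ki \<alpha>) (E \<alpha>') = 0" "J' (F \<alpha>) (K \<alpha>') = 0" "J' (F \<alpha>) (Ki \<alpha>') = 0" if "\<alpha> \<in> R" "\<alpha>' \<in> R" for \<alpha> \<alpha>'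
      using that KE' by (simp_all add: J' in_simps)
    show "J' 1 (E \<alpha>) = 0" "J' (F \<alpha>) 1 = 0" if "\<alpha> \<in> R" for \<alpha>
      using that KE'(1,2)[OF that that] by (simp_all add: J' in_simps)
    show "J' (F \<alpha>) (E \<alpha>') = (if \<alpha> = \<alpha>' then c0 else 0)" if "\<alpha> \<in> R" "\<alpha>' \<in> R" for \<alpha> \<alpha>'
      using FE[OF that] that by (simp only: J' in_simps)
  qed (simp_all add: functional_simps[OF lin(1)] functional_simps[OF lin(2)] right left)
  with J' that show thesis by blast
qed

theorem corollary7p2p2:
  fixes n :: nat and q \<gamma> :: complex
    and g :: "qgen \<Rightarrow> 'u::calg" and T :: "int \<Rightarrow> 'u \<Rightarrow> 'u"
    and \<Delta> :: "'u \<Rightarrow> ('u, 'u) tensor" and S :: "'u \<Rightarrow> 'u" and J :: "'u \<Rightarrow> 'u \<Rightarrow> complex"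
    and lmu lnu :: "nat \<Rightarrow> nat" and lam :: real and qlam :: complex
    and \<rho> :: "'u \<Rightarrow> 'v::cvec \<Rightarrow> 'v" and v\<^sub>0 :: 'v
    and \<kappa> :: "('u, 'v) tensor \<Rightarrow> 'm::cvec" and L :: "'u \<Rightarrow> 'm \<Rightarrow> 'm"
    and B :: "'m \<Rightarrow> ('u, 'v dual) tensor \<Rightarrow> complex"
    and \<xi> :: "('u, 'v dual) tensor"
  assumes "n \<ge> 1" and "q \<noteq> 0" and "\<forall>k>0. q ^ k \<noteq> 1" and "\<gamma> = q - inverse q"
    and "Uq_presented n q g"
    and "coproduct n g \<Delta>" and "antipode n g S"
    and "lusztig_automorphisms n q g T"
    and "q_Killing_form n q g \<Delta> J"
    and "real_power_value q lam qlam"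
    and "V_Lambda n q g T lmu lnu qlam \<rho> v\<^sub>0"
    and "induced_module (U_kA n g T) \<rho> \<kappa> L"
    and "Verma_pairing (A_minus n g T) (A_plus n g T) J \<kappa> B"
    and "\<xi> \<in> tensor_dual (A_plus n g T)"
  shows "dual_operator (A_plus n g T) S L B (g (GE beta)) \<xi> =
      tensor_map (lmult (Z_el g T 1 1)) id \<xi>
    - tensor_map (rmult (Z_el g T 1 1) \<circ> Ad_K g beta) (dual_action S \<rho> (g (GK beta) ^ 2)) \<xi>
    + (\<Sum>i=1..n-1. (\<gamma> * inverse q) *\<^sub>C
         tensor_map (rmult (Z_el g T (i+1) 1) \<circ> Ad_K g beta)
           (transpose_op (\<rho> (X_el g T i)) \<odot> dual_action S \<rho> (g (GK beta) ^ 2)) \<xi>)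
    + (\<Sum>j=1..n-1. (\<gamma> * inverse q) *\<^sub>C
         tensor_map (rmult (Z_el g T 1 (j+1)) \<circ> Ad_K g beta)
           (transpose_op (\<rho> (Y_el g T j)) \<odot> dual_action S \<rho> (g (GK beta) ^ 2)) \<xi>)
    - (\<Sum>i=1..n-1. \<Sum>j=1..n-1. (\<gamma>\<^sup>2 * inverse (q\<^sup>2)) *\<^sub>C
         tensor_map (rmult (Z_el g T (i+1) (j+1)) \<circ> Ad_K g beta)
           (transpose_op (\<rho> (X_el g T i)) \<odot> transpose_op (\<rho> (Y_el g T j)) \<odot> dual_action S \<rho> (g (GK beta) ^ 2)) \<xi>)"
proof -
  interpret quantum_group n q g T
    using assms(1,2,3,5,8) by unfold_locales auto
  interpret quantum_coproduct n q g T \<Delta>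
    using assms(6) by unfold_locales
  obtain J' where pair: "quantum_pairing n q g T \<Delta> J'"
    and J': "\<And>y x. y \<in> Ule \<Longrightarrow> x \<in> Uge \<Longrightarrow> J' y x = J y x"
    using pairing_extension[OF assms(9)] by blast
  interpret quantum_pairing n q g T \<Delta> J' by (fact pair)
  interpret generalized_Verma n q g T \<Delta> J' S \<rho> \<kappa> L B
  proof
    show "antipode n g S" "induced_module (U_kA n g T) \<rho> \<kappa> L" by fact+
    show "acts_on (U_kA n g T) \<rho>" using assms(11) by (simp add: V_Lambda_def)
    show "\<rho> (Z_el g T (Suc i) (Suc j)) v = 0" if "i < n" "j < n" for i j v
      using assms(11) that unfolding V_Lambda_def by auto
    \<comment> \<open>\<open>J\<close> and its extension agree on \<open>A_minus\<close> and
      \<open>A_plus\<close>, which lie in \<open>Ule\<close> and \<open>Uge\<close>, so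
      \<open>B\<close> is also the pairing built from \<open>J'\<close>.\<close>
    show "Verma_pairing Am Ap J' \<kappa> B"
      using assms(13) by (simp add: Verma_pairing_def J' Am_Um Um_Ule Ap_Up Up_Uge)
  qed
  show ?thesis
    unfolding dual_operator_eq[OF assms(14)] by (rule formula_expanded[OF assms(4)])
qed

end
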